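(* Let $d\in\mathbb{N}$ and let $f$ be an nc-holomorphic function on $\mathbb{D}^d_{\rm nc}$ satisfying $\|f(\underline{Z})\|\le 1$ for every $\underline{Z}\in\mathbb{D}^d_{\rm nc}$. Then there exists a sequence $\{\Theta_m\}_{m\ge1}$ of nc-rational inner functions on $\mathbb{D}^d_{\rm nc}$ such that $f$ can be approximated by $\Theta_m$ uniformly on each subset $K$ of $\mathbb{D}^d_{\rm nc}$ that is compact in the du-topology, that is, each $K\subset\mathbb{D}^d_{\rm nc}$ such that for each $n\in\mathbb{N}$ the set $K\cap\mathbb{M}_n^d$ is compact in the usual topology on $\mathbb{M}_n^d$.
   Context: For $n\in\mathbb{N}$, $\mathbb{M}_n$ is the space of $n\times n$ complex matrices with the operator norm, $\mathbb{M}_n^d$ is the set of $d$-tuples $\underline{Z}=(Z_1,\dots,Z_d)$ of such matrices, $\mathbb{M}^d=\bigsqcup_{n\ge1}\mathbb{M}_n^d$, and $\|\underline{Z}\|=\max_{1\le i\le d}\|Z_i\|$. The noncommutative polydisc is $\mathbb{D}^d_{\rm nc}=\{\underline{Z}\in\mathbb{M}^d:\|\underline{Z}\|<1\}$. Compactness of a set $K\subset\mathbb{D}^d_{\rm nc}$ in the du-topology is understood to mean: for each $n\in\mathbb{N}$, $K\cap\mathbb{M}_n^d$ is compact in the usual topology on $\mathbb{M}_n^d$. An nc-function on $\mathbb{D}^d_{\rm nc}$ is a map $f:\mathbb{D}^d_{\rm nc}\to\mathbb{M}^1$ such that (1) $f(\underline{X})\in\mathbb{M}_n$ whenever $\underline{X}\in\mathbb{D}^d_{\rm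 nc}\cap\mathbb{M}_n^d$, and (2) if $\underline{X},\underline{Y}\in\mathbb{D}^d_{\rm nc}$ and $s$ is any (possibly rectangular) matrix with $sX_i=Y_is$ for all $i$, then $sf(\underline{X})=f(\underline{Y})s$. It is nc-holomorphic on $\mathbb{D}^d_{\rm nc}$ if for each $n\ge1$ its restriction to $\mathbb{D}^d_{\rm nc}\cap\mathbb{M}_n^d$ is a holomorphic $\mathbb{M}_n$-valued function of the matrix entries. An nc rational expression is an expression built from noncommuting symbols $X_1,\dots,X_d$ using addition, multiplication, scalar multiplication and inverses; it is evaluated at tuples of matrices of any size where all the inverses occurring exist. An nc rational function is an equivalence class of nc rational expressions with nonempty domains, two expressions being identified if they agree on the intersection of their domains. Let $\mathbb{U}_n$ be the group of $n\times n$ unitary matrices and $\mathbb{U}_n^d$ the set of $d$-tuples of such matrices. An nc rational function $\Theta$ defined on $\mathbb{D}^d_{\rm nc}$ is called inner if, for every $n$, $\Theta(\underline{U})\in\mathbb{U}_n$ for almost all $\underline{U}\in\mathbb{U}_n^d$ with respect to the Haar measure of the group $\mathbb{U}_n^d$, where the boundary value is $\Theta(\underline{U})=\lim_{r\uparrow1}\Theta(rU_1,\dots,rU_d)$.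
   Formalization: Uniform convergence on all of K fails for some K meeting all levels (f=0, K the union over n of balls of radius 1-1/n in M_n); it is stated on each K∩M_n^d, and on all of K when the norm on K is bounded by some r<1, as when K meets finitely many levels. *)

theory Defs
  imports
    "HOL-Probability.Probability"
    "Jordan_Normal_Form.Gauss_Jordan_Elimination"
    "Jordan_Normal_Form.Schur_Decomposition"
begin

text \<open>
  Matrices are those of \<^theory>\<open>Jordan_Normal_Form.Matrix\<close>, whose size is part of the value, so
  that matrices of all sizes live in one type.  A \<open>d\<close>-tuple is a function on a finite index type
  \<^typ>\<open>'d\<close> with \<open>CARD('d) = d\<close>.
\<close>

type_synonym 'd mtuple = "'d \<Rightarrow> complex mat"


section \<open>Tuples of matrices, norms and topology\<close>

definition op_norm :: "complex mat \<Rightarrow> real" where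
  "op_norm A = (SUP v\<in>{v \<in> carrier_vec (dim_col A). L2_set (\<lambda>i. cmod (vec_index v i)) {..<dim_vec v} \<le> 1}.
      L2_set (\<lambda>i. cmod (vec_index (A *\<^sub>v v) i)) {..<dim_row A})"

definition nc_level :: "nat \<Rightarrow> ('d::finite) mtuple set" where
  "nc_level n = {Z. \<forall>i. Z i \<in> carrier_mat n n}"

definition nc_space :: "('d::finite) mtuple set" where
  "nc_space = (\<Union>n\<in>{1..}. nc_level n)"

definition nc_size :: "('d::finite) mtuple \<Rightarrow> nat" where
  "nc_size Z = (THE n. Z \<in> nc_level n)"

definition tuple_norm :: "('d::finite) mtuple \<Rightarrow> real" where
  "tuple_norm Z = Max (range (\<lambda>i. op_norm (Z i)))"

definition nc_disc :: "('d::finite) mtuple set" where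
  "nc_disc = {Z \<in> nc_space. tuple_norm Z < 1}"

text \<open>
  The usual topology of \<open>n \<times> n\<close> matrices is the topology of entrywise convergence.  Entries outside
  the index range of a matrix are unspecified and therefore replaced by \<open>0\<close>.
\<close>

definition mat_topology :: "nat \<Rightarrow> complex mat topology" where
  "mat_topology n = pullback_topology (carrier_mat n n)
     (\<lambda>A (i, j). if i < n \<and> j < n then A $$ (i, j) else 0) (euclidean :: (nat \<times> nat \<Rightarrow> complex) topology)"

definition tuple_topology :: "nat \<Rightarrow> ('d::finite) mtuple topology" where
  "tuple_topology n = product_topology (\<lambda>_. mat_topology n) UNIV"

definition levelwise_compact :: "('d::finite) mtuple set \<Rightarrow> bool" where
  "levelwise_compact K \<longleftrightarrow> (\<forall>n\<ge>1. compactin (tuple_topology n) (K \<inter> nc_level n))"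


section \<open>Noncommutative holomorphic functions\<close>

definition nc_function :: "(('d::finite) mtuple \<Rightarrow> complex mat) \<Rightarrow> bool" where
  "nc_function f \<longleftrightarrow>
     (\<forall>n\<ge>1. \<forall>X\<in>nc_disc \<inter> nc_level n. f X \<in> carrier_mat n n) \<and>
     (\<forall>n\<ge>1. \<forall>m\<ge>1. \<forall>X\<in>nc_disc \<inter> nc_level n. \<forall>Y\<in>nc_disc \<inter> nc_level m. \<forall>s\<in>carrier_mat m n.
        (\<forall>i. s * X i = Y i * s) \<longrightarrow> s * f X = f Y * s)"

text \<open>
  Holomorphy of a matrix-valued function of the \<open>d n\<^sup>2\<close> matrix entries: at \<open>Z\<close> there is a
  complex-linear Frechet derivative \<open>L\<close>.
\<close>

definition level_complex_differentiable ::
    "nat \<Rightarrow> (('d::finite) mtuple \<Rightarrow> complex mat) \<Rightarrow> 'd mtuple \<Rightarrow> bool" where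
  "level_complex_differentiable n f Z \<longleftrightarrow> (\<exists>L.
     (\<forall>H\<in>nc_level n. L H \<in> carrier_mat n n) \<and>
     (\<forall>H\<in>nc_level n. \<forall>H'\<in>nc_level n. L (\<lambda>i. H i + H' i) = L H + L H') \<and>
     (\<forall>c. \<forall>H\<in>nc_level n. L (\<lambda>i. c \<cdot>\<^sub>m H i) = c \<cdot>\<^sub>m L H) \<and>
     (\<forall>\<epsilon>>0. \<exists>\<delta>>0. \<forall>H\<in>nc_level n. tuple_norm H < \<delta> \<longrightarrow>
        op_norm (f (\<lambda>i. Z i + H i) - f Z - L H) \<le> \<epsilon> * tuple_norm H))"

definition nc_holomorphic :: "(('d::finite) mtuple \<Rightarrow> complex mat) \<Rightarrow> bool" where
  "nc_holomorphic f \<longleftrightarrow> nc_function f \<and>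
     (\<forall>n\<ge>1. \<forall>Z\<in>nc_disc \<inter> nc_level n. level_complex_differentiable n f Z)"


section \<open>Noncommutative rational functions\<close>

text \<open>
  The scalar \<open>c\<close> is itself an expression, evaluated as \<open>c\<close> times the identity matrix.
\<close>

datatype 'd nc_expr =
    NVar 'd
  | NConst complex
  | NAdd "'d nc_expr" "'d nc_expr"
  | NMult "'d nc_expr" "'d nc_expr"
  | NScale complex "'d nc_expr"
  | NInv "'d nc_expr"

primrec expr_eval :: "('d::finite) nc_expr \<Rightarrow> 'd mtuple \<Rightarrow> complex mat option" where
  "expr_eval (NVar i) Z = Some (Z i)"
| "expr_eval (NConst c) Z = Some (c \<cdot>\<^sub>m 1\<^sub>m (nc_size Z))"
| "expr_eval (NAdd r s) Z =
     Option.bind (expr_eval r Z) (\<lambda>A. Option.bind (expr_eval s Z) (\<lambda>B. Some (A + B)))"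
| "expr_eval (NMult r s) Z =
     Option.bind (expr_eval r Z) (\<lambda>A. Option.bind (expr_eval s Z) (\<lambda>B. Some (A * B)))"
| "expr_eval (NScale c r) Z = map_option (\<lambda>A. c \<cdot>\<^sub>m A) (expr_eval r Z)"
| "expr_eval (NInv r) Z = Option.bind (expr_eval r Z) mat_inverse"

definition expr_domain :: "('d::finite) nc_expr \<Rightarrow> 'd mtuple set" where
  "expr_domain r = {Z \<in> nc_space. expr_eval r Z \<noteq> None}"

definition expr_rel :: "(('d::finite) nc_expr \<times> 'd nc_expr) set" where
  "expr_rel = {(r, s). expr_domain r \<noteq> {} \<and> expr_domain s \<noteq> {} \<and>
     (\<forall>Z\<in>expr_domain r \<inter> expr_domain s. expr_eval r Z = expr_eval s Z)}"

definition nc_rational_functions :: "('d::finite) nc_expr set set" where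
  "nc_rational_functions = {r. expr_domain r \<noteq> {}} // expr_rel"

definition rat_domain :: "('d::finite) nc_expr set \<Rightarrow> 'd mtuple set" where
  "rat_domain R = (\<Union>r\<in>R. expr_domain r)"

definition rat_eval :: "('d::finite) nc_expr set \<Rightarrow> 'd mtuple \<Rightarrow> complex mat" where
  "rat_eval R Z = (THE W. \<exists>r\<in>R. Z \<in> expr_domain r \<and> expr_eval r Z = Some W)"


section \<open>Inner functions\<close>

definition unitary_mats :: "nat \<Rightarrow> complex mat set" where
  "unitary_mats n = {U \<in> carrier_mat n n. mat_adjoint U * U = 1\<^sub>m n \<and> U * mat_adjoint U = 1\<^sub>m n}"

definition unitary_tuples :: "nat \<Rightarrow> ('d::finite) mtuple set" where
  "unitary_tuples n = {U. \<forall>i. U i \<in> unitary_mats n}"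

text \<open>
  The Haar measure of the compact group of \<open>d\<close>-tuples of unitaries is its translation invariant
  Borel probability measure, which exists and is unique.
\<close>

definition is_haar_measure :: "nat \<Rightarrow> ('d::finite) mtuple measure \<Rightarrow> bool" where
  "is_haar_measure n \<mu> \<longleftrightarrow>
     prob_space \<mu> \<and>
     space \<mu> = unitary_tuples n \<and>
     sets \<mu> = sigma_sets (unitary_tuples n)
       {A. openin (subtopology (tuple_topology n) (unitary_tuples n)) A} \<and>
     (\<forall>V\<in>unitary_tuples n. distr \<mu> \<mu> (\<lambda>U i. V i * U i) = \<mu>)"

definition nc_inner :: "('d::finite) nc_expr set \<Rightarrow> bool" where
  "nc_inner R \<longleftrightarrow> R \<in> nc_rational_functions \<and> nc_disc \<subseteq> rat_domain R \<and>
     (\<forall>n\<ge>1. \<forall>\<mu>. is_haar_measure n \<mu> \<longrightarrow>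
        (AE U in \<mu>. \<exists>W\<in>unitary_mats n.
           limitin (mat_topology n) (\<lambda>r. rat_eval R (\<lambda>i. complex_of_real r \<cdot>\<^sub>m U i)) W (at_left 1)))"


section \<open>Uniform approximation\<close>

text \<open>
  A levelwise compact subset of the nc polydisc may meet every level and contain tuples of norm
  arbitrarily close to \<open>1\<close>.  Inner functions need not converge uniformly on all levels of such a set
  at once: if \<open>K \<inter> nc_level n\<close> is the closed ball of radius \<open>1 - 1 / n\<close>, then, as
  ampliations \<open>Z \<oplus> \<dots> \<oplus> Z\<close> of each \<open>Z\<close> in the nc polydisc belong to \<open>K\<close>, uniform convergence to \<open>0\<close>
  on \<open>K\<close> would be uniform convergence to \<open>0\<close> on the whole nc polydisc.  Uniform approximation
  therefore refers to each level of \<open>K\<close>, and to all levels of \<open>K\<close> together if the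
  norm is bounded away from \<open>1\<close> on \<open>K\<close>, as it is when \<open>K\<close> meets only finitely many levels.
\<close>

definition nc_uniform_limit_on ::
    "('d::finite) mtuple set \<Rightarrow> (nat \<Rightarrow> 'd mtuple \<Rightarrow> complex mat) \<Rightarrow> ('d mtuple \<Rightarrow> complex mat) \<Rightarrow> bool" where
  "nc_uniform_limit_on K g f \<longleftrightarrow>
     (\<forall>\<epsilon>>0. \<forall>\<^sub>F m in sequentially. \<forall>Z\<in>K. op_norm (g m Z - f Z) < \<epsilon>)"

end

theory Submission
  imports Defs "HOL-Complex_Analysis.Cauchy_Integral_Formula"
begin

text \<open>
  The theorem is a noncommutative Caratheodory theorem, and its proof is one of Caratheodory--Fejer
  interpolation: for every \<open>N\<close> there is a rational inner function whose Taylor coefficients agree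
  with those of \<open>f\<close> up to degree \<open>N\<close>.  Two functions bounded by \<open>1\<close> whose expansions agree up to
  degree \<open>N\<close> differ on \<open>\<parallel>Z\<parallel> \<le> r < 1\<close> by an amount that tends to \<open>0\<close> with \<open>N\<close>, uniformly in
  the size of the matrices, so the interpolants converge to \<open>f\<close>.

  The coefficients come from nilpotent tuples.  If all products of \<open>N + 1\<close> entries of \<open>X\<close> vanish,
  then vectors of the form \<open>X\<^sub>w v\<close> intertwine the creation operators of a truncated Fock space with \<open>X\<close>,
  hence \<open>f X = (\<Sum>w. a w X\<^sub>w)\<close> with coefficients read off from the single value of \<open>f\<close> at the (scaled)
  creation operators (\<open>nilpotent_calculus\<close>).  Tensoring an arbitrary \<open>Z\<close> with a Jordan block and
  perturbing the corner of that block shows that the same polynomial agrees with \<open>f\<close> along \<open>z Z\<close> to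
  order \<open>N + 1\<close> at \<open>z = 0\<close>, and Cauchy's estimates turn this into a uniform bound
  (\<open>polynomial_approximation\<close>).

  Contractivity of \<open>f\<close> on nilpotent contractions yields an Agler decomposition of
  \<open>1 - f(Z) f(Y)\<^sup>*\<close> modulo long words, with finite matrices as coefficients (\<open>schur_agler_defect\<close>).
  Indeed, the kernels that have such a decomposition form a closed convex cone; a functional that
  separates the kernel of \<open>f\<close> from it (\<open>defect_alternative\<close>) is, after a small perturbation, an inner product on the
  functions of words of length at most \<open>N\<close> for which appending a letter is a contraction.  The adjoints of these
  contractions form a nilpotent tuple at which \<open>f\<close> would not be a contraction
  (\<open>contractive_model_bound\<close>).

  The decomposition is an equality of Gram matrices, so a finite unitary matrix \<open>T\<close> carries one family
  of vectors to the other (\<open>lurking_unitary\<close>).  Regard \<open>T\<close> as a linear network with one external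
  channel and finitely many internal channels, and feed the output of each internal channel through one
  of the \<open>Z\<^sub>i\<close> back into its input.  The resulting transfer function \<open>\<Theta>\<close> has the prescribed coefficients, since
  unrolling the feedback loop \<open>N\<close> times reproduces them, and the rest is controlled by conservation of
  energy (\<open>realization_approximates\<close>).  Closing the loops one channel at a time writes \<open>\<Theta>\<close> as a rational
  expression all of whose inverses exist on the polydisc (\<open>state_elimination\<close>).

  Finally \<open>\<Theta>\<close> is inner because a unitary network closed through unitary matrices is again
  unitary.  Since everything is finite-dimensional, the loop can be closed for every tuple of unitaries, even where
  \<open>I - T U\<close> is singular (\<open>unitary_feedback\<close>), and the solutions for \<open>r U\<close> converge to those for \<open>U\<close>
  (\<open>radial_estimate\<close>).  So the radial limits exist and are unitary at every point, and
  the statement about almost all points with respect to Haar measure follows.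
\<close>

section \<open>Linear algebra on finite index sets\<close>

text \<open>
  Vectors are functions, of which only the values on a finite index set count, and matrices are
  kernels.  In this form index sets such as sets of words or products of sets need no enumeration.
\<close>

definition ip :: "'i set \<Rightarrow> ('i \<Rightarrow> complex) \<Rightarrow> ('i \<Rightarrow> complex) \<Rightarrow> complex" where
  "ip I x y = (\<Sum>i\<in>I. cnj (x i) * y i)"

definition nsq :: "'i set \<Rightarrow> ('i \<Rightarrow> complex) \<Rightarrow> real" where
  "nsq I x = (\<Sum>i\<in>I. (cmod (x i))\<^sup>2)"

definition act :: "'i set \<Rightarrow> ('i \<Rightarrow> 'i \<Rightarrow> complex) \<Rightarrow> ('i \<Rightarrow> complex) \<Rightarrow> 'i \<Rightarrow> complex" where
  "act I A x = (\<lambda>a. \<Sum>b\<in>I. A a b * x b)"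

definition isometric_on :: "'i set \<Rightarrow> ('i \<Rightarrow> 'i \<Rightarrow> complex) \<Rightarrow> bool" where
  "isometric_on I A \<longleftrightarrow> (\<forall>x y. ip I (act I A x) (act I A y) = ip I x y)"

lemma ip_self: "ip I x x = complex_of_real (nsq I x)"
  unfolding ip_def nsq_def of_real_sum
  by (rule sum.cong) (simp_all only: complex_norm_square mult.commute)

lemma nsq_nonneg [simp]: "nsq I x \<ge> 0"
  unfolding nsq_def by (simp add: sum_nonneg)

lemma cnj_ip: "cnj (ip I x y) = ip I y x"
  unfolding ip_def by (simp add: mult.commute)

lemma ip_add_right: "ip I x (\<lambda>i. y i + z i) = ip I x y + ip I x z"
  and ip_diff_right: "ip I x (\<lambda>i. y i - z i) = ip I x y - ip I x z"
  and ip_diff_left: "ip I (\<lambda>i. y i - z i) x = ip I y x - ip I z x"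
  and ip_scale_right: "ip I x (\<lambda>i. c * y i) = c * ip I x y"
  and ip_scale_left: "ip I (\<lambda>i. c * x i) y = cnj c * ip I x y"
  unfolding ip_def
  by (simp_all add: sum.distrib sum_subtractf algebra_simps sum_distrib_left)

lemma ip_cong: "(\<And>i. i \<in> I \<Longrightarrow> x i = x' i) \<Longrightarrow> (\<And>i. i \<in> I \<Longrightarrow> y i = y' i) \<Longrightarrow> ip I x y = ip I x' y'"
  unfolding ip_def by (auto intro: sum.cong)

lemma nsq_cong: "(\<And>i. i \<in> I \<Longrightarrow> x i = x' i) \<Longrightarrow> nsq I x = nsq I x'"
  unfolding nsq_def by (auto intro: sum.cong)

lemma act_cong: "(\<And>a b. a \<in> I \<Longrightarrow> b \<in> I \<Longrightarrow> A a b = A' a b) \<Longrightarrow> (\<And>i. i \<in> I \<Longrightarrow> x i = x' i) \<Longrightarrow> a \<in> I \<Longrightarrow> act I A x a = act I A' x' a"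
  unfolding act_def by (auto intro: sum.cong)

lemma act_diff: "act I A (\<lambda>i. x i - y i) a = act I A x a - act I A y a"
  and act_add: "act I A (\<lambda>i. x i + y i) a = act I A x a + act I A y a"
  and act_scale: "act I A (\<lambda>i. c * x i) a = c * act I A x a"
  unfolding act_def by (simp_all add: sum_subtractf sum.distrib algebra_simps sum_distrib_left)

lemma act_sum: "act I A (\<lambda>i. \<Sum>k\<in>K. x k i) a = (\<Sum>k\<in>K. act I A (x k) a)"
  unfolding act_def by (simp add: sum_distrib_left) (rule sum.swap)

lemma act_act: "act I A (act I B x) = act I (\<lambda>a b. \<Sum>c\<in>I. A a c * B c b) x"
proof
  fix a
  have "act I A (act I B x) a = (\<Sum>b\<in>I. \<Sum>c\<in>I. A a b * B b c * x c)"
    unfolding act_def by (simp add: sum_distrib_left mult.assoc)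
  also have "\<dots> = (\<Sum>c\<in>I. \<Sum>b\<in>I. A a b * B b c * x c)" by (rule sum.swap)
  also have "\<dots> = act I (\<lambda>a b. \<Sum>c\<in>I. A a c * B c b) x a"
    unfolding act_def by (simp add: sum_distrib_right)
  finally show "act I A (act I B x) a = act I (\<lambda>a b. \<Sum>c\<in>I. A a c * B c b) x a" .
qed

lemma isometric_on_nsq: "isometric_on I A \<Longrightarrow> nsq I (act I A x) = nsq I x"
  unfolding isometric_on_def using ip_self by (metis of_real_eq_iff)

lemma isometric_on_comp:
  assumes "isometric_on I A" "isometric_on I B"
  shows "isometric_on I (\<lambda>a b. \<Sum>c\<in>I. A a c * B c b)"
proof -
  have "act I (\<lambda>a b. \<Sum>c\<in>I. A a c * B c b) x = act I A (act I B x)" for x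
    by (rule act_act[symmetric])
  then show ?thesis using assms by (simp add: isometric_on_def)
qed

lemma act_delta:
  assumes "finite I" "a \<in> I"
  shows "act I (\<lambda>a b. of_bool (a = b)) x a = x a"
proof -
  have "act I (\<lambda>a b. of_bool (a = b)) x a = (\<Sum>b\<in>I. if a = b then x b else 0)"
    unfolding act_def by (rule sum.cong) auto
  then show ?thesis using assms by simp
qed

text \<open>
  The quasi-reflection \<open>x \<mapsto> x - \<langle>u, x\<rangle> / \<alpha> u\<close>.  It is unitary if \<open>2 Re \<alpha> = \<parallel>u\<parallel>\<^sup>2\<close>; a real
  \<open>\<alpha>\<close> gives the Householder reflection.
\<close>

definition reflection :: "('i \<Rightarrow> complex) \<Rightarrow> complex \<Rightarrow> 'i \<Rightarrow> 'i \<Rightarrow> complex" where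
  "reflection u \<alpha> = (\<lambda>a b. of_bool (a = b) - u a * cnj (u b) / \<alpha>)"

lemma act_reflection:
  assumes "finite I" "a \<in> I"
  shows "act I (reflection u \<alpha>) x a = x a - ip I u x / \<alpha> * u a"
proof -
  have "act I (reflection u \<alpha>) x a = act I (\<lambda>a b. of_bool (a = b)) x a - ip I u x / \<alpha> * u a"
  proof -
    have "(\<Sum>b\<in>I. reflection u \<alpha> a b * x b)
      = (\<Sum>b\<in>I. of_bool (a = b) * x b - (u a / \<alpha>) * (cnj (u b) * x b))"
      unfolding reflection_def left_diff_distrib by (rule sum.cong) simp_all
    then show ?thesis
      unfolding act_def ip_def sum_subtractf sum_distrib_left[symmetric] by simp
  qed
  then show ?thesis using act_delta[OF assms] by simp
qed

lemma isometric_on_reflection: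
  assumes "finite I" "\<alpha> + cnj \<alpha> = ip I u u"
  shows "isometric_on I (reflection u \<alpha>)"
  unfolding isometric_on_def
proof (intro allI)
  fix x y
  have "ip I (act I (reflection u \<alpha>) x) (act I (reflection u \<alpha>) y)
    = ip I (\<lambda>a. x a - ip I u x / \<alpha> * u a) (\<lambda>a. y a - ip I u y / \<alpha> * u a)"
    by (intro ip_cong act_reflection assms)
  also have "\<dots> = ip I x y - ip I u y / \<alpha> * ip I x u - cnj (ip I u x / \<alpha>) * ip I u y
      + cnj (ip I u x / \<alpha>) * (ip I u y / \<alpha>) * ip I u u"
  proof -
    have "ip I (\<lambda>a. x a - p * u a) (\<lambda>a. y a - q * u a)
      = ip I x y - q * ip I x u - cnj p * ip I u y + cnj p * q * ip I u u" for p q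
      by (simp add: ip_diff_left ip_diff_right ip_scale_left ip_scale_right algebra_simps)
    then show ?thesis .
  qed
  also have "\<dots> = ip I x y - ip I u y / \<alpha> * ip I x u - ip I x u / cnj \<alpha> * ip I u y
      + (ip I x u / cnj \<alpha>) * (ip I u y / \<alpha>) * (\<alpha> + cnj \<alpha>)"
    by (simp add: cnj_ip assms(2))
  also have "\<dots> = ip I x y"
    by (cases "\<alpha> = 0") (simp_all add: field_simps)
  finally show "ip I (act I (reflection u \<alpha>) x) (act I (reflection u \<alpha>) y) = ip I x y" .
qed

text \<open>
  Families with equal Gram matrices differ by a unitary.  The unitary is built one vector at
  a time: if \<open>x\<close> is the current image of the new vector \<open>l k\<close>, the quasi-reflection along
  \<open>x - r k\<close> moves \<open>x\<close> to \<open>r k\<close> and fixes the vectors \<open>r j\<close> that have been reached before, as they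
  are orthogonal to \<open>x - r k\<close>.  Isometry of the transposed kernel is recorded because the network
  below acts on rows.
\<close>

lemma lurking_unitary:
  fixes l r :: "'k \<Rightarrow> 'i \<Rightarrow> complex"
  assumes "finite F" "finite I"
    and "\<And>j k. j \<in> F \<Longrightarrow> k \<in> F \<Longrightarrow> ip I (l j) (l k) = ip I (r j) (r k)"
  shows "\<exists>U. isometric_on I U \<and> isometric_on I (\<lambda>a b. U b a) \<and> (\<forall>j\<in>F. \<forall>a\<in>I. act I U (l j) a = r j a)"
  using assms(1,3)
proof (induction F rule: finite_induct)
  case empty
  have "isometric_on I (\<lambda>a b. of_bool (a = b))"
    unfolding isometric_on_def by (intro allI ip_cong) (auto simp: act_delta assms(2))
  moreover have "(\<lambda>a b::'i. of_bool (b = a) :: complex) = (\<lambda>a b. of_bool (a = b))" by (auto simp: fun_eq_iff)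
  ultimately show ?case by (intro exI[of _ "\<lambda>a b. of_bool (a = b)"]) simp
next
  case (insert k F)
  then obtain U where U: "isometric_on I U" "isometric_on I (\<lambda>a b. U b a)"
    and Ul: "\<And>j a. j \<in> F \<Longrightarrow> a \<in> I \<Longrightarrow> act I U (l j) a = r j a" by auto
  define x where "x = act I U (l k)"
  define u where "u = (\<lambda>a. x a - r k a)"
  define \<alpha> where "\<alpha> = ip I u x"
  have xx: "ip I x x = ip I (r k) (r k)"
    using U(1) insert.prems by (simp add: x_def isometric_on_def)
  have orth: "ip I u (r j) = 0" if "j \<in> F" for j
  proof -
    have "ip I x (r j) = ip I x (act I U (l j))" by (intro ip_cong) (auto simp: Ul that)
    also have "\<dots> = ip I (l k) (l j)" using U(1) by (simp add: x_def isometric_on_def)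
    finally show ?thesis using insert.prems that by (simp add: u_def ip_diff_left)
  qed
  have sum: "\<alpha> + cnj \<alpha> = ip I u u"
    unfolding \<alpha>_def cnj_ip by (simp add: u_def ip_diff_left ip_diff_right xx)
  have sum': "\<alpha> + cnj \<alpha> = ip I (\<lambda>a. cnj (u a)) (\<lambda>a. cnj (u a))"
    unfolding sum by (simp add: ip_def mult.commute)
  define V where "V = (\<lambda>a b. \<Sum>c\<in>I. reflection u \<alpha> a c * U c b)"
  have R1: "isometric_on I (reflection u \<alpha>)" by (rule isometric_on_reflection[OF assms(2) sum])
  have "isometric_on I (reflection (\<lambda>a. cnj (u a)) \<alpha>)" by (rule isometric_on_reflection[OF assms(2) sum'])
  moreover have "reflection (\<lambda>a. cnj (u a)) \<alpha> = (\<lambda>a b. reflection u \<alpha> b a)"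
    by (auto simp: reflection_def fun_eq_iff)
  ultimately have R2: "isometric_on I (\<lambda>a b. reflection u \<alpha> b a)" by simp
  have V1: "isometric_on I V" unfolding V_def by (rule isometric_on_comp[OF R1 U(1)])
  have V2: "isometric_on I (\<lambda>a b. V b a)"
    using isometric_on_comp[OF U(2) R2] unfolding V_def by (simp add: mult.commute)
  have actV: "act I V y = act I (reflection u \<alpha>) (act I U y)" for y
    unfolding V_def by (rule act_act[symmetric])
  have "act I V (l j) a = r j a" if "j \<in> F" "a \<in> I" for j a
  proof -
    have "act I V (l j) a = act I (reflection u \<alpha>) (r j) a"
      unfolding actV by (intro act_cong) (auto simp: Ul that)
    then show ?thesis using orth[OF that(1)] by (simp add: act_reflection assms(2) that)
  qed
  moreover have "act I V (l k) a = r k a" if "a \<in> I" for a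
  proof -
    have "act I V (l k) a = x a - ip I u x / \<alpha> * u a"
      unfolding actV x_def[symmetric] by (simp add: act_reflection assms(2) that)
    also have "\<dots> = r k a"
    \<comment> \<open>If \<open>\<alpha> = 0\<close> then \<open>u\<close> vanishes, and division by zero makes the quasi-reflection the identity.\<close>
    proof (cases "\<alpha> = 0")
      case True
      then have "nsq I u = 0" using sum ip_self[of I u] by simp
      then have "u a = 0" using that assms(2) by (simp add: nsq_def sum_nonneg_eq_0_iff)
      then show ?thesis by (simp add: u_def)
    next
      case False
      then show ?thesis by (simp add: \<alpha>_def[symmetric]) (simp add: u_def)
    qed
    finally show ?thesis .
  qed
  ultimately show ?case using V1 V2 by (intro exI[of _ V]) auto
qed

section \<open>Positive semidefinite kernels\<close>

definition psd_on :: "'i set \<Rightarrow> ('i \<Rightarrow> 'i \<Rightarrow> complex) \<Rightarrow> bool" where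
  "psd_on I H \<longleftrightarrow> (\<forall>a\<in>I. \<forall>b\<in>I. H b a = cnj (H a b)) \<and> (\<forall>x. Re (ip I x (act I H x)) \<ge> 0)"

lemma psd_on_restrict:
  assumes "psd_on I H" "J \<subseteq> I" "finite I"
  shows "psd_on J H"
  unfolding psd_on_def
proof (intro conjI allI)
  show "\<forall>a\<in>J. \<forall>b\<in>J. H b a = cnj (H a b)" using assms by (auto simp: psd_on_def)
  fix x :: "'a \<Rightarrow> complex"
  define y where "y = (\<lambda>a. if a \<in> J then x a else 0)"
  have a: "act I H y a = act J H x a" for a
    unfolding act_def y_def by (rule sum.mono_neutral_cong_right) (use assms in auto)
  have "ip I y (act I H y) = ip J x (act J H x)"
    unfolding ip_def a by (rule sum.mono_neutral_cong_right) (use assms in \<open>auto simp: y_def\<close>)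
  then show "0 \<le> Re (ip J x (act J H x))" using assms(1) by (metis psd_on_def)
qed

lemma psd_on_2x2:
  assumes "psd_on I H" "finite I" "a \<in> I" "b \<in> I"
  shows "(cmod (H a b))\<^sup>2 \<le> Re (H a a) * Re (H b b)" and "Im (H a a) = 0" and "Re (H a a) \<ge> 0"
proof -
  have im: "Im (H c c) = 0" if "c \<in> I" for c
  proof -
    have "H c c = cnj (H c c)" using assms(1) that unfolding psd_on_def by blast
    then have "Im (H c c) = Im (cnj (H c c))" by (rule arg_cong)
    then show ?thesis by simp
  qed
  show "Im (H a a) = 0" by (rule im) fact
  have nn: "Re (H c c) \<ge> 0" if "c \<in> I" for c
  proof -
    have "psd_on {c} H" by (rule psd_on_restrict[OF assms(1)]) (use that assms in auto)
    then have "Re (ip {c} (\<lambda>_. 1) (act {c} H (\<lambda>_. 1))) \<ge> 0" by (auto simp: psd_on_def)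
    then show ?thesis by (simp add: ip_def act_def)
  qed
  show "Re (H a a) \<ge> 0" by (rule nn) fact
  show "(cmod (H a b))\<^sup>2 \<le> Re (H a a) * Re (H b b)"
  proof (cases "a = b")
    case True
    then show ?thesis using im[OF assms(3)] by (metis True add.right_neutral cmod_power2 order_refl power2_eq_square zero_power2)
  next
    case False
    have P: "psd_on {a, b} H" by (rule psd_on_restrict[OF assms(1)]) (use assms in auto)
    have ba: "H b a = cnj (H a b)" using assms(1,3,4) unfolding psd_on_def by blast
    have key: "Re (H a a) * (cmod s)\<^sup>2 + 2 * Re (cnj s * H a b * t) + Re (H b b) * (cmod t)\<^sup>2 \<ge> 0" for s t
    proof -
      define x where "x = (\<lambda>c. if c = a then s else t)"
      have "Re (ip {a, b} x (act {a, b} H x)) \<ge> 0" using P by (simp add: psd_on_def)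
      moreover have "ip {a, b} x (act {a, b} H x) = cnj s * H a a * s + cnj s * H a b * t + cnj t * cnj (H a b) * s + cnj t * H b b * t"
        using False ba by (simp add: ip_def act_def x_def algebra_simps)
      moreover have "Re (cnj t * cnj (H a b) * s) = Re (cnj s * H a b * t)"
        by (simp add: algebra_simps)
      moreover have "Re (cnj s * H a a * s) = Re (H a a) * (cmod s)\<^sup>2" "Re (cnj t * H b b * t) = Re (H b b) * (cmod t)\<^sup>2"
        using im[OF assms(3)] im[OF assms(4)] unfolding cmod_power2 by (simp_all add: power2_eq_square algebra_simps)
      ultimately show ?thesis by (simp only: plus_complex.sel)
    qed
    show ?thesis
    proof (cases "Re (H b b) = 0")
      case True
      have "(cmod (H a b))\<^sup>2 = 0"
      proof (rule ccontr)
        assume ne: "(cmod (H a b))\<^sup>2 \<noteq> 0"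
        define c where "c = (Re (H a a) + 1) / (cmod (H a b))\<^sup>2"
        have "Re (H a a) + 2 * Re (H a b * (- of_real c * cnj (H a b))) \<ge> 0"
          using key[of 1 "- of_real c * cnj (H a b)"] True by (simp add: mult.assoc)
        moreover have "Re (H a b * (- of_real c * cnj (H a b))) = - c * (cmod (H a b))\<^sup>2"
          unfolding cmod_power2 by (simp add: power2_eq_square algebra_simps)
        ultimately have "Re (H a a) - 2 * c * (cmod (H a b))\<^sup>2 \<ge> 0" by (simp only:)
        then show False using ne nn[OF assms(3)] by (simp add: c_def)
      qed
      then show ?thesis using True by simp
    next
      case False
      then have pos: "Re (H b b) > 0" using nn[OF assms(4)] by simp
      have "Re (H a a) * (Re (H b b))\<^sup>2 + 2 * Re (of_real (Re (H b b)) * H a b * (- cnj (H a b))) + Re (H b b) * (cmod (H a b))\<^sup>2 \<ge> 0"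
        using key[of "of_real (Re (H b b))" "- cnj (H a b)"] by (simp add: norm_mult)
      moreover have "Re (of_real (Re (H b b)) * H a b * (- cnj (H a b))) = - (Re (H b b) * (cmod (H a b))\<^sup>2)"
        unfolding cmod_power2 by (simp add: power2_eq_square algebra_simps)
      ultimately have "Re (H b b) * (Re (H a a) * Re (H b b) - (cmod (H a b))\<^sup>2) \<ge> 0"
        by (simp add: algebra_simps power2_eq_square)
      then show ?thesis using pos by (simp add: zero_le_mult_iff)
    qed
  qed
qed

text \<open>
  Cholesky factorization: subtracting \<open>cnj (qs a) * qs b\<close> with \<open>qs b = H s b / sqrt (H s s)\<close> clears the row and
  the column of \<open>s\<close> and leaves a positive semidefinite kernel on the other indices.
\<close>

lemma psd_on_factor:
  assumes "finite I" "psd_on I H"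
  shows "\<exists>q. \<forall>a\<in>I. \<forall>b\<in>I. H a b = (\<Sum>j\<in>I. cnj (q j a) * q j b)"
  using assms
proof (induction I arbitrary: H rule: finite_induct)
  case empty
  then show ?case by simp
next
  case (insert s I)
  have herm: "H b a = cnj (H a b)" if "a \<in> insert s I" "b \<in> insert s I" for a b
    using insert.prems that unfolding psd_on_def by blast
  define h where "h = Re (H s s)"
  have hs: "H s s = of_real h" "h \<ge> 0"
    using psd_on_2x2(2,3)[OF insert.prems, of s s] insert.hyps by (auto simp: h_def complex_eq_iff)
  define qs where "qs = (\<lambda>b. H s b / of_real (sqrt h))"
  define H' where "H' = (\<lambda>a b. H a b - cnj (qs a) * qs b)"
  have qss: "cnj (qs a) * qs s = H a s" if "a \<in> insert s I" for a
  proof (cases "h = 0")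
    case True
    have "(cmod (H a s))\<^sup>2 \<le> Re (H a a) * Re (H s s)"
      using psd_on_2x2(1)[OF insert.prems, of a s] insert.hyps that by simp
    then have "H a s = 0" using True by (simp add: h_def)
    then show ?thesis using True by (simp add: qs_def)
  next
    case False
    have "cnj (qs a) * qs s = H a s * of_real h / (of_real (sqrt h) * of_real (sqrt h))"
      using herm[OF _ that, of s] by (simp add: qs_def hs)
    also have "of_real (sqrt h) * of_real (sqrt h) = complex_of_real h"
      using hs(2) by (simp flip: of_real_mult)
    finally show ?thesis using False by simp
  qed
  have qsh: "cnj (qs a) * qs b * of_real h = cnj (H s a) * H s b" if "a \<in> insert s I" "b \<in> insert s I" for a b
  proof (cases "h = 0")
    case True
    have "(cmod (H s b))\<^sup>2 \<le> Re (H s s) * Re (H b b)"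
      using psd_on_2x2(1)[OF insert.prems, of s b] insert.hyps that by simp
    then have "H s b = 0" using True by (simp add: h_def)
    then show ?thesis using True by (simp add: qs_def)
  next
    case False
    have "of_real (sqrt h) * of_real (sqrt h) = complex_of_real h"
      using hs(2) by (simp flip: of_real_mult)
    then show ?thesis using False by (simp add: qs_def field_simps)
  qed
  have P': "psd_on I H'"
    unfolding psd_on_def
  proof (intro conjI allI ballI)
    fix a b assume "a \<in> I" "b \<in> I"
    then show "H' b a = cnj (H' a b)" using herm[of a b] by (simp add: H'_def mult.commute)
  next
    fix x :: "'a \<Rightarrow> complex"
    define c where "c = (\<Sum>b\<in>I. H s b * x b)"
    \<comment> \<open>This value at \<open>s\<close> minimises the form of \<open>H\<close> over all extensions of \<open>x\<close>.\<close>
    define y where "y = (\<lambda>a. if a = s then - c / of_real h else x a)"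
    have ne: "a \<noteq> s" if "a \<in> I" for a using that insert.hyps by auto
    have yI: "y a = x a" if "a \<in> I" for a using ne[OF that] by (simp add: y_def)
    have actI: "(\<Sum>b\<in>I. G b * y b) = (\<Sum>b\<in>I. G b * x b)" for G
      by (rule sum.cong) (auto simp: y_def ne)
    have act_y: "act (insert s I) H y a = act I H x a - H a s * c / of_real h" if "a \<in> insert s I" for a
      unfolding act_def using insert.hyps by (simp add: actI) (simp add: y_def)
    have "ip (insert s I) y (act (insert s I) H y) = cnj (y s) * act (insert s I) H y s + (\<Sum>a\<in>I. cnj (y a) * act (insert s I) H y a)"
      unfolding ip_def using insert.hyps by simp
    also have "(\<Sum>a\<in>I. cnj (y a) * act (insert s I) H y a) = (\<Sum>a\<in>I. cnj (x a) * (act I H x a - H a s * c / of_real h))"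
      by (rule sum.cong) (simp_all add: yI act_y)
    also have "\<dots> = ip I x (act I H x) - (\<Sum>a\<in>I. cnj (x a) * H a s) * c / of_real h"
      unfolding ip_def by (simp add: right_diff_distrib sum_subtractf sum_distrib_right sum_divide_distrib mult.assoc)
    also have "(\<Sum>a\<in>I. cnj (x a) * H a s) = cnj c"
    proof -
      have "(\<Sum>a\<in>I. cnj (x a) * H a s) = (\<Sum>a\<in>I. cnj (x a) * cnj (H s a))"
        by (rule sum.cong) (use herm[of s] in auto)
      then show ?thesis by (simp add: c_def mult.commute)
    qed
    also have "cnj (y s) * act (insert s I) H y s = 0"
    proof -
      have "act (insert s I) H y s = c - H s s * c / of_real h"
        using act_y[of s] by (simp add: c_def act_def)
      then show ?thesis by (simp add: hs y_def)
    qed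
    finally have e1: "ip (insert s I) y (act (insert s I) H y) = ip I x (act I H x) - cnj c * c / of_real h"
      by simp
    have "ip I x (act I H' x) = ip I x (act I H x) - (\<Sum>a\<in>I. \<Sum>b\<in>I. cnj (x a) * (cnj (qs a) * qs b) * x b)"
      unfolding ip_def act_def H'_def
      by (simp add: sum_subtractf algebra_simps sum_distrib_left)
    also have "(\<Sum>a\<in>I. \<Sum>b\<in>I. cnj (x a) * (cnj (qs a) * qs b) * x b) = cnj c * c / of_real h"
    proof -
      have "(\<Sum>a\<in>I. \<Sum>b\<in>I. cnj (x a) * (cnj (qs a) * qs b) * x b) = (\<Sum>a\<in>I. \<Sum>b\<in>I. cnj (x a) * cnj (H s a) * (H s b * x b) / of_real h)"
      proof (intro sum.cong refl)
        fix a b assume "a \<in> I" "b \<in> I"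
        then have q: "cnj (qs a) * qs b * of_real h = cnj (H s a) * H s b" using qsh[of a b] by simp
        have "cnj (qs a) * qs b = cnj (H s a) * H s b / of_real h"
        proof (cases "h = 0")
          case True then show ?thesis by (simp add: qs_def)
        next
          case False then show ?thesis using q by (simp add: field_simps)
        qed
        then show "cnj (x a) * (cnj (qs a) * qs b) * x b = cnj (x a) * cnj (H s a) * (H s b * x b) / of_real h"
          by (simp add: mult_ac)
      qed
      also have "\<dots> = cnj c * c / of_real h"
        unfolding c_def cnj_sum sum_product sum_divide_distrib by (intro sum.cong refl) simp
      finally show ?thesis .
    qed
    finally have "ip I x (act I H' x) = ip (insert s I) y (act (insert s I) H y)" using e1 by simp
    then show "0 \<le> Re (ip I x (act I H' x))" using insert.prems by (simp add: psd_on_def)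
  qed
  from insert.IH[OF P'] obtain q where q: "\<And>a b. a \<in> I \<Longrightarrow> b \<in> I \<Longrightarrow> H' a b = (\<Sum>j\<in>I. cnj (q j a) * q j b)" by blast
  define p where "p = (\<lambda>j a. if j = s then qs a else if a = s then 0 else q j a)"
  have "H a b = (\<Sum>j\<in>insert s I. cnj (p j a) * p j b)" if ab: "a \<in> insert s I" "b \<in> insert s I" for a b
  proof -
    have "(\<Sum>j\<in>insert s I. cnj (p j a) * p j b) = cnj (qs a) * qs b + (\<Sum>j\<in>I. cnj (p j a) * p j b)"
      using insert.hyps by (simp add: p_def)
    also have "(\<Sum>j\<in>I. cnj (p j a) * p j b) = (if a = s \<or> b = s then 0 else H' a b)"
    proof -
      have "(\<Sum>j\<in>I. cnj (p j a) * p j b) = (\<Sum>j\<in>I. if a = s \<or> b = s then 0 else cnj (q j a) * q j b)"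
        by (rule sum.cong) (use insert.hyps in \<open>auto simp: p_def\<close>)
      then show ?thesis using ab q by auto
    qed
    also have "cnj (qs a) * qs b + (if a = s \<or> b = s then 0 else H' a b) = H a b"
    proof (cases "b = s")
      case True then show ?thesis using qss[OF ab(1)] by simp
    next
      case False
      show ?thesis
      proof (cases "a = s")
        case True
        have "cnj (cnj (qs b) * qs s) = cnj (H b s)" using qss[OF ab(2)] by simp
        then show ?thesis using True herm[of b s] ab by (simp add: mult.commute)
      next
        case False with \<open>b \<noteq> s\<close> show ?thesis by (simp add: H'_def)
      qed
    qed
    finally show ?thesis by simp
  qed
  then show ?case by (intro exI[of _ p] ballI)
qed

section \<open>Closing the loops of a unitary network\<close>

text \<open>
  The equation \<open>z = M z\<close> on the channels \<open>S\<close> is solvable for every input on \<open>P\<close>, although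
  \<open>1 - M\<close> may be singular on \<open>S\<close>.  Closing a single channel \<open>s\<close> replaces \<open>M a b\<close> by
  \<open>M a b + M a s * M s b / (1 - M s s)\<close>.  If \<open>M s s = 1\<close>, the column and the row of \<open>s\<close> vanish
  elsewhere, because \<open>M\<close> is isometric; the channel is then decoupled, and the convention that division
  by zero gives zero yields the correct kernel.
\<close>

lemma unitary_feedback:
  assumes "finite S" "finite P" "P \<inter> S = {}" "isometric_on (P \<union> S) M"
  shows "\<exists>z. (\<forall>a\<in>P. z a = u a) \<and> (\<forall>a\<in>S. act (P \<union> S) M z a = z a)"
  using assms(1,3,4)
proof (induction S arbitrary: M rule: finite_induct)
  case empty
  show ?case by (rule exI[of _ u]) simp
next
  case (insert s S)
  define I where "I = P \<union> S"
  have fin: "finite I" "s \<notin> I" using assms(2) insert.hyps insert.prems(1) by (auto simp: I_def)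
  have PI: "P \<union> insert s S = insert s I" by (auto simp: I_def)
  have iso: "isometric_on (insert s I) M" using insert.prems(2) by (simp add: I_def)
  have act_ins: "act (insert s I) M z a = act I M z a + M a s * z s" for z a
    using fin by (simp add: act_def)
  have deg: "M s b = 0" if "M s s = 1" "b \<in> I" for b
  proof -
    define e where "e = (\<lambda>c a::'a. of_bool (a = c) :: complex)"
    have ae: "act (insert s I) M (e c) = (\<lambda>a. M a c)" if "c \<in> insert s I" for c
    proof
      fix a
      have "act (insert s I) M (e c) a = (\<Sum>d\<in>insert s I. if d = c then M a d else 0)"
        unfolding act_def e_def by (rule sum.cong) auto
      then show "act (insert s I) M (e c) a = M a c" using fin that by (simp del: sum.insert)
    qed
    have ipe: "ip (insert s I) (e c) x = x c" if "c \<in> insert s I" for c x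
    proof -
      have "ip (insert s I) (e c) x = (\<Sum>d\<in>insert s I. if d = c then x d else 0)"
        unfolding ip_def e_def by (rule sum.cong) auto
      then show  ?thesis using fin that by (simp del: sum.insert)
    qed
    have "nsq (insert s I) (\<lambda>a. M a s) = nsq (insert s I) (e s)"
      using isometric_on_nsq[OF iso, of "e s"] ae[of s] by simp
    also have "\<dots> = 1" using ip_self[of "insert s I" "e s"] ipe[of s "e s"] by (simp add: e_def)
    finally have "nsq I (\<lambda>a. M a s) = 0" using fin that by (simp add: nsq_def)
    then have col: "M a s = 0" if "a \<in> I" for a using that fin by (simp add: nsq_def sum_nonneg_eq_0_iff)
    have "ip (insert s I) (act (insert s I) M (e s)) (act (insert s I) M (e b)) = ip (insert s I) (e s) (e b)"
      using iso by (simp add: isometric_on_def)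
    moreover have "ip (insert s I) (e s) (e b) = 0" using ipe[of s "e b"] that fin by (auto simp: e_def)
    moreover have "ip (insert s I) (act (insert s I) M (e s)) (act (insert s I) M (e b)) = M s b"
      using that fin by (simp add: ae ip_def col)
    ultimately show  ?thesis by simp
  qed
  define ext where "ext = (\<lambda>z a. if a = s then (\<Sum>b\<in>I. M s b * z b) / (1 - M s s) else z a)"
  define M' where "M' = (\<lambda>a b. M a b + M a s * M s b / (1 - M s s))"
  have cong: "act I M (ext z) a = act I M z a" for z a
    unfolding act_def by (rule sum.cong) (use fin in \<open>auto simp: ext_def\<close>)
  have at_s: "act (insert s I) M (ext z) s = ext z s" for z
  proof (cases "M s s = 1")
    case True
    then show  ?thesis unfolding act_ins cong using deg[OF True] by (simp add: act_def ext_def)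
  next
    case False
    then have "1 - M s s \<noteq> 0" by simp
    then show  ?thesis unfolding act_ins cong by (simp add: act_def ext_def field_simps)
  qed
  have at_I: "act (insert s I) M (ext z) a = act I M' z a" for z a
    unfolding act_ins cong
    by (simp add: ext_def act_def M'_def algebra_simps sum.distrib sum_distrib_left sum_divide_distrib)
  have "isometric_on I M'"
    unfolding isometric_on_def
  proof (intro allI)
    fix x y
    have "ip (insert s I) (act (insert s I) M (ext x)) (act (insert s I) M (ext y)) = ip (insert s I) (ext x) (ext y)"
      using iso by (simp add: isometric_on_def)
    moreover have "ip (insert s I) (act (insert s I) M (ext x)) (act (insert s I) M (ext y))
      = cnj (ext x s) * ext y s + ip I (act I M' x) (act I M' y)"
      proof -
      have "(\<Sum>i\<in>I. cnj (act (insert s I) M (ext x) i) * act (insert s I) M (ext y) i)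
        = (\<Sum>i\<in>I. cnj (act I M' x i) * act I M' y i)"
        by (rule sum.cong) (simp_all only: at_I)
      then show  ?thesis unfolding ip_def using fin by (simp only: sum.insert at_s not_False_eq_True)
    qed
    moreover have "ip (insert s I) (ext x) (ext y) = cnj (ext x s) * ext y s + ip I x y"
      using fin by (auto simp: ip_def ext_def intro!: sum.cong)
    ultimately show "ip I (act I M' x) (act I M' y) = ip I x y" by simp
  qed
  then obtain z where z: "\<And>a. a \<in> P \<Longrightarrow> z a = u a" "\<And>a. a \<in> S \<Longrightarrow> act I M' z a = z a"
    using insert.IH[of M'] insert.prems(1) unfolding I_def by blast
  show ?case unfolding PI
  proof (intro exI[of _ "ext z"] conjI ballI)
    fix a assume "a \<in> P" then show "ext z a = u a" using z(1) insert.prems(1) by (auto simp: ext_def)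
  next
    fix a assume "a \<in> insert s S"
    then show "act (insert s I) M (ext z) a = ext z a"
      using at_s at_I z(2) fin by (cases "a = s") (auto simp: ext_def)
  qed
qed

section \<open>Kernels on words and their defects\<close>

definition words :: "nat \<Rightarrow> ('d::finite) list set" where
  "words N = {w. length w \<le> N}"

lemma finite_words [simp]: "finite (words N)"
  using finite_lists_length_le[of "UNIV :: 'd::finite set" N] by (simp add: words_def)

lemma Nil_in_words [simp]: "[] \<in> words N" by (simp add: words_def)

text \<open>
  The operator \<open>e\<^sub>w \<mapsto> e\<^sub>w\<^sub>i\<close> on functions of words, and below it the conjugation of a kernel by
  this operator.
\<close>

definition append_op :: "'d \<Rightarrow> ('d list \<Rightarrow> complex) \<Rightarrow> 'd list \<Rightarrow> complex" where
  "append_op i x w = (if w \<noteq> [] \<and> last w = i then x (butlast w) else 0)"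

definition append_ker :: "'d \<Rightarrow> ('d list \<Rightarrow> 'd list \<Rightarrow> complex) \<Rightarrow> 'd list \<Rightarrow> 'd list \<Rightarrow> complex" where
  "append_ker i H w v = (if w \<noteq> [] \<and> v \<noteq> [] \<and> last w = i \<and> last v = i then H (butlast w) (butlast v) else 0)"

lemma sum_append:
  fixes g :: "('d::finite) list \<Rightarrow> 'b::comm_monoid_add"
  shows "(\<Sum>w\<in>words N. if w \<noteq> [] \<and> last w = i then g (butlast w) else 0) = (\<Sum>u\<in>words N. if length u < N then g u else 0)"
proof -
  have "(\<Sum>w\<in>words N. if w \<noteq> [] \<and> last w = i then g (butlast w) else 0)
      = (\<Sum>w\<in>{w\<in>words N. w \<noteq> [] \<and> last w = i}. g (butlast w))"
    by (rule sum.inter_filter[symmetric]) simp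
  also have "\<dots> = (\<Sum>u\<in>{u\<in>words N. length u < N}. g u)"
    by (rule sum.reindex_bij_witness[of _ "\<lambda>u. u @ [i]" butlast]) (auto simp: words_def simp flip: length_greater_0_conv)
  also have "\<dots> = (\<Sum>u\<in>words N. if length u < N then g u else 0)"
    by (rule sum.inter_filter) simp
  finally show ?thesis .
qed

text \<open>
  The first-order condition at a minimum, for quadratic functions of a parameter \<open>t\<close>.
\<close>

lemma first_order_le:
  fixes b c :: real
  assumes "\<And>t. 0 < t \<Longrightarrow> t \<le> 1 \<Longrightarrow> 2 * t * b \<le> t\<^sup>2 * c"
  shows "b \<le> 0"
proof (rule ccontr)
  assume "\<not> b \<le> 0"
  then have b: "b > 0" by simp
  define t where "t = min 1 (b / (\<bar>c\<bar> + 1))"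
  have t: "0 < t" "t \<le> 1" using b by (simp_all add: t_def)
  have "2 * b \<le> t * c" using assms[OF t] t by (simp add: power2_eq_square)
  also have "t * c \<le> t * \<bar>c\<bar>" using t by (simp add: mult_left_mono)
  also have "\<dots> \<le> b / (\<bar>c\<bar> + 1) * \<bar>c\<bar>" by (rule mult_right_mono) (simp_all add: t_def)
  also have "\<dots> \<le> b" using b by (simp add: field_simps)
  finally show False using b by simp
qed

lemma psd_on_add_rank_one:
  assumes "psd_on I H" "t \<ge> 0"
  shows "psd_on I (\<lambda>a b. H a b + of_real t * (x a * cnj (x b)))"
  unfolding psd_on_def
proof (intro conjI ballI allI)
  fix a b assume "a \<in> I" "b \<in> I"
  then have "H b a = cnj (H a b)" using assms unfolding psd_on_def by blast
  then show "H b a + of_real t * (x b * cnj (x a)) = cnj (H a b + of_real t * (x a * cnj (x b)))" by simp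
next
  fix y
  have "ip I y (act I (\<lambda>a b. H a b + of_real t * (x a * cnj (x b))) y)
     = ip I y (act I H y) + of_real t * (ip I y x * ip I x y)"
    unfolding ip_def act_def sum_product
    by (simp add: algebra_simps sum.distrib sum_distrib_left)
  moreover have "ip I y x * ip I x y = of_real ((cmod (ip I x y))\<^sup>2)"
    using complex_norm_square[of "ip I x y"] by (simp add: cnj_ip mult.commute)
  moreover have "Re (ip I y (act I H y)) \<ge> 0" using assms(1) unfolding psd_on_def by blast
  ultimately show "0 \<le> Re (ip I y (act I (\<lambda>a b. H a b + of_real t * (x a * cnj (x b))) y))"
    using assms(2) by simp
qed

lemma psd_on_scale:
  assumes "psd_on I H" "t \<ge> 0"
  shows "psd_on I (\<lambda>a b. of_real t * H a b)"
  unfolding psd_on_def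
proof (intro conjI ballI allI)
  fix a b assume "a \<in> I" "b \<in> I"
  then have "H b a = cnj (H a b)" using assms unfolding psd_on_def by blast
  then show "of_real t * H b a = cnj (of_real t * H a b)" by simp
next
  fix y
  have "ip I y (act I (\<lambda>a b. of_real t * H a b) y) = of_real t * ip I y (act I H y)"
    unfolding ip_def act_def
    by (simp add: algebra_simps sum_distrib_left)
  moreover have "Re (ip I y (act I H y)) \<ge> 0" using assms(1) unfolding psd_on_def by blast
  ultimately show "0 \<le> Re (ip I y (act I (\<lambda>a b. of_real t * H a b) y))"
    using assms(2) by simp
qed

lemma ip_act_rank_one:
  "ip (I \<times> I) (\<lambda>p. E (fst p) (snd p)) (\<lambda>p. x (fst p) * cnj (x (snd p))) = cnj (ip I x (act I E x))"
  unfolding ip_def act_def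
  by (simp add: sum.cartesian_product' sum_distrib_left mult_ac)

lemma continuous_on_coordinate: "continuous_on A (\<lambda>h :: 'a \<Rightarrow> complex. h k)"
  by (rule continuous_on_subset[OF continuous_on_product_coordinates]) simp

text \<open>
  Families of kernels are functions on \<open>'d \<times> 'a \<times> 'a\<close>, so that Tychonoff's theorem applies.
\<close>

lemma compact_bounded_psd:
  "compact {h :: 'd \<times> 'a \<times> 'a \<Rightarrow> complex. (\<forall>k. cmod (h k) \<le> B) \<and> (\<forall>i. psd_on I (\<lambda>a b. h (i, a, b)))}"
proof -
  have "compactin (product_topology (\<lambda>_. euclidean) UNIV) (PiE UNIV (\<lambda>_::'d \<times> 'a \<times> 'a. cball (0::complex) B))"
    unfolding compactin_PiE by (simp add: compactin_euclidean_iff)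
  then have c: "compact (PiE UNIV (\<lambda>_::'d \<times> 'a \<times> 'a. cball (0::complex) B))"
    by (simp add: euclidean_product_topology compactin_euclidean_iff)
  have cl: "closed {h :: 'd \<times> 'a \<times> 'a \<Rightarrow> complex. \<forall>i. (\<forall>a\<in>I. \<forall>b\<in>I. h (i, b, a) = cnj (h (i, a, b))) \<and> (\<forall>x. 0 \<le> Re (ip I x (act I (\<lambda>a b. h (i, a, b)) x)))}"
    unfolding ip_def act_def Ball_def
    by (intro closed_Collect_all closed_Collect_conj closed_Collect_imp open_Collect_const
        closed_Collect_eq closed_Collect_le continuous_intros continuous_on_coordinate)
  have "{h :: 'd \<times> 'a \<times> 'a \<Rightarrow> complex. (\<forall>k. cmod (h k) \<le> B) \<and> (\<forall>i. psd_on I (\<lambda>a b. h (i, a, b)))}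
     = PiE UNIV (\<lambda>_::'d \<times> 'a \<times> 'a. cball (0::complex) B) \<inter> {h :: 'd \<times> 'a \<times> 'a \<Rightarrow> complex. \<forall>i. (\<forall>a\<in>I. \<forall>b\<in>I. h (i, b, a) = cnj (h (i, a, b))) \<and> (\<forall>x. 0 \<le> Re (ip I x (act I (\<lambda>a b. h (i, a, b)) x)))}"
    unfolding psd_on_def by (auto simp: PiE_def)
  then show ?thesis using compact_Int_closed[OF c cl] by simp
qed

text \<open>
  Up to complex conjugation, the coefficients of \<open>\<Sum>i. h\<^sub>i(Z) (1 - Z\<^sub>i Y\<^sub>i\<^sup>*) h\<^sub>i(Y)\<^sup>*\<close>, where \<open>H i\<close> is the kernel of
  \<open>h\<^sub>i(Z) h\<^sub>i(Y)\<^sup>*\<close>.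
\<close>

definition defect :: "nat \<Rightarrow> (('d::finite) \<Rightarrow> 'd list \<Rightarrow> 'd list \<Rightarrow> complex) \<Rightarrow> 'd list \<Rightarrow> 'd list \<Rightarrow> complex" where
  "defect N H w v = (\<Sum>i\<in>UNIV. H i w v - append_ker i (H i) w v)"

text \<open>
  A bounded defect has bounded sources.  With the weight \<open>2 ^ (- length w)\<close> the trace of the
  appended kernel is at most half of the trace of \<open>H i\<close>, so the weighted trace of the defect
  dominates half of the weighted traces of all the \<open>H i\<close>.  This makes the cone of defects closed.
\<close>

lemma defect_diag_bound:
  fixes H :: "('d::finite) \<Rightarrow> 'd list \<Rightarrow> 'd list \<Rightarrow> complex" and C :: real
  assumes psd: "\<And>i. psd_on (words N) (H i)"
    and bd: "\<And>w. w \<in> words N \<Longrightarrow> cmod (defect N H w w) \<le> C" and u: "u \<in> words N"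
  shows "Re (H i u u) \<le> 2 ^ Suc N * (card (words N :: 'd list set) * C)"
proof -
  define \<rho> where "\<rho> = (\<lambda>w::'d list. (1/2::real) ^ length w)"
  define W where "W = (words N :: 'd list set)"
  have nn: "Re (H i w w) \<ge> 0" if "w \<in> W" for i w
    using psd_on_2x2(3)[OF psd _ _ , of w w] that by (auto simp: W_def)
  have C0: "C \<ge> 0" using bd[of "[]"] norm_ge_zero[of "defect N H [] []"] by (simp del: norm_ge_zero)
  have half: "(\<Sum>w\<in>W. \<rho> w * Re (append_ker i (H i) w w)) \<le> (\<Sum>w\<in>W. \<rho> w * Re (H i w w)) / 2" for i
  proof -
    have "(\<Sum>w\<in>W. \<rho> w * Re (append_ker i (H i) w w))
      = (\<Sum>w\<in>W. if w \<noteq> [] \<and> last w = i then (\<lambda>u. \<rho> u / 2 * Re (H i u u)) (butlast w) else 0)"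
    proof (rule sum.cong[OF refl])
      fix w assume "w \<in> W"
      show "\<rho> w * Re (append_ker i (H i) w w) = (if w \<noteq> [] \<and> last w = i then (\<lambda>u. \<rho> u / 2 * Re (H i u u)) (butlast w) else 0)"
        by (cases w rule: rev_cases) (auto simp: append_ker_def \<rho>_def)
    qed
    also have "\<dots> = (\<Sum>u\<in>W. if length u < N then \<rho> u / 2 * Re (H i u u) else 0)"
      unfolding W_def by (rule sum_append)
    also have "\<dots> \<le> (\<Sum>u\<in>W. \<rho> u * Re (H i u u) / 2)"
      by (rule sum_mono) (simp add: \<rho>_def nn)
    finally show ?thesis by (simp add: sum_divide_distrib)
  qed
  have "(1/2) ^ N * Re (H i u u) \<le> \<rho> u * Re (H i u u)"
    using u nn[of u i] by (intro mult_right_mono) (auto simp: \<rho>_def words_def W_def power_decreasing)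
  also have "\<dots> \<le> (\<Sum>w\<in>W. \<rho> w * Re (H i w w))"
    by (rule member_le_sum) (use u nn in \<open>auto simp: W_def \<rho>_def\<close>)
  also have "\<dots> \<le> (\<Sum>j\<in>UNIV. \<Sum>w\<in>W. \<rho> w * Re (H j w w))"
    by (rule member_le_sum[where f = "\<lambda>j. \<Sum>w\<in>W. \<rho> w * Re (H j w w)"]) (use nn in \<open>auto simp: \<rho>_def intro!: sum_nonneg\<close>)
  also have "\<dots> \<le> 2 * (\<Sum>j\<in>UNIV. (\<Sum>w\<in>W. \<rho> w * Re (H j w w)) - (\<Sum>w\<in>W. \<rho> w * Re (append_ker j (H j) w w)))"
  proof -
    have "(\<Sum>j\<in>UNIV. \<Sum>w\<in>W. \<rho> w * Re (append_ker j (H j) w w)) \<le> (\<Sum>j\<in>UNIV. (\<Sum>w\<in>W. \<rho> w * Re (H j w w)) / 2)"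
      by (intro sum_mono half)
    then show ?thesis by (simp add: sum_subtractf flip: sum_divide_distrib)
  qed
  also have "(\<Sum>j\<in>UNIV. (\<Sum>w\<in>W. \<rho> w * Re (H j w w)) - (\<Sum>w\<in>W. \<rho> w * Re (append_ker j (H j) w w)))
      = (\<Sum>w\<in>W. \<rho> w * Re (defect N H w w))"
  proof -
    have "(\<Sum>w\<in>W. \<rho> w * Re (defect N H w w)) = (\<Sum>w\<in>W. \<Sum>j\<in>UNIV. \<rho> w * Re (H j w w) - \<rho> w * Re (append_ker j (H j) w w))"
      by (simp add: defect_def sum_distrib_left right_diff_distrib)
    also have "\<dots> = (\<Sum>j\<in>UNIV. \<Sum>w\<in>W. \<rho> w * Re (H j w w) - \<rho> w * Re (append_ker j (H j) w w))"
      by (rule sum.swap)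
    finally show ?thesis by (simp add: sum_subtractf)
  qed
  also have "(\<Sum>w\<in>W. \<rho> w * Re (defect N H w w)) \<le> (\<Sum>w\<in>W. C)"
  proof (rule sum_mono)
    fix w assume w: "w \<in> W"
    have "\<rho> w * Re (defect N H w w) \<le> \<rho> w * C"
      using bd[of w] complex_Re_le_cmod[of "defect N H w w"] w by (intro mult_left_mono) (auto simp: \<rho>_def W_def)
    also have "\<dots> \<le> 1 * C" using C0 by (intro mult_right_mono) (auto simp: \<rho>_def power_le_one)
    finally show "\<rho> w * Re (defect N H w w) \<le> C" by simp
  qed
  finally have "(1/2) ^ N * Re (H i u u) \<le> 2 * (card W * C)" by simp
  then have "2 ^ N * ((1/2) ^ N * Re (H i u u)) \<le> 2 ^ N * (2 * (card W * C))" by simp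
  then show ?thesis by (simp add: W_def power_one_over field_simps)
qed

lemma nsq_diff_scaled:
  "nsq P (\<lambda>p. x p - of_real t * y p) = nsq P x - 2 * t * Re (ip P x y) + t\<^sup>2 * nsq P y"
proof -
  have "complex_of_real (nsq P (\<lambda>p. x p - of_real t * y p)) = ip P (\<lambda>p. x p - of_real t * y p) (\<lambda>p. x p - of_real t * y p)"
    by (rule ip_self[symmetric])
  also have "\<dots> = ip P x x - of_real t * (ip P x y + cnj (ip P x y)) + (of_real t)\<^sup>2 * ip P y y"
    by (simp add: ip_diff_left ip_diff_right ip_scale_left ip_scale_right cnj_ip algebra_simps power2_eq_square)
  also have "ip P x y + cnj (ip P x y) = of_real (2 * Re (ip P x y))" by (rule complex_add_cnj)
  also have "ip P x x - of_real t * of_real (2 * Re (ip P x y)) + (of_real t)\<^sup>2 * ip P y y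
    = complex_of_real (nsq P x - 2 * t * Re (ip P x y) + t\<^sup>2 * nsq P y)"
    by (simp add: ip_self)
  finally show ?thesis unfolding of_real_eq_iff .
qed

text \<open>
  Separation of \<open>K\<close> from the cone of defects of positive semidefinite families.  The distance from \<open>K\<close> to
  the cone is attained, since by the previous bound the minimum may be taken over a compact set.  If the residual
  \<open>E\<close> at the nearest point is not zero, then \<open>L = - E\<close> separates: moving the minimiser in the
  direction of a rank one kernel shows that appending a letter decreases the form of \<open>L\<close>, and shrinking the
  minimiser shows that \<open>L\<close> is negative on \<open>K\<close>.
\<close>

theorem defect_alternative:
  fixes K :: "('d::finite) list \<Rightarrow> 'd list \<Rightarrow> complex"
  assumes herm: "\<And>w v. w \<in> words N \<Longrightarrow> v \<in> words N \<Longrightarrow> K v w = cnj (K w v)"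
  shows "(\<exists>H. (\<forall>i. psd_on (words N) (H i)) \<and> (\<forall>w\<in>words N. \<forall>v\<in>words N. K w v = defect N H w v))
    \<or> (\<exists>L. (\<forall>w\<in>words N. \<forall>v\<in>words N. L v w = cnj (L w v)) \<and>
        (\<forall>i x. Re (ip (words N) (append_op i x) (act (words N) L (append_op i x))) \<le> Re (ip (words N) x (act (words N) L x))) \<and>
        Re (ip (words N \<times> words N) (\<lambda>p. L (fst p) (snd p)) (\<lambda>p. K (fst p) (snd p))) < 0)"
proof -
  define W where "W = (words N :: 'd list set)"
  define H where "H = (\<lambda>(h :: 'd \<times> 'd list \<times> 'd list \<Rightarrow> complex) i w v. h (i, w, v))"
  define \<Lambda> where "\<Lambda> = (\<lambda>h p. defect N (H h) (fst p) (snd p))"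
  define k where "k = (\<lambda>p. K (fst p) (snd p))"
  define F where "F = (\<lambda>h. nsq (W \<times> W) (\<lambda>p. k p - \<Lambda> h p))"
  define C where "C = sqrt (nsq (W \<times> W) k) + sqrt (nsq (W \<times> W) k)"
  define B where "B = 2 ^ Suc N * (real (card W) * C)"
  define \<K> where "\<K> = {h :: 'd \<times> 'd list \<times> 'd list \<Rightarrow> complex. (\<forall>k. cmod (h k) \<le> B) \<and> (\<forall>i. psd_on W (\<lambda>a b. h (i, a, b)))}"
  have finW: "finite W" by (simp add: W_def)
  have \<Lambda>0: "\<Lambda> (\<lambda>_. 0) p = 0" for p by (simp add: \<Lambda>_def defect_def H_def append_ker_def)
  have F0: "F (\<lambda>_. 0) = nsq (W \<times> W) k" by (simp add: F_def \<Lambda>0)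
  have B0: "B \<ge> 0" by (simp add: B_def C_def)
  have zero_in: "(\<lambda>_. 0) \<in> \<K>"
    by (simp add: \<K>_def B0 psd_on_def ip_def act_def)
  have cont: "continuous_on \<K> F"
  proof -
    have 1: "continuous_on \<K> (\<lambda>h. H h i w v)" for i w v
      unfolding H_def by (rule continuous_on_coordinate)
    have 2: "continuous_on \<K> (\<lambda>h. append_ker i (H h i) w v)" for i w v
      unfolding append_ker_def by (cases "w \<noteq> [] \<and> v \<noteq> [] \<and> last w = i \<and> last v = i") (auto intro: 1)
    show ?thesis
      unfolding F_def nsq_def \<Lambda>_def defect_def by (intro continuous_intros 1 2)
  qed
  have "compact \<K>" unfolding \<K>_def by (rule compact_bounded_psd)
  then obtain h0 where h0: "h0 \<in> \<K>" and min0: "\<And>h. h \<in> \<K> \<Longrightarrow> F h0 \<le> F h"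
    using continuous_attains_inf[OF _ _ cont] zero_in by blast
  have entry: "cmod (x (w, v)) \<le> sqrt (nsq (W \<times> W) x)" if "w \<in> W" "v \<in> W" for x w v
  proof -
    have "(cmod (x (w, v)))\<^sup>2 \<le> nsq (W \<times> W) x"
      unfolding nsq_def by (rule member_le_sum) (use that finW in auto)
    then show ?thesis by (simp add: real_le_rsqrt)
  qed
  have min: "F h0 \<le> F h" if psd: "\<And>i. psd_on W (H h i)" for h
  proof (cases "F h \<le> F (\<lambda>_. 0)")
    case False
    then show ?thesis using min0[OF zero_in] by simp
  next
    case True
    have diag: "Re (H h i u u) \<le> B" if "u \<in> W" for i u
      unfolding B_def W_def
    proof (rule defect_diag_bound[where H = "H h"])
      show "psd_on (words N) (H h i)" for i using psd by (simp add: W_def)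
      show "u \<in> words N" using that by (simp add: W_def)
      fix w :: "'d list" assume "w \<in> words N"
      then have w: "w \<in> W" by (simp add: W_def)
      have "cmod (k (w, w) - \<Lambda> h (w, w)) \<le> sqrt (F h)"
        using entry[OF w w, of "\<lambda>p. k p - \<Lambda> h p"] by (simp add: F_def)
      also have "\<dots> \<le> sqrt (nsq (W \<times> W) k)" using True F0 by simp
      finally have "cmod (\<Lambda> h (w, w)) \<le> sqrt (nsq (W \<times> W) k) + cmod (k (w, w))"
        using norm_triangle_sub[of "\<Lambda> h (w, w)" "k (w, w)"] by (simp add: norm_minus_commute)
      then have "cmod (\<Lambda> h (w, w)) \<le> C" using entry[OF w w, of k] by (simp add: C_def)
      then show "cmod (defect N (H h) w w) \<le> C" by (simp add: \<Lambda>_def)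
    qed
    \<comment> \<open>\<open>F\<close> does not bound the entries outside \<open>W\<close>, so they are cut off.\<close>
    define h' where "h' = (\<lambda>(i, w, v). if w \<in> W \<and> v \<in> W then h (i, w, v) else 0)"
    have psd': "psd_on W (\<lambda>a b. h' (i, a, b))" for i
    proof -
      have eq: "act W (\<lambda>a b. h' (i, a, b)) x a = act W (H h i) x a" if "a \<in> W" for x a
        using that by (intro act_cong) (auto simp: h'_def H_def)
      have ip_eq: "ip W x (act W (\<lambda>a b. h' (i, a, b)) x) = ip W x (act W (H h i) x)" for x
        by (intro ip_cong eq) auto
      have h'H: "h' (i, a, b) = H h i a b" if "a \<in> W" "b \<in> W" for a b
        using that by (simp add: h'_def H_def)
      show ?thesis unfolding psd_on_def
      proof (intro conjI ballI allI)
        fix a b assume "a \<in> W" "b \<in> W"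
        then show "h' (i, b, a) = cnj (h' (i, a, b))"
          using psd[of i] unfolding psd_on_def h'H[OF \<open>a \<in> W\<close> \<open>b \<in> W\<close>] h'H[OF \<open>b \<in> W\<close> \<open>a \<in> W\<close>] by blast
      next
        fix x show "0 \<le> Re (ip W x (act W (\<lambda>a b. h' (i, a, b)) x))"
          using psd[of i] unfolding psd_on_def ip_eq by blast
      qed
    qed
    have "cmod (h' kk) \<le> B" for kk
    proof -
      obtain i w v where kk: "kk = (i, w, v)" by (cases kk)
      show ?thesis
      proof (cases "w \<in> W \<and> v \<in> W")
        case True
        have "(cmod (H h i w v))\<^sup>2 \<le> Re (H h i w w) * Re (H h i v v)"
          using psd_on_2x2(1)[OF psd finW] True by blast
        also have "\<dots> \<le> B * B"
          using True diag psd_on_2x2(3)[OF psd finW] B0 by (intro mult_mono) auto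
        finally have "(cmod (H h i w v))\<^sup>2 \<le> B\<^sup>2" by (simp only: power2_eq_square)
        then have "cmod (H h i w v) \<le> B" using B0 by (rule power2_le_imp_le)
        with True show ?thesis by (simp add: kk h'_def H_def)
      next
        case False
        then have "h' kk = 0" by (auto simp: kk h'_def)
        then show ?thesis using B0 by simp
      qed
    qed
    with psd' have "h' \<in> \<K>" by (simp add: \<K>_def)
    then have "F h0 \<le> F h'" by (rule min0)
    also have "F h' = F h"
    proof -
      have "append_ker i (H h' i) w v = append_ker i (H h i) w v" if "w \<in> W" "v \<in> W" for i w v
        using that unfolding append_ker_def H_def h'_def W_def words_def by auto
      then show ?thesis
        unfolding F_def by (intro nsq_cong) (auto simp: \<Lambda>_def defect_def H_def h'_def)
    qed
    finally show ?thesis .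
  qed
  have psd0: "psd_on W (H h0 i)" for i using h0 by (simp add: \<K>_def H_def)
  define E where "E = (\<lambda>p. k p - \<Lambda> h0 p)"
  have lin: "\<Lambda> (\<lambda>q. h q + of_real t * g q) p = \<Lambda> h p + of_real t * \<Lambda> g p" for h t g p
  proof -
    have "H (\<lambda>q. h q + of_real t * g q) i w v - append_ker i (H (\<lambda>q. h q + of_real t * g q) i) w v
      = (H h i w v - append_ker i (H h i) w v) + of_real t * (H g i w v - append_ker i (H g i) w v)" for i w v
      by (simp add: append_ker_def H_def right_diff_distrib)
    then show ?thesis
      unfolding \<Lambda>_def defect_def by (simp only: sum.distrib sum_distrib_left)
  qed
  have var: "Re (ip (W \<times> W) E (\<Lambda> g)) \<le> 0"
    if "\<And>t i. 0 < t \<Longrightarrow> t \<le> 1 \<Longrightarrow> psd_on W (H (\<lambda>q. h0 q + of_real t * g q) i)" for g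
  proof (rule first_order_le)
    fix t :: real assume t: "0 < t" "t \<le> 1"
    have "F h0 \<le> F (\<lambda>q. h0 q + of_real t * g q)" using that[OF t] by (rule min)
    also have "\<dots> = nsq (W \<times> W) (\<lambda>p. E p - of_real t * \<Lambda> g p)"
      unfolding F_def E_def lin by (simp add: algebra_simps)
    also have "\<dots> = nsq (W \<times> W) E - 2 * t * Re (ip (W \<times> W) E (\<Lambda> g)) + t\<^sup>2 * nsq (W \<times> W) (\<Lambda> g)"
      by (rule nsq_diff_scaled)
    also have "nsq (W \<times> W) E = F h0" by (simp add: F_def E_def)
    finally show "2 * t * Re (ip (W \<times> W) E (\<Lambda> g)) \<le> t\<^sup>2 * nsq (W \<times> W) (\<Lambda> g)" by simp
  qed
  have down: "Re (ip (W \<times> W) E (\<Lambda> h0)) \<ge> 0"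
  proof -
    have "Re (ip (W \<times> W) E (\<Lambda> (\<lambda>q. - h0 q))) \<le> 0"
    proof (rule var)
      fix t :: real and i assume "0 < t" "t \<le> 1"
      then have "psd_on W (\<lambda>a b. of_real (1 - t) * H h0 i a b)" by (intro psd_on_scale psd0) simp
      then show "psd_on W (H (\<lambda>q. h0 q + of_real t * - h0 q) i)" by (simp add: H_def algebra_simps)
    qed
    moreover have "\<Lambda> (\<lambda>q. - h0 q) p = - \<Lambda> h0 p" for p
      using lin[of "\<lambda>_. 0" "-1" h0 p] by (simp add: \<Lambda>0)
    ultimately show ?thesis by (simp add: ip_def sum_negf)
  qed
  show ?thesis
  proof (cases "nsq (W \<times> W) E = 0")
    case True
    have "K w v = defect N (H h0) w v" if "w \<in> words N" "v \<in> words N" for w v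
    proof -
      have "cmod (E (w, v)) \<le> 0" using entry[of w v E] that True by (simp add: W_def)
      then show ?thesis by (simp add: E_def k_def \<Lambda>_def)
    qed
    then show ?thesis using psd0 unfolding W_def by blast
  next
    case False
    define L where "L = (\<lambda>w v. - E (w, v))"
    have hermE: "E (v, w) = cnj (E (w, v))" if "w \<in> W" "v \<in> W" for w v
    proof -
      have h: "H h0 i b a = cnj (H h0 i a b)" if "a \<in> W" "b \<in> W" for i a b
        using psd0 that unfolding psd_on_def by blast
      have ba: "butlast w \<in> W" "butlast v \<in> W" using that by (auto simp: W_def words_def)
      have "append_ker i (H h0 i) v w = cnj (append_ker i (H h0 i) w v)" for i
        using h[OF ba] by (auto simp: append_ker_def)
      then show ?thesis
        using that h[OF that] herm[of w v] unfolding E_def k_def \<Lambda>_def defect_def by (simp add: W_def)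
    qed
    have "Re (ip W (append_op i x) (act W L (append_op i x))) \<le> Re (ip W x (act W L x))" for i x
    proof -
      define g where "g = (\<lambda>(j::'d, w, v). if j = i then x w * cnj (x v) else 0)"
      have "Re (ip (W \<times> W) E (\<Lambda> g)) \<le> 0"
      proof (rule var)
        fix t :: real and j assume t: "0 < t" "t \<le> 1"
        have "H (\<lambda>q. h0 q + of_real t * g q) j = (if j = i then (\<lambda>a b. H h0 j a b + of_real t * (x a * cnj (x b))) else H h0 j)"
          by (auto simp: H_def g_def fun_eq_iff)
        moreover have "psd_on W (\<lambda>a b. H h0 j a b + of_real t * (x a * cnj (x b)))"
          using t by (intro psd_on_add_rank_one psd0) simp
        ultimately show "psd_on W (H (\<lambda>q. h0 q + of_real t * g q) j)" using psd0 by (cases "j = i") simp_all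
      qed
      moreover have "\<Lambda> g p = x (fst p) * cnj (x (snd p)) - append_op i x (fst p) * cnj (append_op i x (snd p))" for p
      proof -
        have "\<Lambda> g p = (\<Sum>j\<in>UNIV. if j = i then x (fst p) * cnj (x (snd p)) - append_op i x (fst p) * cnj (append_op i x (snd p)) else 0)"
          unfolding \<Lambda>_def defect_def
          by (rule sum.cong[OF refl]) (auto simp: H_def g_def append_ker_def append_op_def)
        then show ?thesis by simp
      qed
      ultimately have "Re (ip (W \<times> W) E (\<lambda>p. x (fst p) * cnj (x (snd p)) - append_op i x (fst p) * cnj (append_op i x (snd p)))) \<le> 0"
        by (simp add: ip_def)
      then have "Re (ip W x (act W (\<lambda>w v. E (w, v)) x)) \<le> Re (ip W (append_op i x) (act W (\<lambda>w v. E (w, v)) (append_op i x)))"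
        using ip_act_rank_one[of W "\<lambda>w v. E (w, v)"] by (simp add: ip_diff_right)
      then show ?thesis by (simp add: L_def act_def ip_def sum_negf)
    qed
    moreover have "Re (ip (W \<times> W) (\<lambda>p. L (fst p) (snd p)) k) < 0"
    proof -
      have "ip (W \<times> W) (\<lambda>p. L (fst p) (snd p)) k = - ip (W \<times> W) E (\<lambda>p. E p + \<Lambda> h0 p)"
      proof -
        have "k = (\<lambda>p. E p + \<Lambda> h0 p)" by (simp add: E_def)
        then show ?thesis by (simp add: L_def ip_def sum_negf)
      qed
      also have "\<dots> = - (of_real (nsq (W \<times> W) E) + ip (W \<times> W) E (\<Lambda> h0))"
        by (simp add: ip_add_right ip_self)
      finally have "Re (ip (W \<times> W) (\<lambda>p. L (fst p) (snd p)) k) = - nsq (W \<times> W) E - Re (ip (W \<times> W) E (\<Lambda> h0))"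
        by simp
      moreover have "nsq (W \<times> W) E > 0" using False nsq_nonneg[of "W \<times> W" E] by linarith
      ultimately show ?thesis using down by linarith
    qed
    moreover have "\<forall>w\<in>W. \<forall>v\<in>W. L v w = cnj (L w v)"
    proof (intro ballI)
      fix w v assume "w \<in> W" "v \<in> W"
      from hermE[OF this] show "L v w = cnj (L w v)" unfolding L_def by simp
    qed
    ultimately show ?thesis unfolding W_def k_def by blast
  qed
qed

section \<open>Operator norms and words in matrices\<close>

abbreviation ent :: "complex mat \<Rightarrow> nat \<Rightarrow> nat \<Rightarrow> complex" where
  "ent A \<equiv> \<lambda>i j. A $$ (i, j)"

abbreviation mat_act :: "nat \<Rightarrow> complex mat \<Rightarrow> (nat \<Rightarrow> complex) \<Rightarrow> nat \<Rightarrow> complex" where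
  "mat_act n A \<equiv> act {..<n} (ent A)"

lemma mult_self_le_imp_le:
  fixes s b :: real
  assumes "s * s \<le> s * b" "0 \<le> s" "0 \<le> b"
  shows "s \<le> b"
proof (cases "s = 0")
  case False
  then have "0 < s" using assms(2) by simp
  with assms(1) show ?thesis by (rule mult_left_le_imp_le)
qed (use assms in simp)

lemma L2_set_nsq: "L2_set (\<lambda>i. cmod (x i)) I = sqrt (nsq I x)"
  by (simp add: L2_set_def nsq_def)

lemma nsq_scale: "nsq I (\<lambda>i. c * x i) = (cmod c)\<^sup>2 * nsq I x"
  by (simp add: nsq_def norm_mult power_mult_distrib sum_distrib_left)

lemma entry_le_nsq: "finite I \<Longrightarrow> i \<in> I \<Longrightarrow> (cmod (x i))\<^sup>2 \<le> nsq I x"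
  unfolding nsq_def by (rule member_le_sum) auto

lemma sqrt_nsq_add: "sqrt (nsq I (\<lambda>i. x i + y i)) \<le> sqrt (nsq I x) + sqrt (nsq I y)"
proof -
  have "sqrt (nsq I (\<lambda>i. x i + y i)) = L2_set (\<lambda>i. cmod (x i + y i)) I" by (simp add: L2_set_nsq)
  also have "\<dots> \<le> L2_set (\<lambda>i. cmod (x i) + cmod (y i)) I"
    by (rule L2_set_mono) (simp_all add: norm_triangle_ineq)
  also have "\<dots> \<le> L2_set (\<lambda>i. cmod (x i)) I + L2_set (\<lambda>i. cmod (y i)) I" by (rule L2_set_triangle_ineq)
  finally show ?thesis by (simp add: L2_set_nsq)
qed

lemma cmod_ip_le: "cmod (ip I x y) \<le> sqrt (nsq I x) * sqrt (nsq I y)"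
proof -
  have "cmod (ip I x y) \<le> (\<Sum>i\<in>I. \<bar>cmod (x i)\<bar> * \<bar>cmod (y i)\<bar>)"
    unfolding ip_def by (rule order_trans[OF norm_sum]) (simp add: norm_mult)
  also have "\<dots> \<le> L2_set (\<lambda>i. cmod (x i)) I * L2_set (\<lambda>i. cmod (y i)) I"
    by (rule L2_set_mult_ineq)
  finally show ?thesis by (simp add: L2_set_nsq)
qed

lemma mult_mat_entry:
  assumes "A \<in> carrier_mat n m" "B \<in> carrier_mat m k" "i < n" "j < k"
  shows "(A * B) $$ (i, j) = (\<Sum>r<m. A $$ (i, r) * B $$ (r, j))"
  using assms by (auto simp: scalar_prod_def atLeast0LessThan intro!: sum.cong)

lemma mult_vec_entry:
  assumes "A \<in> carrier_mat n m" "v \<in> carrier_vec m" "i < n"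
  shows "vec_index (A *\<^sub>v v) i = (\<Sum>r<m. A $$ (i, r) * vec_index v r)"
  using assms by (auto simp: scalar_prod_def atLeast0LessThan intro!: sum.cong)

lemma op_norm_set_bounded:
  assumes A: "A \<in> carrier_mat n n"
  shows "bdd_above ((\<lambda>v. L2_set (\<lambda>i. cmod (vec_index (A *\<^sub>v v) i)) {..<dim_row A}) `
    {v \<in> carrier_vec (dim_col A). L2_set (\<lambda>i. cmod (vec_index v i)) {..<dim_vec v} \<le> 1})"
proof (rule bdd_aboveI2)
  fix v assume "v \<in> {v \<in> carrier_vec (dim_col A). L2_set (\<lambda>i. cmod (vec_index v i)) {..<dim_vec v} \<le> 1}"
  then have v: "v \<in> carrier_vec n" and v1: "L2_set (\<lambda>i. cmod (vec_index v i)) {..<n} \<le> 1" using A by auto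
  have vj: "cmod (vec_index v j) \<le> 1" if "j < n" for j
    using member_le_L2_set[of "{..<n}" j "\<lambda>i. cmod (vec_index v i)"] that v1 by simp
  have "L2_set (\<lambda>i. cmod (vec_index (A *\<^sub>v v) i)) {..<n} \<le> (\<Sum>i<n. cmod (vec_index (A *\<^sub>v v) i))"
    by (rule L2_set_le_sum) simp
  also have "\<dots> \<le> (\<Sum>i<n. \<Sum>j<n. cmod (A $$ (i, j)))"
  proof (rule sum_mono)
    fix i assume "i \<in> {..<n}"
    then have "cmod (vec_index (A *\<^sub>v v) i) = cmod (\<Sum>j<n. A $$ (i, j) * vec_index v j)"
      using mult_vec_entry[OF A v] by simp
    also have "\<dots> \<le> (\<Sum>j<n. cmod (A $$ (i, j) * vec_index v j))" by (rule norm_sum)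
    also have "\<dots> \<le> (\<Sum>j<n. cmod (A $$ (i, j)))"
    proof (rule sum_mono)
      fix j assume "j \<in> {..<n}"
      then show "cmod (A $$ (i, j) * vec_index v j) \<le> cmod (A $$ (i, j))"
        using vj[of j] mult_left_mono[of "cmod (vec_index v j)" 1 "cmod (A $$ (i, j))"] by (simp add: norm_mult)
    qed
    finally show "cmod (vec_index (A *\<^sub>v v) i) \<le> (\<Sum>j<n. cmod (A $$ (i, j)))" .
  qed
  finally show "L2_set (\<lambda>i. cmod (vec_index (A *\<^sub>v v) i)) {..<dim_row A} \<le> (\<Sum>i<n. \<Sum>j<n. cmod (A $$ (i, j)))"
    using A by simp
qed

lemma L2_mult_vec:
  assumes A: "A \<in> carrier_mat n n"
  shows "L2_set (\<lambda>i. cmod (vec_index (A *\<^sub>v vec n x) i)) {..<dim_row A} = sqrt (nsq {..<n} (mat_act n A x))"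
proof -
  have d: "dim_row A = n" using A by simp
  have "L2_set (\<lambda>i. cmod (vec_index (A *\<^sub>v vec n x) i)) {..<n} = L2_set (\<lambda>i. cmod (mat_act n A x i)) {..<n}"
    by (rule L2_set_cong) (use mult_vec_entry[OF A, of "vec n x"] in \<open>auto simp: act_def intro!: arg_cong[where f=cmod] sum.cong\<close>)
  then show ?thesis unfolding d by (simp add: L2_set_nsq)
qed

lemma op_norm_le:
  assumes A: "A \<in> carrier_mat n n" and b: "b \<ge> 0"
    and bd: "\<And>x. nsq {..<n} (mat_act n A x) \<le> b\<^sup>2 * nsq {..<n} x"
  shows "op_norm A \<le> b"
  unfolding op_norm_def
proof (rule cSUP_least)
  show "{v \<in> carrier_vec (dim_col A). L2_set (\<lambda>i. cmod (vec_index v i)) {..<dim_vec v} \<le> 1} \<noteq> {}"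
  proof -
    have "0\<^sub>v n \<in> {v \<in> carrier_vec (dim_col A). L2_set (\<lambda>i. cmod (vec_index v i)) {..<dim_vec v} \<le> 1}"
      using A by (auto simp: L2_set_def)
    then show ?thesis by blast
  qed
  fix v assume "v \<in> {v \<in> carrier_vec (dim_col A). L2_set (\<lambda>i. cmod (vec_index v i)) {..<dim_vec v} \<le> 1}"
  then have v: "v \<in> carrier_vec n" and v1: "L2_set (\<lambda>i. cmod (vec_index v i)) {..<n} \<le> 1" using A by auto
  have "v = vec n (vec_index v)" using v by auto
  then have "L2_set (\<lambda>i. cmod (vec_index (A *\<^sub>v v) i)) {..<dim_row A} = sqrt (nsq {..<n} (mat_act n A (vec_index v)))"
    using L2_mult_vec[OF A, of "vec_index v"] by simp
  also have "\<dots> \<le> sqrt (b\<^sup>2 * nsq {..<n} (vec_index v))" using bd by simp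
  also have "\<dots> = b * sqrt (nsq {..<n} (vec_index v))" using b by (simp add: real_sqrt_mult)
  also have "\<dots> \<le> b * 1" using v1 b by (intro mult_left_mono) (simp_all add: L2_set_nsq)
  finally show "L2_set (\<lambda>i. cmod (vec_index (A *\<^sub>v v) i)) {..<dim_row A} \<le> b" by simp
qed

lemma nsq_act_op_norm:
  assumes A: "A \<in> carrier_mat n n"
  shows "nsq {..<n} (mat_act n A x) \<le> (op_norm A)\<^sup>2 * nsq {..<n} x" and "op_norm A \<ge> 0"
proof -
  have upper: "sqrt (nsq {..<n} (mat_act n A y)) \<le> op_norm A" if "nsq {..<n} y \<le> 1" for y
  proof -
    have y: "vec n y \<in> {v \<in> carrier_vec (dim_col A). L2_set (\<lambda>i. cmod (vec_index v i)) {..<dim_vec v} \<le> 1}"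
    proof -
      have "L2_set (\<lambda>i. cmod (vec_index (vec n y) i)) {..<n} = L2_set (\<lambda>i. cmod (y i)) {..<n}"
        by (rule L2_set_cong) auto
      then show ?thesis using A that by (simp add: L2_set_nsq)
    qed
    show ?thesis unfolding op_norm_def L2_mult_vec[OF A, symmetric]
      by (rule cSUP_upper[OF y op_norm_set_bounded[OF A]])
  qed
  show nn: "op_norm A \<ge> 0"
    using upper[of "\<lambda>_. 0"] by (simp add: nsq_def act_def)
  show "nsq {..<n} (mat_act n A x) \<le> (op_norm A)\<^sup>2 * nsq {..<n} x"
  proof (cases "nsq {..<n} x = 0")
    case True
    then have "x i = 0" if "i < n" for i using that by (simp add: nsq_def sum_nonneg_eq_0_iff)
    then have "nsq {..<n} (mat_act n A x) = 0" by (simp add: nsq_def act_def)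
    then show ?thesis using True by simp
  next
    case False
    define s where "s = sqrt (nsq {..<n} x)"
    have s: "s > 0" "s\<^sup>2 = nsq {..<n} x" using False by (simp_all add: s_def less_le)
    have "nsq {..<n} (\<lambda>i. of_real (1/s) * x i) \<le> 1"
      unfolding nsq_scale s(2)[symmetric] using s by (simp add: power_divide norm_divide)
    from upper[OF this] have "nsq {..<n} (mat_act n A (\<lambda>i. of_real (1/s) * x i)) \<le> (op_norm A)\<^sup>2"
      by (metis nn nsq_nonneg real_le_lsqrt real_sqrt_le_iff real_sqrt_abs abs_of_nonneg sqrt_le_D)
    then have "nsq {..<n} (\<lambda>i. of_real (1/s) * mat_act n A x i) \<le> (op_norm A)\<^sup>2"
      unfolding act_scale .
    then have "nsq {..<n} (mat_act n A x) / s\<^sup>2 \<le> (op_norm A)\<^sup>2"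
      unfolding nsq_scale by (simp add: power_divide norm_divide)
    then have "nsq {..<n} (mat_act n A x) \<le> (op_norm A)\<^sup>2 * s\<^sup>2"
      using s(1) by (simp only: pos_divide_le_eq zero_less_power)
    then show ?thesis by (simp only: s(2))
  qed
qed

lemma tuple_norm_le_iff: "tuple_norm Z \<le> r \<longleftrightarrow> (\<forall>i. op_norm (Z i) \<le> r)"
  and tuple_norm_less_iff: "tuple_norm Z < r \<longleftrightarrow> (\<forall>i. op_norm (Z i) < r)"
  unfolding tuple_norm_def by (subst Max_le_iff Max_less_iff; auto)+

lemma op_norm_le_tuple_norm: "op_norm (Z i) \<le> tuple_norm Z"
  using tuple_norm_le_iff[of Z "tuple_norm Z"] by simp

lemma nc_level_carrier: "Z \<in> nc_level n \<Longrightarrow> Z i \<in> carrier_mat n n"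
  by (simp add: nc_level_def)

lemma nc_disc_level_iff:
  assumes "n \<ge> 1"
  shows "Z \<in> nc_disc \<inter> nc_level n \<longleftrightarrow> Z \<in> nc_level n \<and> tuple_norm Z < 1"
  using assms by (auto simp: nc_disc_def nc_space_def)

lemma nc_size_level: 
  assumes "Z \<in> nc_level n" shows "nc_size Z = n"
  unfolding nc_size_def
proof (rule the_equality)
  fix m assume "Z \<in> nc_level m"
  then show "m = n" using assms nc_level_carrier by (metis carrier_matD(1))
qed (rule assms)

text \<open>
  The vector \<open>Z\<^sub>w x\<close>, where \<open>Z\<^sub>w\<close> is the product of the entries of \<open>Z\<close> along the word \<open>w\<close>.
\<close>

primrec word_act :: "nat \<Rightarrow> ('d::finite) mtuple \<Rightarrow> 'd list \<Rightarrow> (nat \<Rightarrow> complex) \<Rightarrow> nat \<Rightarrow> complex" where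
  "word_act n Z [] x = x"
| "word_act n Z (i # w) x = mat_act n (Z i) (word_act n Z w x)"

lemma word_act_append: "word_act n Z (w @ v) x = word_act n Z w (word_act n Z v x)"
  by (induction w) simp_all

lemma word_act_sum: "word_act n Z w (\<lambda>i. \<Sum>k\<in>K. x k i) = (\<lambda>i. \<Sum>k\<in>K. word_act n Z w (x k) i)"
  by (induction w) (simp_all add: act_sum)

lemma word_act_scale: "word_act n Z w (\<lambda>i. c * x i) = (\<lambda>i. c * word_act n Z w x i)"
  by (induction w) (simp_all add: act_scale)

lemma word_act_add: "word_act n Z w (\<lambda>i. x i + y i) = (\<lambda>i. word_act n Z w x i + word_act n Z w y i)"
  by (induction w) (simp_all add: act_add)

lemma word_act_cong: "(\<And>i. i < n \<Longrightarrow> x i = y i) \<Longrightarrow> i < n \<Longrightarrow> word_act n Z w x i = word_act n Z w y i"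
proof (induction w arbitrary: i)
  case (Cons a w)
  then show ?case by (auto intro!: act_cong)
qed simp

section \<open>Nilpotent tuples determine Taylor coefficients\<close>

text \<open>
  Let \<open>S\<^sub>i\<close> be the creation operators \<open>e\<^sub>w \<mapsto> e\<^sub>i\<^sub>w\<close> on words of length at most \<open>N\<close>, which kill the
  longest words.  If \<open>X\<close> is nilpotent of order \<open>N + 1\<close> then \<open>e\<^sub>w \<mapsto> X\<^sub>w x\<close> intertwines \<open>S\<close> with \<open>X\<close>,
  so \<open>f X x\<close> is the image of \<open>f S e\<close> for the empty word \<open>e\<close>.  As \<open>S\<close> has norm \<open>1\<close>, the argument is
  applied to \<open>S / 2\<close>, which accounts for the powers of \<open>2\<close>.
\<close>

theorem nilpotent_calculus:
  fixes f :: "('d::finite) mtuple \<Rightarrow> complex mat"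
  assumes nc: "nc_function f"
  shows "\<exists>a. \<forall>n\<ge>1. \<forall>X\<in>nc_disc \<inter> nc_level n.
    (\<forall>w x i. length w = Suc N \<longrightarrow> i < n \<longrightarrow> word_act n X w x i = 0) \<longrightarrow>
    (\<forall>x. \<forall>i<n. mat_act n (f X) x i = (\<Sum>w\<in>words N. a w * word_act n X w x i))"
proof -
  define W where "W = (words N :: 'd list set)"
  define M where "M = card W"
  have finW: "finite W" by (simp add: W_def)
  obtain e where e: "bij_betw e {..<M} W"
    using ex_bij_betw_nat_finite[OF finW] by (auto simp: M_def atLeast0LessThan)
  define g where "g = inv_into {..<M} e"
  have g: "g w < M" "e (g w) = w" if "w \<in> W" for w
    using bij_betw_inv_into_right[OF e that] bij_betw_apply[OF bij_betw_inv_into[OF e] that] by (auto simp: g_def)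
  have eg: "e p \<in> W" "g (e p) = p" if "p < M" for p
    using bij_betw_apply[OF e] bij_betw_inv_into_left[OF e] that by (auto simp: g_def)
  have nilW: "[] \<in> W" by (simp add: W_def)
  then have M1: "M \<ge> 1" using finW card_gt_0_iff[of W] by (auto simp: M_def)
  have sumW: "(\<Sum>p<M. F (e p)) = (\<Sum>w\<in>W. F w)" for F :: "'d list \<Rightarrow> complex"
    by (rule sum.reindex_bij_betw[OF e])
  have sumWr: "(\<Sum>p<M. F (e p)) = (\<Sum>w\<in>W. F w)" for F :: "'d list \<Rightarrow> real"
    by (rule sum.reindex_bij_betw[OF e])
  define S where "S = (\<lambda>i. mat M M (\<lambda>(p, q). if e p = i # e q then 1/2 else 0 :: complex))"
  have S_lev: "S \<in> nc_level M" by (simp add: S_def nc_level_def)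
  have "op_norm (S i) \<le> 1/2" for i
  proof (rule op_norm_le)
    show "S i \<in> carrier_mat M M" by (simp add: S_def)
    fix x :: "nat \<Rightarrow> complex"
    have a: "mat_act M (S i) x p = (if e p \<noteq> [] \<and> hd (e p) = i then x (g (tl (e p))) / 2 else 0)" if "p < M" for p
    proof -
      have "mat_act M (S i) x p = (\<Sum>q<M. (\<lambda>w. if e p = i # w then x (g w) / 2 else 0) (e q))"
        unfolding act_def by (rule sum.cong) (use that eg in \<open>auto simp: S_def\<close>)
      also have "\<dots> = (\<Sum>w\<in>W. if e p = i # w then x (g w) / 2 else 0)" by (rule sumW)
      also have "\<dots> = (\<Sum>w\<in>W. if w = tl (e p) then (if e p \<noteq> [] \<and> hd (e p) = i then x (g w) / 2 else 0) else 0)"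
        by (rule sum.cong) (auto simp: neq_Nil_conv)
      also have "\<dots> = (if e p \<noteq> [] \<and> hd (e p) = i then x (g (tl (e p))) / 2 else 0)"
        using eg(1)[OF that] finW by (auto simp: W_def words_def)
      finally show ?thesis .
    qed
    have "nsq {..<M} (mat_act M (S i) x) = (\<Sum>p<M. (\<lambda>w. if w \<noteq> [] \<and> hd w = i then (cmod (x (g (tl w))))\<^sup>2 / 4 else 0) (e p))"
      unfolding nsq_def by (rule sum.cong) (auto simp: a norm_divide power_divide)
    also have "\<dots> = (\<Sum>w\<in>W. if w \<noteq> [] \<and> hd w = i then (cmod (x (g (tl w))))\<^sup>2 / 4 else 0)" by (rule sumWr)
    also have "\<dots> = (\<Sum>w\<in>{w\<in>W. w \<noteq> [] \<and> hd w = i}. (cmod (x (g (tl w))))\<^sup>2 / 4)"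
      by (rule sum.inter_filter[symmetric]) (rule finW)
    also have "\<dots> = (\<Sum>u\<in>tl ` {w\<in>W. w \<noteq> [] \<and> hd w = i}. (cmod (x (g u)))\<^sup>2 / 4)"
      by (subst sum.reindex) (auto simp: inj_on_def intro: list.expand)
    also have "\<dots> \<le> (\<Sum>u\<in>W. (cmod (x (g u)))\<^sup>2 / 4)"
      by (rule sum_mono2) (use finW in \<open>auto simp: W_def words_def\<close>)
    also have "\<dots> = (\<Sum>p<M. (cmod (x (g (e p))))\<^sup>2 / 4)" by (rule sumWr[symmetric])
    also have "\<dots> = (1/2)\<^sup>2 * nsq {..<M} x"
      unfolding nsq_def by (simp add: eg power_divide sum_divide_distrib)
    finally show "nsq {..<M} (mat_act M (S i) x) \<le> (1/2)\<^sup>2 * nsq {..<M} x" .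
  qed simp
  then have "tuple_norm S \<le> 1/2" unfolding tuple_norm_le_iff by blast
  then have "tuple_norm S < 1" by linarith
  then have S: "S \<in> nc_disc \<inter> nc_level M" using S_lev nc_disc_level_iff[OF M1] by blast
  define a where "a = (\<lambda>w. 2 ^ length w * f S $$ (g w, g []))"
  have "mat_act n (f X) x i = (\<Sum>w\<in>W. a w * word_act n X w x i)"
    if n: "n \<ge> 1" and X: "X \<in> nc_disc \<inter> nc_level n"
      and nil: "\<forall>w x i. length w = Suc N \<longrightarrow> i < n \<longrightarrow> word_act n X w x i = 0" and i: "i < n" for n X x i
  proof -
    define s where "s = mat n M (\<lambda>(p, q). 2 ^ length (e q) * word_act n X (e q) x p)"
    have s: "s \<in> carrier_mat n M" by (simp add: s_def)
    have Xc: "X j \<in> carrier_mat n n" for j using X by (auto simp: nc_level_def)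
    have Sc: "S j \<in> carrier_mat M M" for j by (simp add: S_def)
    have inter: "s * S j = X j * s" for j
    proof (rule eq_matI)
      fix p q assume "p < dim_row (X j * s)" "q < dim_col (X j * s)"
      then have p: "p < n" and q: "q < M" using Xc[of j] s by auto
      have "(s * S j) $$ (p, q) = (\<Sum>r<M. s $$ (p, r) * S j $$ (r, q))"
        by (rule mult_mat_entry[OF s Sc p q])
      also have "\<dots> = (\<Sum>r<M. (\<lambda>w. if w = j # e q then 2 ^ length w / 2 * word_act n X w x p else 0) (e r))"
        by (rule sum.cong) (use p q in \<open>auto simp: s_def S_def\<close>)
      also have "\<dots> = (\<Sum>w\<in>W. if w = j # e q then 2 ^ length w / 2 * word_act n X w x p else 0)" by (rule sumW)
      also have "\<dots> = (if j # e q \<in> W then 2 ^ length (e q) * word_act n X (j # e q) x p else 0)"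
        using finW by simp
      also have "\<dots> = 2 ^ length (e q) * word_act n X (j # e q) x p"
      \<comment> \<open>A word that is too long is killed by \<open>S\<close> on one side and by nilpotency on the other.\<close>
      proof (cases "j # e q \<in> W")
        case False
        then have "length (j # e q) = Suc N" using eg(1)[OF q] by (auto simp: W_def words_def)
        then have "word_act n X (j # e q) x p = 0" using nil p by blast
        then show ?thesis using False by simp
      qed simp
      also have "\<dots> = (\<Sum>r<n. X j $$ (p, r) * s $$ (r, q))"
        using p q by (simp add: s_def act_def sum_distrib_left mult_ac)
      also have "\<dots> = (X j * s) $$ (p, q)"
        by (rule mult_mat_entry[OF Xc s p q, symmetric])
      finally show "(s * S j) $$ (p, q) = (X j * s) $$ (p, q)" .
    qed (use Xc[of j] s Sc[of j] in auto)
    have fS: "f S \<in> carrier_mat M M" and fX: "f X \<in> carrier_mat n n"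
      using nc S X n M1 unfolding nc_function_def by blast+
    have "s * f S = f X * s"
      using nc S X n M1 s inter unfolding nc_function_def by blast
    then have "(s * f S) $$ (i, g []) = (f X * s) $$ (i, g [])" by simp
    then have "(\<Sum>r<M. s $$ (i, r) * f S $$ (r, g [])) = (\<Sum>r<n. f X $$ (i, r) * s $$ (r, g []))"
      using mult_mat_entry[OF s fS i g(1)[OF nilW]] mult_mat_entry[OF fX s i g(1)[OF nilW]] by simp
    moreover have "(\<Sum>r<n. f X $$ (i, r) * s $$ (r, g [])) = mat_act n (f X) x i"
      unfolding act_def by (rule sum.cong) (use g[OF nilW] in \<open>auto simp: s_def\<close>)
    moreover have "(\<Sum>r<M. s $$ (i, r) * f S $$ (r, g [])) = (\<Sum>r<M. (\<lambda>w. a w * word_act n X w x i) (e r))"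
      by (rule sum.cong) (use i eg in \<open>auto simp: s_def a_def\<close>)
    ultimately show ?thesis using sumW[of "\<lambda>w. a w * word_act n X w x i"] by simp
  qed
  then show ?thesis unfolding W_def by (intro exI[of _ a]) simp
qed

section \<open>One complex variable\<close>

lemma constant_term_eq_0:
  fixes b :: "nat \<Rightarrow> complex"
  assumes "\<delta> > 0" "\<And>z. z \<noteq> 0 \<Longrightarrow> cmod z < \<delta> \<Longrightarrow> cmod (\<Sum>k\<le>N. b k * z ^ k) \<le> C * cmod z ^ Suc N"
  shows "b 0 = 0"
proof -
  have "((\<lambda>z. \<Sum>k\<le>N. b k * z ^ k) \<longlongrightarrow> (\<Sum>k\<le>N. b k * 0 ^ k)) (at 0)"
    by (intro tendsto_intros)
  moreover have "(\<Sum>k\<le>N. b k * 0 ^ k) = b 0"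
    by (subst sum.remove[of _ 0]) auto
  moreover have "((\<lambda>z. \<Sum>k\<le>N. b k * z ^ k) \<longlongrightarrow> 0) (at 0)"
  proof (rule Lim_null_comparison)
    show "\<forall>\<^sub>F z in at 0. cmod (\<Sum>k\<le>N. b k * z ^ k) \<le> C * cmod z ^ Suc N"
      unfolding eventually_at using assms by (intro exI[of _ \<delta>]) (simp add: dist_norm)
    have "((\<lambda>z::complex. C * cmod z ^ Suc N) \<longlongrightarrow> C * cmod 0 ^ Suc N) (at 0)"
      by (intro tendsto_intros)
    then show "((\<lambda>z::complex. C * cmod z ^ Suc N) \<longlongrightarrow> 0) (at 0)" by simp
  qed
  ultimately show "b 0 = 0" using tendsto_unique[OF at_neq_bot] by metis
qed

lemma polynomial_vanishing_order:
  fixes b :: "nat \<Rightarrow> complex"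
  assumes \<delta>: "\<delta> > 0" and "\<And>z. z \<noteq> 0 \<Longrightarrow> cmod z < \<delta> \<Longrightarrow> cmod (\<Sum>k\<le>N. b k * z ^ k) \<le> C * cmod z ^ Suc N"
    and "k \<le> N"
  shows "b k = 0"
  using assms(2,3)
proof (induction N arbitrary: b k)
  case 0
  have "b 0 = 0" by (rule constant_term_eq_0[OF \<delta>]) (rule "0.prems"(1))
  then show ?case using "0.prems"(2) by (simp only: le_zero_eq)
next
  case (Suc N)
  have 0: "b 0 = 0" by (rule constant_term_eq_0[OF \<delta>]) (rule Suc.prems(1))
  show ?case
  proof (cases k)
    case (Suc j)
    have "(\<lambda>k. b (Suc k)) j = 0"
    proof (rule Suc.IH[where b = "\<lambda>k. b (Suc k)"])
      show "j \<le> N" using Suc Suc.prems(2) by (simp only: Suc_le_mono)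
      fix z :: complex assume z: "z \<noteq> 0" "cmod z < \<delta>"
      have "(\<Sum>k\<le>Suc N. b k * z ^ k) = z * (\<Sum>k\<le>N. b (Suc k) * z ^ k)"
        by (subst sum.atMost_Suc_shift) (simp add: 0 sum_distrib_left mult_ac)
      then have "cmod z * cmod (\<Sum>k\<le>N. b (Suc k) * z ^ k) \<le> cmod z * (C * cmod z ^ Suc N)"
        using Suc.prems(1)[OF z] by (simp add: norm_mult mult_ac)
      then show "cmod (\<Sum>k\<le>N. b (Suc k) * z ^ k) \<le> C * cmod z ^ Suc N"
        using z(1) by simp
    qed
    then show ?thesis by (simp add: Suc)
  qed (simp add: 0)
qed

text \<open>
  A polynomial of degree \<open>N\<close> that agrees with \<open>\<phi>\<close> to order \<open>N + 1\<close> at \<open>0\<close> is the Taylor polynomial, and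
  Cauchy's estimates bound the remaining coefficients.
\<close>

lemma taylor_remainder_from_contact:
  fixes \<phi> :: "complex \<Rightarrow> complex"
  assumes hol: "\<phi> holomorphic_on ball 0 R" and R: "1 < \<rho>" "\<rho> < R"
    and bd: "\<And>z. cmod z < R \<Longrightarrow> cmod (\<phi> z) \<le> B"
    and contact: "\<delta> > 0" "\<And>z. cmod z < \<delta> \<Longrightarrow> cmod (\<phi> z - (\<Sum>k\<le>N. c k * z ^ k)) \<le> C * cmod z ^ Suc N"
  shows "cmod (\<phi> 1 - (\<Sum>k\<le>N. c k)) \<le> B * ((1 / \<rho>) ^ Suc N / (1 - 1 / \<rho>))"
proof -
  define p where "p = (\<lambda>k. (deriv ^^ k) \<phi> 0 / fact k)"
  have B0: "B \<ge> 0" using order_trans[OF norm_ge_zero bd[of 0]] R by simp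
  have sums: "(\<lambda>k. p k * z ^ k) sums \<phi> z" if "cmod z < R" for z
    using holomorphic_power_series[OF hol, of z] that by (simp add: p_def)
  have coeff: "cmod (p k) \<le> B * (1 / \<rho>) ^ k" for k
  proof -
    have "cmod ((deriv ^^ k) \<phi> 0) \<le> fact k * B / \<rho> ^ k"
    proof (rule Cauchy_inequality)
      show "\<phi> holomorphic_on ball 0 \<rho>" by (rule holomorphic_on_subset[OF hol]) (use R in auto)
      show "continuous_on (cball 0 \<rho>) \<phi>"
        by (rule holomorphic_on_imp_continuous_on[OF holomorphic_on_subset[OF hol]]) (use R in auto)
      show "0 < \<rho>" using R by simp
      show "cmod (\<phi> x) \<le> B" if "cmod (0 - x) = \<rho>" for x using bd[of x] that R by simp
    qed
    then show ?thesis by (simp add: p_def norm_divide power_one_over field_simps)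
  qed
  have q: "0 < 1 / \<rho>" "1 / \<rho> < 1" using R by auto
  define T where "T = B * ((1 / \<rho>) ^ Suc N / (1 - 1 / \<rho>))"
  have tail: "cmod (\<phi> z - (\<Sum>k\<le>N. p k * z ^ k)) \<le> T * cmod z ^ Suc N" if z: "cmod z \<le> 1" for z
  proof -
    have 1: "(\<lambda>k. p (k + Suc N) * z ^ (k + Suc N)) sums (\<phi> z - (\<Sum>k<Suc N. p k * z ^ k))"
      using sums_iff_shift[of "\<lambda>k. p k * z ^ k" "Suc N" "\<phi> z - (\<Sum>k<Suc N. p k * z ^ k)"] sums[of z] z R by simp
    have 2: "cmod (p (k + Suc N) * z ^ (k + Suc N)) \<le> (B * (1 / \<rho>) ^ Suc N * cmod z ^ Suc N) * (1 / \<rho>) ^ k" for k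
    proof -
      have "cmod (p (k + Suc N) * z ^ (k + Suc N)) \<le> (B * (1 / \<rho>) ^ (k + Suc N)) * cmod z ^ (k + Suc N)"
        unfolding norm_mult norm_power by (intro mult_right_mono coeff) simp
      also have "\<dots> \<le> (B * (1 / \<rho>) ^ (k + Suc N)) * cmod z ^ Suc N"
        using z q B0 by (intro mult_left_mono power_decreasing) auto
      finally show ?thesis by (simp add: power_add mult_ac)
    qed
    have 3: "(\<lambda>k. (B * (1 / \<rho>) ^ Suc N * cmod z ^ Suc N) * (1 / \<rho>) ^ k) sums
        ((B * (1 / \<rho>) ^ Suc N * cmod z ^ Suc N) * (1 / (1 - 1 / \<rho>)))"
      using q by (intro sums_mult geometric_sums) auto
    have "cmod (\<phi> z - (\<Sum>k<Suc N. p k * z ^ k)) \<le> (B * (1 / \<rho>) ^ Suc N * cmod z ^ Suc N) * (1 / (1 - 1 / \<rho>))"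
      by (rule norm_sums_le[OF 1 3 2])
    then show ?thesis by (simp add: T_def lessThan_Suc_atMost mult_ac)
  qed
  have "c k - p k = 0" if "k \<le> N" for k
  proof (rule polynomial_vanishing_order[OF _ _ that, where \<delta> = "min 1 \<delta>" and C = "C + T"])
    show "0 < min 1 \<delta>" using contact(1) by simp
    fix z :: complex assume z: "cmod z < min 1 \<delta>"
    have "(\<Sum>k\<le>N. (c k - p k) * z ^ k) = (\<phi> z - (\<Sum>k\<le>N. p k * z ^ k)) - (\<phi> z - (\<Sum>k\<le>N. c k * z ^ k))"
      by (simp add: left_diff_distrib sum_subtractf)
    also have "cmod \<dots> \<le> T * cmod z ^ Suc N + C * cmod z ^ Suc N"
      by (rule order_trans[OF norm_triangle_ineq4 add_mono[OF tail contact(2)]]) (use z in auto)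
    finally show "cmod (\<Sum>k\<le>N. (c k - p k) * z ^ k) \<le> (C + T) * cmod z ^ Suc N"
      by (simp add: algebra_simps)
  qed
  then have "(\<Sum>k\<le>N. c k) = (\<Sum>k\<le>N. p k * 1 ^ k)" by (intro sum.cong) auto
  then show ?thesis using tail[of 1] by (simp add: T_def)
qed

lemma op_norm_scale_le:
  assumes "A \<in> carrier_mat n n"
  shows "op_norm (c \<cdot>\<^sub>m A) \<le> cmod c * op_norm A"
proof (rule op_norm_le)
  show "c \<cdot>\<^sub>m A \<in> carrier_mat n n" using assms by simp
  show "0 \<le> cmod c * op_norm A" using nsq_act_op_norm(2)[OF assms] by simp
  fix x
  have "nsq {..<n} (mat_act n (c \<cdot>\<^sub>m A) x) = nsq {..<n} (\<lambda>i. c * mat_act n A x i)"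
    by (rule nsq_cong) (use assms in \<open>auto simp: act_def sum_distrib_left mult_ac intro!: sum.cong\<close>)
  also have "\<dots> \<le> (cmod c)\<^sup>2 * ((op_norm A)\<^sup>2 * nsq {..<n} x)"
    unfolding nsq_scale by (intro mult_left_mono nsq_act_op_norm(1)[OF assms]) simp
  finally show "nsq {..<n} (mat_act n (c \<cdot>\<^sub>m A) x) \<le> (cmod c * op_norm A)\<^sup>2 * nsq {..<n} x"
    by (simp add: power_mult_distrib mult_ac)
qed

lemma tuple_norm_scale_le:
  assumes "Z \<in> nc_level n"
  shows "tuple_norm (\<lambda>i. c \<cdot>\<^sub>m Z i) \<le> cmod c * tuple_norm Z"
  unfolding tuple_norm_le_iff
proof
  fix i
  show "op_norm (c \<cdot>\<^sub>m Z i) \<le> cmod c * tuple_norm Z"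
    by (rule order_trans[OF op_norm_scale_le[OF nc_level_carrier[OF assms]]])
      (intro mult_left_mono op_norm_le_tuple_norm norm_ge_zero)
qed

lemma tuple_norm_nonneg: "Z \<in> nc_level n \<Longrightarrow> 0 \<le> tuple_norm Z"
  by (rule order_trans[OF nsq_act_op_norm(2)[OF nc_level_carrier] op_norm_le_tuple_norm])

lemma entry_le_op_norm:
  assumes A: "A \<in> carrier_mat n n" and "i < n" "j < n"
  shows "cmod (A $$ (i, j)) \<le> op_norm A"
proof -
  define e where "e = (\<lambda>k. if k = j then 1 else 0 :: complex)"
  have "mat_act n A e i = A $$ (i, j)"
  proof -
    have "mat_act n A e i = (\<Sum>b<n. if b = j then A $$ (i, b) else 0)"
      unfolding act_def e_def by (rule sum.cong) auto
    then show ?thesis using assms by simp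
  qed
  then have "(cmod (A $$ (i, j)))\<^sup>2 \<le> nsq {..<n} (mat_act n A e)"
    using entry_le_nsq[of "{..<n}" i "mat_act n A e"] assms by simp
  also have "\<dots> \<le> (op_norm A)\<^sup>2 * nsq {..<n} e" by (rule nsq_act_op_norm(1)[OF A])
  also have "nsq {..<n} e = (\<Sum>k<n. if k = j then 1 else 0)"
    unfolding nsq_def e_def by (rule sum.cong) auto
  also have "\<dots> = 1" using assms by simp
  finally have "(cmod (A $$ (i, j)))\<^sup>2 \<le> (op_norm A)\<^sup>2" by (simp only: mult_1_right)
  then show ?thesis using nsq_act_op_norm(2)[OF A] by (rule power2_le_imp_le)
qed

text \<open>
  This reduces holomorphy on a level to one complex variable.
\<close>

lemma level_differentiable_entry:
  assumes "level_complex_differentiable n f Z" and Z: "f Z \<in> carrier_mat n n"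
    and H: "H \<in> nc_level n" and ij: "i < n" "j < n"
  shows "\<exists>D. ((\<lambda>c. f (\<lambda>k. Z k + c \<cdot>\<^sub>m H k) $$ (i, j)) has_field_derivative D) (at 0)"
proof -
  obtain L where Lc: "\<And>H. H \<in> nc_level n \<Longrightarrow> L H \<in> carrier_mat n n"
    and Ls: "\<And>c H. H \<in> nc_level n \<Longrightarrow> L (\<lambda>i. c \<cdot>\<^sub>m H i) = c \<cdot>\<^sub>m L H"
    and Ld: "\<And>\<epsilon>. \<epsilon> > 0 \<Longrightarrow> \<exists>\<delta>>0. \<forall>H\<in>nc_level n. tuple_norm H < \<delta> \<longrightarrow>
        op_norm (f (\<lambda>i. Z i + H i) - f Z - L H) \<le> \<epsilon> * tuple_norm H"
    using assms(1) unfolding level_complex_differentiable_def by blast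
  define g where "g = (\<lambda>c. f (\<lambda>k. Z k + c \<cdot>\<^sub>m H k) $$ (i, j))"
  define B where "B = tuple_norm H + 1"
  have B: "B > 0" using tuple_norm_nonneg[OF H] by (simp add: B_def)
  have cH: "(\<lambda>k. c \<cdot>\<^sub>m H k) \<in> nc_level n" for c using H by (simp add: nc_level_def)
  have cHB: "tuple_norm (\<lambda>k. c \<cdot>\<^sub>m H k) \<le> cmod c * B" for c
    unfolding B_def by (rule order_trans[OF tuple_norm_scale_le[OF H]]) (intro mult_left_mono, simp_all)
  have step: "\<exists>d>0. \<forall>c. c \<noteq> 0 \<and> cmod c < d \<longrightarrow> cmod (g c - f Z $$ (i, j) - c * L H $$ (i, j)) < e * cmod c" if e0: "e > 0" for e
  proof -
    obtain \<delta> where \<delta>: "\<delta> > 0" "\<And>H. H \<in> nc_level n \<Longrightarrow> tuple_norm H < \<delta> \<Longrightarrow>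
        op_norm (f (\<lambda>i. Z i + H i) - f Z - L H) \<le> e / (2 * B) * tuple_norm H"
    proof -
      have "e / (2 * B) > 0" using e0 B by simp
      from Ld[OF this] show ?thesis using that by blast
    qed
    show ?thesis
    proof (intro exI[of _ "\<delta> / B"] conjI allI impI)
      show "\<delta> / B > 0" using \<delta> B by simp
      fix c assume c: "c \<noteq> 0 \<and> cmod c < \<delta> / B"
      then have "cmod c * B < \<delta>" using B by (simp add: field_simps)
      then have "tuple_norm (\<lambda>k. c \<cdot>\<^sub>m H k) < \<delta>" using cHB[of c] by simp
      from \<delta>(2)[OF cH this]
      have op: "op_norm (f (\<lambda>k. Z k + c \<cdot>\<^sub>m H k) - f Z - c \<cdot>\<^sub>m L H) \<le> e / (2 * B) * tuple_norm (\<lambda>k. c \<cdot>\<^sub>m H k)"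
        by (simp add: Ls[OF H])
      have "g c - f Z $$ (i, j) - c * L H $$ (i, j) = (f (\<lambda>k. Z k + c \<cdot>\<^sub>m H k) - f Z - c \<cdot>\<^sub>m L H) $$ (i, j)"
        using Lc[OF H] Z ij by (simp add: g_def)
      also have "cmod \<dots> \<le> op_norm (f (\<lambda>k. Z k + c \<cdot>\<^sub>m H k) - f Z - c \<cdot>\<^sub>m L H)"
        by (rule entry_le_op_norm[OF _ ij]) (use Lc[OF H] in \<open>auto intro: minus_carrier_mat\<close>)
      also have "\<dots> \<le> e / (2 * B) * tuple_norm (\<lambda>k. c \<cdot>\<^sub>m H k)" by (rule op)
      also have "\<dots> \<le> e / (2 * B) * (cmod c * B)" using that B by (intro mult_left_mono cHB) simp
      also have "\<dots> = e / 2 * cmod c" using B by simp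
      also have "\<dots> < e * cmod c" using that c by simp
      finally show "cmod (g c - f Z $$ (i, j) - c * L H $$ (i, j)) < e * cmod c" .
    qed
  qed
  \<comment> \<open>The matrix \<open>Z k + 0 \<cdot>\<^sub>m H k\<close> has the size of \<open>H k\<close> and need not equal \<open>Z k\<close>, but the estimate for
    the direction \<open>0 \<cdot>\<^sub>m H\<close> of norm zero shows that \<open>f\<close> has the same entries there.\<close>
  have g0: "g 0 = f Z $$ (i, j)"
  proof -
    obtain \<delta> where \<delta>: "\<delta> > 0" "\<And>H. H \<in> nc_level n \<Longrightarrow> tuple_norm H < \<delta> \<Longrightarrow>
        op_norm (f (\<lambda>i. Z i + H i) - f Z - L H) \<le> 1 * tuple_norm H"
      using Ld[of 1] by auto
    have t0: "tuple_norm (\<lambda>k. 0 \<cdot>\<^sub>m H k) \<le> 0" using cHB[of 0] by simp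
    then have "op_norm (f (\<lambda>k. Z k + 0 \<cdot>\<^sub>m H k) - f Z - 0 \<cdot>\<^sub>m L H) \<le> 0"
      using \<delta>(2)[OF cH[of 0]] \<delta>(1) by (simp add: Ls[OF H])
    moreover have "cmod ((f (\<lambda>k. Z k + 0 \<cdot>\<^sub>m H k) - f Z - 0 \<cdot>\<^sub>m L H) $$ (i, j)) \<le> op_norm (f (\<lambda>k. Z k + 0 \<cdot>\<^sub>m H k) - f Z - 0 \<cdot>\<^sub>m L H)"
      by (rule entry_le_op_norm[OF _ ij]) (use Lc[OF H] in \<open>auto intro: minus_carrier_mat\<close>)
    ultimately have "cmod ((f (\<lambda>k. Z k + 0 \<cdot>\<^sub>m H k) - f Z - 0 \<cdot>\<^sub>m L H) $$ (i, j)) \<le> 0" by (rule order_trans[rotated])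
    then have "(f (\<lambda>k. Z k + 0 \<cdot>\<^sub>m H k) - f Z - 0 \<cdot>\<^sub>m L H) $$ (i, j) = 0" by (simp only: norm_le_zero_iff)
    then show ?thesis using Lc[OF H] Z ij by (simp add: g_def)
  qed
  have "(g has_field_derivative L H $$ (i, j)) (at 0)"
    unfolding has_field_derivative_iff tendsto_iff eventually_at
  proof (intro allI impI)
    fix e :: real assume "e > 0"
    from step[OF this] obtain d where d: "d > 0" "\<And>c. c \<noteq> 0 \<and> cmod c < d \<Longrightarrow> cmod (g c - f Z $$ (i, j) - c * L H $$ (i, j)) < e * cmod c" by blast
    show "\<exists>d>0. \<forall>x\<in>UNIV. x \<noteq> 0 \<and> dist x 0 < d \<longrightarrow> dist ((g x - g 0) / (x - 0)) (L H $$ (i, j)) < e"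
    proof (intro exI[of _ d] conjI ballI impI)
      fix c :: complex assume c: "c \<noteq> 0 \<and> dist c 0 < d"
      then have "dist ((g c - g 0) / (c - 0)) (L H $$ (i, j)) = cmod ((g c - f Z $$ (i, j) - c * L H $$ (i, j)) / c)"
        by (simp add: dist_norm g0 diff_divide_distrib)
      also have "\<dots> < e" using d(2)[of c] c by (simp add: norm_divide divide_less_eq dist_norm)
      finally show "dist ((g c - g 0) / (c - 0)) (L H $$ (i, j)) < e" .
    qed (use d in auto)
  qed
  then show ?thesis unfolding g_def by blast
qed

section \<open>Approximation by Taylor polynomials\<close>

lemma sum_blocks:
  fixes F :: "nat \<Rightarrow> 'b::comm_monoid_add"
  shows "(\<Sum>P<m * n. F P) = (\<Sum>k<m. \<Sum>p<n. F (k * n + p))"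
proof (induction m)
  case (Suc m)
  have "(\<Sum>P<Suc m * n. F P) = (\<Sum>P<m * n + n. F P)" by (simp add: add.commute)
  also have "\<dots> = (\<Sum>P<m * n. F P) + (\<Sum>P\<in>{m * n..<m * n + n}. F P)"
    by (simp add: lessThan_atLeast0 sum.atLeastLessThan_concat)
  also have "(\<Sum>P\<in>{m * n..<m * n + n}. F P) = (\<Sum>p<n. F (m * n + p))"
    using sum.shift_bounds_nat_ivl[of F 0 "m * n" n] by (simp add: lessThan_atLeast0 add.commute)
  finally show ?case using Suc by simp
qed simp

lemma block_index_less: "k < m \<Longrightarrow> p < n \<Longrightarrow> k * n + p < m * (n::nat)"
  by (metis add.commute mult_Suc less_le_trans add_less_cancel_left mult_le_mono1 Suc_leI)

text \<open>
  The tensor product of \<open>Z\<close> with the nilpotent Jordan block of size \<open>N + 1\<close> whose upper right corner is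
  replaced by \<open>c\<close>.  The block with index \<open>k\<close> consists of the indices \<open>k * n + p\<close> with \<open>p < n\<close>.
\<close>

definition jordan_tensor :: "nat \<Rightarrow> nat \<Rightarrow> ('d::finite) mtuple \<Rightarrow> complex \<Rightarrow> 'd mtuple" where
  "jordan_tensor N n Z c = (\<lambda>i. mat (Suc N * n) (Suc N * n) (\<lambda>(P, Q).
     if P div n = Suc (Q div n) then Z i $$ (P mod n, Q mod n)
     else if P div n = 0 \<and> Q div n = N then c * Z i $$ (P mod n, Q mod n) else 0))"

lemma act_jordan_tensor:
  assumes k: "k < Suc N" and p: "p < n"
  shows "mat_act (Suc N * n) (jordan_tensor N n Z c i) y (k * n + p)
    = (if k = 0 then c * mat_act n (Z i) (\<lambda>q. y (N * n + q)) p
       else mat_act n (Z i) (\<lambda>q. y ((k - 1) * n + q)) p)"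
proof -
  have "mat_act (Suc N * n) (jordan_tensor N n Z c i) y (k * n + p)
      = (\<Sum>l<Suc N. \<Sum>q<n. jordan_tensor N n Z c i $$ (k * n + p, l * n + q) * y (l * n + q))"
    unfolding act_def by (rule sum_blocks)
  also have "\<dots> = (\<Sum>l<Suc N. if k = Suc l then mat_act n (Z i) (\<lambda>q. y (l * n + q)) p
      else if k = 0 \<and> l = N then c * mat_act n (Z i) (\<lambda>q. y (l * n + q)) p else 0)"
  proof (rule sum.cong[OF refl])
    fix l assume l: "l \<in> {..<Suc N}"
    have entry: "jordan_tensor N n Z c i $$ (k * n + p, l * n + q)
      = (if k = Suc l then Z i $$ (p, q) else if k = 0 \<and> l = N then c * Z i $$ (p, q) else 0)" if "q < n" for q
    proof -
      have "k * n + p < Suc N * n" "l * n + q < Suc N * n"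
        using block_index_less[OF k p] block_index_less[of l "Suc N" q n] l that by auto
      then show ?thesis using p that by (simp add: jordan_tensor_def del: mult_Suc)
    qed
    have "(\<Sum>q<n. jordan_tensor N n Z c i $$ (k * n + p, l * n + q) * y (l * n + q))
      = (\<Sum>q<n. (if k = Suc l then Z i $$ (p, q) else if k = 0 \<and> l = N then c * Z i $$ (p, q) else 0) * y (l * n + q))"
      by (rule sum.cong) (auto simp: entry)
    then show "(\<Sum>q<n. jordan_tensor N n Z c i $$ (k * n + p, l * n + q) * y (l * n + q))
      = (if k = Suc l then mat_act n (Z i) (\<lambda>q. y (l * n + q)) p
      else if k = 0 \<and> l = N then c * mat_act n (Z i) (\<lambda>q. y (l * n + q)) p else 0)"
      by (auto simp: act_def sum_distrib_left mult.assoc)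
  qed
  also have "\<dots> = (if k = 0 then c * mat_act n (Z i) (\<lambda>q. y (N * n + q)) p
       else mat_act n (Z i) (\<lambda>q. y ((k - 1) * n + q)) p)"
  proof (cases k)
    case 0
    then have "(\<Sum>l<Suc N. if k = Suc l then mat_act n (Z i) (\<lambda>q. y (l * n + q)) p
      else if k = 0 \<and> l = N then c * mat_act n (Z i) (\<lambda>q. y (l * n + q)) p else 0)
      = (\<Sum>l<Suc N. if l = N then c * mat_act n (Z i) (\<lambda>q. y (N * n + q)) p else 0)"
      by (intro sum.cong) auto
    then show ?thesis using 0 by simp
  next
    case (Suc k')
    then have "(\<Sum>l<Suc N. if k = Suc l then mat_act n (Z i) (\<lambda>q. y (l * n + q)) p
      else if k = 0 \<and> l = N then c * mat_act n (Z i) (\<lambda>q. y (l * n + q)) p else 0)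
      = (\<Sum>l<Suc N. if l = k' then mat_act n (Z i) (\<lambda>q. y (k' * n + q)) p else 0)"
      by (intro sum.cong) auto
    also have "\<dots> = mat_act n (Z i) (\<lambda>q. y (k' * n + q)) p" using Suc k by (simp del: sum.lessThan_Suc)
    finally show ?thesis using Suc by simp
  qed
  finally show ?thesis .
qed

lemma jordan_tensor_level: "jordan_tensor N n Z c \<in> nc_level (Suc N * n)"
  by (simp add: nc_level_def jordan_tensor_def)

lemma tuple_norm_jordan_tensor:
  assumes Z: "Z \<in> nc_level n" and c: "cmod c \<le> 1"
  shows "tuple_norm (jordan_tensor N n Z c) \<le> tuple_norm Z"
proof -
  have "op_norm (jordan_tensor N n Z c i) \<le> op_norm (Z i)" for i
  proof (rule op_norm_le)
    show "jordan_tensor N n Z c i \<in> carrier_mat (Suc N * n) (Suc N * n)" by (simp add: jordan_tensor_def)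
    show "0 \<le> op_norm (Z i)" by (rule nsq_act_op_norm(2)[OF nc_level_carrier[OF Z]])
    fix y :: "nat \<Rightarrow> complex"
    define b where "b = (\<lambda>k q. y (k * n + q))"
    have blocks: "nsq {..<Suc N * n} x = (\<Sum>k<Suc N. nsq {..<n} (\<lambda>q. x (k * n + q)))" for x
      unfolding nsq_def by (rule sum_blocks)
    have "nsq {..<n} (\<lambda>p. mat_act (Suc N * n) (jordan_tensor N n Z c i) y (k * n + p))
        \<le> (op_norm (Z i))\<^sup>2 * nsq {..<n} (b (if k = 0 then N else k - 1))" if k: "k < Suc N" for k
    proof (cases "k = 0")
      case True
      have "nsq {..<n} (\<lambda>p. mat_act (Suc N * n) (jordan_tensor N n Z c i) y (k * n + p))
        = nsq {..<n} (\<lambda>p. c * mat_act n (Z i) (b N) p)"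
        by (rule nsq_cong) (subst act_jordan_tensor[OF k], use True in \<open>auto simp: b_def\<close>)
      also have "\<dots> \<le> 1 * ((op_norm (Z i))\<^sup>2 * nsq {..<n} (b N))"
        unfolding nsq_scale using c
        by (intro mult_mono nsq_act_op_norm(1)[OF nc_level_carrier[OF Z]]) (auto simp: power_le_one)
      finally show ?thesis using True by simp
    next
      case False
      have "nsq {..<n} (\<lambda>p. mat_act (Suc N * n) (jordan_tensor N n Z c i) y (k * n + p))
        = nsq {..<n} (mat_act n (Z i) (b (k - 1)))"
        by (rule nsq_cong) (subst act_jordan_tensor[OF k], use False in \<open>auto simp: b_def\<close>)
      also have "\<dots> \<le> (op_norm (Z i))\<^sup>2 * nsq {..<n} (b (k - 1))"
        by (rule nsq_act_op_norm(1)[OF nc_level_carrier[OF Z]])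
      finally show ?thesis using False by simp
    qed
    then have "nsq {..<Suc N * n} (mat_act (Suc N * n) (jordan_tensor N n Z c i) y)
        \<le> (\<Sum>k<Suc N. (op_norm (Z i))\<^sup>2 * nsq {..<n} (b (if k = 0 then N else k - 1)))"
      unfolding blocks by (intro sum_mono) simp
    also have "\<dots> = (op_norm (Z i))\<^sup>2 * (\<Sum>k<Suc N. nsq {..<n} (b (if k = 0 then N else k - 1)))"
      by (rule sum_distrib_left[symmetric])
    also have "(\<Sum>k<Suc N. nsq {..<n} (b (if k = 0 then N else k - 1))) = (\<Sum>k<Suc N. nsq {..<n} (b k))"
      by (subst sum.lessThan_Suc_shift) (simp add: add.commute)
    also have "\<dots> = nsq {..<Suc N * n} y" unfolding blocks b_def ..
    finally show "nsq {..<Suc N * n} (mat_act (Suc N * n) (jordan_tensor N n Z c i) y)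
        \<le> (op_norm (Z i))\<^sup>2 * nsq {..<Suc N * n} y" .
  qed
  then show ?thesis unfolding tuple_norm_le_iff using op_norm_le_tuple_norm order_trans by blast
qed

lemma word_act_jordan_tensor:
  assumes "k < Suc N" and "p < n"
  shows "word_act (Suc N * n) (jordan_tensor N n Z 0) w y (k * n + p)
    = (if k < length w then 0 else word_act n Z w (\<lambda>q. y ((k - length w) * n + q)) p)"
  using assms
proof (induction w arbitrary: k p)
  case (Cons i w)
  show ?case
  proof (cases k)
    case 0
    then show ?thesis
      using act_jordan_tensor[OF Cons.prems, of Z 0 i "word_act (Suc N * n) (jordan_tensor N n Z 0) w y"]
      by (simp del: mult_Suc)
  next
    case (Suc k')
    have "word_act (Suc N * n) (jordan_tensor N n Z 0) (i # w) y (k * n + p)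
      = mat_act n (Z i) (\<lambda>q. word_act (Suc N * n) (jordan_tensor N n Z 0) w y (k' * n + q)) p"
      using act_jordan_tensor[OF Cons.prems, of Z 0 i "word_act (Suc N * n) (jordan_tensor N n Z 0) w y"] Suc
      by (simp del: mult_Suc)
    also have "\<dots> = mat_act n (Z i) (\<lambda>q. if k' < length w then 0 else word_act n Z w (\<lambda>q. y ((k' - length w) * n + q)) q) p"
      by (rule act_cong) (use Cons Suc in auto)
    finally show ?thesis using Suc by (simp add: act_def)
  qed
qed simp

definition poly_act :: "nat \<Rightarrow> ('d list \<Rightarrow> complex) \<Rightarrow> nat \<Rightarrow> ('d::finite) mtuple \<Rightarrow> (nat \<Rightarrow> complex) \<Rightarrow> nat \<Rightarrow> complex" where
  "poly_act N a n Z x p = (\<Sum>w\<in>words N. a w * word_act n Z w x p)"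

lemma derivative_imp_local_lipschitz:
  assumes "(h has_field_derivative D) (at (0::complex))"
  shows "\<exists>C\<ge>0. \<forall>\<^sub>F c in nhds 0. cmod (h c - h 0) \<le> C * cmod c"
proof -
  have "((\<lambda>c. (h c - h 0) / (c - 0)) \<longlongrightarrow> D) (at 0)"
    using assms by (simp add: has_field_derivative_iff)
  then have "\<forall>\<^sub>F c in at 0. dist ((h c - h 0) / (c - 0)) D < 1" by (rule tendstoD) simp
  then have "\<forall>\<^sub>F c in nhds 0. c \<noteq> 0 \<longrightarrow> dist ((h c - h 0) / (c - 0)) D < 1"
    by (simp add: eventually_at_filter)
  then have "\<forall>\<^sub>F c in nhds 0. cmod (h c - h 0) \<le> (cmod D + 1) * cmod c"
  proof (rule eventually_mono)
    fix c :: complex assume c: "c \<noteq> 0 \<longrightarrow> dist ((h c - h 0) / (c - 0)) D < 1"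
    show "cmod (h c - h 0) \<le> (cmod D + 1) * cmod c"
    proof (cases "c = 0")
      case False
      then have "cmod ((h c - h 0) / c - D) < 1" using c by (simp add: dist_norm)
      then have "cmod ((h c - h 0) / c) \<le> cmod D + 1"
        using norm_triangle_sub[of "(h c - h 0) / c" D] by linarith
      then show ?thesis using False by (simp add: norm_divide pos_divide_le_eq)
    qed simp
  qed
  moreover have "0 \<le> cmod D + 1" by simp
  ultimately show ?thesis by blast
qed

lemma scaled_tuple_level: "Z \<in> nc_level n \<Longrightarrow> (\<lambda>i. c \<cdot>\<^sub>m Z i) \<in> nc_level n"
  by (simp add: nc_level_def)

text \<open>
  For \<open>c = z ^ (N + 1)\<close> the vector \<open>(z ^ (N - k))\<^sub>k\<close> is an eigenvector of the perturbed Jordan block with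
  eigenvalue \<open>z\<close>.  Hence \<open>f (z Z)\<close> is the last block row of \<open>f (jordan_tensor N n Z c)\<close> applied to this vector,
  whose last entry is \<open>1\<close>.  For \<open>c = 0\<close> the argument of \<open>f\<close> is nilpotent, and the same row gives the
  polynomial; differentiability at that point makes the error \<open>O(c) = O(z ^ (N + 1))\<close>.
\<close>

lemma polynomial_contact:
  fixes f :: "('d::finite) mtuple \<Rightarrow> complex mat"
  assumes hol: "nc_holomorphic f"
    and a: "\<And>n X x i. n \<ge> 1 \<Longrightarrow> X \<in> nc_disc \<inter> nc_level n \<Longrightarrow>
      (\<And>w x i. length w = Suc N \<Longrightarrow> i < n \<Longrightarrow> word_act n X w x i = 0) \<Longrightarrow> i < n \<Longrightarrow>
      mat_act n (f X) x i = poly_act N a n X x i"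
    and n: "n \<ge> 1" and Z: "Z \<in> nc_disc \<inter> nc_level n" and p: "p < n"
  shows "\<exists>C\<ge>0. \<forall>\<^sub>F z in nhds 0. cmod (mat_act n (f (\<lambda>i. z \<cdot>\<^sub>m Z i)) x p
    - (\<Sum>w\<in>words N. a w * z ^ length w * word_act n Z w x p)) \<le> C * cmod z ^ Suc N"
proof -
  have nc: "nc_function f" using hol by (simp add: nc_holomorphic_def)
  define M where "M = Suc N * n"
  have M: "M \<ge> 1" using n by (simp add: M_def)
  have Zl: "Z \<in> nc_level n" and Z1: "tuple_norm Z < 1" using Z nc_disc_level_iff[OF n] by blast+
  define X where "X = jordan_tensor N n Z"
  have Xl: "X c \<in> nc_level M" for c unfolding X_def M_def by (rule jordan_tensor_level)
  have Xd: "X c \<in> nc_disc \<inter> nc_level M" if "cmod c \<le> 1" for c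
    using tuple_norm_jordan_tensor[OF Zl that, of N] Xl[of c] Z1 nc_disc_level_iff[OF M, of "X c"] by (auto simp: X_def)
  have X0d: "X 0 \<in> nc_disc \<inter> nc_level M" by (rule Xd) simp
  define H where "H = (\<lambda>i. mat M M (\<lambda>(P, Q). if P div n = 0 \<and> Q div n = N then Z i $$ (P mod n, Q mod n) else 0))"
  have Hl: "H \<in> nc_level M" by (simp add: H_def nc_level_def)
  have XH: "X c = (\<lambda>k. X 0 k + c \<cdot>\<^sub>m H k)" for c
  proof
    fix k show "X c k = X 0 k + c \<cdot>\<^sub>m H k"
      by (rule eq_matI) (auto simp: X_def H_def jordan_tensor_def M_def simp del: mult_Suc)
  qed
  have fX: "f (X c) \<in> carrier_mat M M" if "cmod c \<le> 1" for c
    using nc M Xd[OF that] unfolding nc_function_def by blast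
  define R where "R = N * n + p"
  have R: "R < M" unfolding R_def M_def by (rule block_index_less) (use p in auto)
  have lip: "\<exists>C\<ge>0. \<forall>\<^sub>F c in nhds 0. cmod (f (X c) $$ (R, P) - f (X 0) $$ (R, P)) \<le> C * cmod c"
    if "P < M" for P
  proof -
    have "level_complex_differentiable M f (X 0)"
      using hol M X0d unfolding nc_holomorphic_def by blast
    from level_differentiable_entry[OF this fX Hl R that]
    obtain D where "((\<lambda>c. f (\<lambda>k. X 0 k + c \<cdot>\<^sub>m H k) $$ (R, P)) has_field_derivative D) (at 0)" by auto
    then have "((\<lambda>c. f (X c) $$ (R, P)) has_field_derivative D) (at 0)" by (simp only: XH[symmetric])
    then show ?thesis by (rule derivative_imp_local_lipschitz)
  qed
  have "\<forall>P. \<exists>C. P < M \<longrightarrow> C \<ge> 0 \<and> (\<forall>\<^sub>F c in nhds 0. cmod (f (X c) $$ (R, P) - f (X 0) $$ (R, P)) \<le> C * cmod c)"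
    using lip by blast
  from choice[OF this] obtain K where K0: "\<And>P. P < M \<Longrightarrow> K P \<ge> 0"
    and K: "\<And>P. P < M \<Longrightarrow> \<forall>\<^sub>F c in nhds 0. cmod (f (X c) $$ (R, P) - f (X 0) $$ (R, P)) \<le> K P * cmod c"
    by blast
  have ev: "\<forall>\<^sub>F c in nhds 0. \<forall>P\<in>{..<M}. cmod (f (X c) $$ (R, P) - f (X 0) $$ (R, P)) \<le> K P * cmod c"
    by (rule eventually_ball_finite) (use K R in auto)
  define B where "B = (\<Sum>q<n. cmod (x q))"
  have B0: "B \<ge> 0" by (simp add: B_def sum_nonneg)
  define C where "C = (\<Sum>P<M. K P * B)"
  have C0: "C \<ge> 0" unfolding C_def by (intro sum_nonneg mult_nonneg_nonneg) (use K0 R B0 in auto)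
  have "filterlim (\<lambda>z::complex. z ^ Suc N) (nhds (0 ^ Suc N)) (nhds 0)"
    by (intro tendsto_intros filterlim_ident)
  then have lim: "filterlim (\<lambda>z::complex. z ^ Suc N) (nhds 0) (nhds 0)" by simp
  have "\<forall>\<^sub>F z in nhds (0::complex). dist z 0 < 1" by (rule eventually_nhds_ball[of 1 0, simplified ball_def, simplified, THEN eventually_mono]) (auto simp: dist_norm)
  then have small: "\<forall>\<^sub>F z in nhds (0::complex). cmod z < 1" by simp
  have "\<forall>\<^sub>F z in nhds 0. cmod (mat_act n (f (\<lambda>i. z \<cdot>\<^sub>m Z i)) x p
    - (\<Sum>w\<in>words N. a w * z ^ length w * word_act n Z w x p)) \<le> C * cmod z ^ Suc N"
    using eventually_compose_filterlim[OF ev lim] small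
  proof eventually_elim
    fix z :: complex
    assume e: "\<forall>P\<in>{..<M}. cmod (f (X (z ^ Suc N)) $$ (R, P) - f (X 0) $$ (R, P)) \<le> K P * cmod (z ^ Suc N)"
      and z1: "cmod z < 1"
    define c where "c = z ^ Suc N"
    have c1: "cmod c \<le> 1" unfolding c_def norm_power by (rule power_le_one) (use z1 in auto)
    define s where "s = mat M n (\<lambda>(P, q). if P mod n = q then z ^ (N - P div n) else 0)"
    have s: "s \<in> carrier_mat M n" by (simp add: s_def)
    define zZ where "zZ = (\<lambda>i. z \<cdot>\<^sub>m Z i)"
    have zZl: "zZ \<in> nc_level n" unfolding zZ_def by (rule scaled_tuple_level[OF Zl])
    have "tuple_norm zZ \<le> cmod z * tuple_norm Z" unfolding zZ_def by (rule tuple_norm_scale_le[OF Zl])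
    also have "\<dots> \<le> 1 * tuple_norm Z" using z1 tuple_norm_nonneg[OF Zl] by (intro mult_right_mono) auto
    finally have zZd: "zZ \<in> nc_disc \<inter> nc_level n" using zZl Z1 nc_disc_level_iff[OF n, of zZ] by simp
    have sP: "s $$ (k * n + m, q) = (if m = q then z ^ (N - k) else 0)" if "k < Suc N" "m < n" "q < n" for k m q
      using that block_index_less[OF that(1,2)] by (simp add: s_def M_def del: mult_Suc)
    have inter: "s * zZ i = X c i * s" for i
    proof (rule eq_matI)
      fix P q assume "P < dim_row (X c i * s)" "q < dim_col (X c i * s)"
      then have P: "P < M" and q: "q < n" using nc_level_carrier[OF Xl[of c], of i] s by auto
      define k m where "k = P div n" and "m = P mod n"
      have k: "k < Suc N" using P by (simp add: k_def M_def less_mult_imp_div_less del: mult_Suc)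
      have m: "m < n" using n by (simp add: m_def)
      have Pkm: "P = k * n + m" by (simp add: k_def m_def)
      have "(s * zZ i) $$ (P, q) = (\<Sum>r<n. s $$ (P, r) * zZ i $$ (r, q))"
        by (rule mult_mat_entry[OF s nc_level_carrier[OF zZl] P q])
      also have "\<dots> = (\<Sum>r<n. if r = m then z ^ (N - k) * zZ i $$ (m, q) else 0)"
        unfolding Pkm by (rule sum.cong) (auto simp: sP[OF k m])
      also have "\<dots> = z ^ (N - k) * (z * Z i $$ (m, q))"
        using m q nc_level_carrier[OF Zl, of i] by (simp add: zZ_def)
      finally have lhs: "(s * zZ i) $$ (P, q) = z ^ (N - k) * (z * Z i $$ (m, q))" .
      have "(X c i * s) $$ (P, q) = mat_act M (X c i) (\<lambda>Q. s $$ (Q, q)) P"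
        unfolding act_def by (rule mult_mat_entry[OF nc_level_carrier[OF Xl] s P q])
      also have "\<dots> = (if k = 0 then c * mat_act n (Z i) (\<lambda>r. s $$ (N * n + r, q)) m
         else mat_act n (Z i) (\<lambda>r. s $$ ((k - 1) * n + r, q)) m)"
        unfolding Pkm X_def M_def by (rule act_jordan_tensor[OF k m])
      also have "\<dots> = z ^ (N - k) * (z * Z i $$ (m, q))"
      proof -
        have col: "mat_act n (Z i) (\<lambda>r. s $$ (l * n + r, q)) m = Z i $$ (m, q) * z ^ (N - l)" if "l < Suc N" for l
        proof -
          have "mat_act n (Z i) (\<lambda>r. s $$ (l * n + r, q)) m = (\<Sum>r<n. if r = q then Z i $$ (m, q) * z ^ (N - l) else 0)"
            unfolding act_def by (rule sum.cong) (auto simp: sP[OF that _ q])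
          then show ?thesis using q by simp
        qed
        show ?thesis
        proof (cases "k = 0")
          case True
          then show ?thesis using col[of N] by (simp add: c_def)
        next
          case False
          then have "N - (k - 1) = Suc (N - k)" using k by simp
          then show ?thesis using False col[of "k - 1"] k by simp
        qed
      qed
      finally show "(s * zZ i) $$ (P, q) = (X c i * s) $$ (P, q)" using lhs by simp
    qed (use nc_level_carrier[OF Xl, of c i] nc_level_carrier[OF zZl, of i] s in auto)
    have fz: "f zZ \<in> carrier_mat n n" using nc n zZd unfolding nc_function_def by blast
    have "s * f zZ = f (X c) * s"
      using nc n M zZd Xd[OF c1] s inter unfolding nc_function_def by blast
    then have row: "(\<Sum>r<n. s $$ (R, r) * f zZ $$ (r, q)) = (\<Sum>P<M. f (X c) $$ (R, P) * s $$ (P, q))" if "q < n" for q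
      using mult_mat_entry[OF s fz R that] mult_mat_entry[OF fX[OF c1] s R that] by simp
    define y where "y = (\<lambda>P. \<Sum>q<n. s $$ (P, q) * x q)"
    have y: "y (k * n + m) = z ^ (N - k) * x m" if "k < Suc N" "m < n" for k m
    proof -
      have "y (k * n + m) = (\<Sum>q<n. if q = m then z ^ (N - k) * x m else 0)"
        unfolding y_def by (rule sum.cong) (auto simp: sP[OF that])
      then show ?thesis using that by simp
    qed
    have "mat_act n (f zZ) x p = (\<Sum>q<n. (\<Sum>r<n. s $$ (R, r) * f zZ $$ (r, q)) * x q)"
      unfolding act_def
    proof (rule sum.cong[OF refl])
      fix q assume "q \<in> {..<n}"
      have "(\<Sum>r<n. s $$ (R, r) * f zZ $$ (r, q)) = (\<Sum>r<n. if r = p then f zZ $$ (p, q) else 0)"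
        unfolding R_def by (rule sum.cong) (auto simp: sP[OF _ p])
      then show "f zZ $$ (p, q) * x q = (\<Sum>r<n. s $$ (R, r) * f zZ $$ (r, q)) * x q" using p by simp
    qed
    also have "\<dots> = (\<Sum>q<n. (\<Sum>P<M. f (X c) $$ (R, P) * s $$ (P, q)) * x q)" using row by simp
    also have "\<dots> = (\<Sum>q<n. \<Sum>P<M. f (X c) $$ (R, P) * (s $$ (P, q) * x q))"
      by (simp add: sum_distrib_right mult.assoc)
    also have "\<dots> = (\<Sum>P<M. \<Sum>q<n. f (X c) $$ (R, P) * (s $$ (P, q) * x q))" by (rule sum.swap)
    also have "\<dots> = mat_act M (f (X c)) y R"
      by (simp add: act_def y_def sum_distrib_left)
    finally have 1: "mat_act n (f zZ) x p = mat_act M (f (X c)) y R" .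
    have "mat_act M (f (X 0)) y R = poly_act N a M (X 0) y R"
    proof (rule a[OF M X0d _ R])
      fix w :: "'d list" and x i assume w: "length w = Suc N" and i: "i < M"
      have "i div n < Suc N" using i by (simp add: M_def less_mult_imp_div_less del: mult_Suc)
      moreover have "i mod n < n" using n by simp
      ultimately have "word_act M (X 0) w x (i div n * n + i mod n) = 0"
        unfolding M_def X_def using word_act_jordan_tensor[of "i div n" N "i mod n" n Z w x] w by (simp del: mult_Suc div_mult_mod_eq)
      then show "word_act M (X 0) w x i = 0" by simp
    qed
    also have "\<dots> = (\<Sum>w\<in>words N. a w * z ^ length w * word_act n Z w x p)"
      unfolding poly_act_def
    proof (rule sum.cong[OF refl])
      fix w :: "'d list" assume "w \<in> words N"
      then have w: "length w \<le> N" by (simp add: words_def)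
      have "word_act M (X 0) w y R = word_act n Z w (\<lambda>q. y ((N - length w) * n + q)) p"
        unfolding M_def X_def R_def using word_act_jordan_tensor[of N N p n Z w y] p w by simp
      also have "\<dots> = word_act n Z w (\<lambda>q. z ^ length w * x q) p"
        by (rule word_act_cong[OF _ p]) (use y[of "N - length w"] w in simp)
      also have "\<dots> = z ^ length w * word_act n Z w x p" by (simp add: word_act_scale)
      finally show "a w * word_act M (X 0) w y R = a w * z ^ length w * word_act n Z w x p" by simp
    qed
    finally have 2: "mat_act M (f (X 0)) y R = (\<Sum>w\<in>words N. a w * z ^ length w * word_act n Z w x p)" .
    have yB: "cmod (y P) \<le> B" if P: "P < M" for P
    proof -
      have k: "P div n < Suc N" using P by (simp add: M_def less_mult_imp_div_less del: mult_Suc)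
      have m: "P mod n < n" using n by simp
      have "y P = z ^ (N - P div n) * x (P mod n)" using y[OF k m] by simp
      then have "cmod (y P) = cmod z ^ (N - P div n) * cmod (x (P mod n))" by (simp add: norm_mult norm_power)
      also have "\<dots> \<le> 1 * cmod (x (P mod n))" using z1 by (intro mult_right_mono power_le_one) auto
      also have "\<dots> \<le> B" using member_le_sum[of "P mod n" "{..<n}" "\<lambda>q. cmod (x q)"] m by (simp add: B_def)
      finally show ?thesis .
    qed
    have "mat_act n (f zZ) x p - (\<Sum>w\<in>words N. a w * z ^ length w * word_act n Z w x p)
      = (\<Sum>P<M. (f (X c) $$ (R, P) - f (X 0) $$ (R, P)) * y P)"
      unfolding 1 2[symmetric] by (simp add: act_def left_diff_distrib sum_subtractf)
    also have "cmod \<dots> \<le> (\<Sum>P<M. cmod ((f (X c) $$ (R, P) - f (X 0) $$ (R, P)) * y P))" by (rule norm_sum)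
    also have "\<dots> \<le> (\<Sum>P<M. K P * cmod c * B)"
      unfolding norm_mult using e yB K0 R by (intro sum_mono mult_mono) (auto simp: c_def)
    also have "\<dots> = C * cmod z ^ Suc N"
      by (simp add: C_def c_def norm_power norm_mult sum_distrib_left sum_distrib_right mult_ac)
    finally show "cmod (mat_act n (f (\<lambda>i. z \<cdot>\<^sub>m Z i)) x p
      - (\<Sum>w\<in>words N. a w * z ^ length w * word_act n Z w x p)) \<le> C * cmod z ^ Suc N"
      by (simp only: zZ_def)
  qed
  then show ?thesis using C0 by blast
qed

text \<open>
  The scalar function \<open>\<phi>\<close> pairs \<open>f (z Z) x\<close> with the difference \<open>v\<close> of \<open>f Z x\<close> and the polynomial, so that its Taylor remainder
  at \<open>z = 1\<close> is the square of the norm of \<open>v\<close>.  It is holomorphic on the disc of radius \<open>1 / t\<^sup>2\<close>, and the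
  estimate for the circle of radius \<open>1 / t\<close> gives the bound.
\<close>

theorem polynomial_approximation:
  fixes f :: "('d::finite) mtuple \<Rightarrow> complex mat"
  assumes hol: "nc_holomorphic f" and bd: "\<forall>Z\<in>nc_disc. op_norm (f Z) \<le> 1"
    and a: "\<And>n X x i. n \<ge> 1 \<Longrightarrow> X \<in> nc_disc \<inter> nc_level n \<Longrightarrow>
      (\<And>w x i. length w = Suc N \<Longrightarrow> i < n \<Longrightarrow> word_act n X w x i = 0) \<Longrightarrow> i < n \<Longrightarrow>
      mat_act n (f X) x i = poly_act N a n X x i"
    and n: "n \<ge> 1" and Z: "Z \<in> nc_level n" and Zr: "tuple_norm Z \<le> t\<^sup>2" and t: "0 < t" "t < 1"
  shows "nsq {..<n} (\<lambda>p. mat_act n (f Z) x p - poly_act N a n Z x p) \<le> (t ^ Suc N / (1 - t))\<^sup>2 * nsq {..<n} x"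
proof -
  have nc: "nc_function f" using hol by (simp add: nc_holomorphic_def)
  define R where "R = 1 / t\<^sup>2"
  define \<rho> where "\<rho> = 1 / t"
  have t2: "t\<^sup>2 < t" using t by (simp add: power2_eq_square)
  have R: "1 < \<rho>" "\<rho> < R" using t t2 by (auto simp: \<rho>_def R_def field_simps)
  have Rt: "R * t\<^sup>2 = 1" using t by (simp add: R_def)
  have zZ: "(\<lambda>i. z \<cdot>\<^sub>m Z i) \<in> nc_disc \<inter> nc_level n" if "cmod z < R" for z
  proof -
    have "tuple_norm (\<lambda>i. z \<cdot>\<^sub>m Z i) \<le> cmod z * tuple_norm Z" by (rule tuple_norm_scale_le[OF Z])
    also have "\<dots> \<le> cmod z * t\<^sup>2" using Zr by (intro mult_left_mono) auto
    also have "\<dots> < R * t\<^sup>2" using that t by (intro mult_strict_right_mono) auto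
    finally have "tuple_norm (\<lambda>i. z \<cdot>\<^sub>m Z i) < 1" by (simp only: Rt)
    then show ?thesis using scaled_tuple_level[OF Z] nc_disc_level_iff[OF n] by blast
  qed
  have Zd: "Z \<in> nc_disc \<inter> nc_level n"
  proof -
    have "t\<^sup>2 < 1" using t2 t by simp
    then have "tuple_norm Z < 1" using Zr by linarith
    then show ?thesis using Z nc_disc_level_iff[OF n] by blast
  qed
  define F where "F = (\<lambda>z. f (\<lambda>i. z \<cdot>\<^sub>m Z i))"
  have Fc: "F z \<in> carrier_mat n n" if "cmod z < R" for z
    using nc n zZ[OF that] unfolding F_def nc_function_def by blast
  have F_deriv: "(\<lambda>z. F z $$ (i, j)) field_differentiable (at z)" if z: "cmod z < R" and ij: "i < n" "j < n" for z i j
  proof -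
    have "level_complex_differentiable n f (\<lambda>i. z \<cdot>\<^sub>m Z i)"
      using hol n zZ[OF z] unfolding nc_holomorphic_def by blast
    moreover have "f (\<lambda>i. z \<cdot>\<^sub>m Z i) \<in> carrier_mat n n" using Fc[OF z] by (simp add: F_def)
    ultimately obtain D where D: "((\<lambda>c. f (\<lambda>k. z \<cdot>\<^sub>m Z k + c \<cdot>\<^sub>m Z k) $$ (i, j)) has_field_derivative D) (at 0)"
      using level_differentiable_entry[OF _ _ Z ij] by blast
    have "(\<lambda>k. z \<cdot>\<^sub>m Z k + c \<cdot>\<^sub>m Z k) = (\<lambda>k. (c + z) \<cdot>\<^sub>m Z k)" for c
      by (rule ext, rule eq_matI) (auto simp: algebra_simps)
    then have "((\<lambda>c. F (c + z) $$ (i, j)) has_field_derivative D) (at 0)" using D by (simp add: F_def)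
    then have "((\<lambda>z. F z $$ (i, j)) has_field_derivative D) (at (0 + z))"
      by (simp only: DERIV_shift)
    then show ?thesis unfolding field_differentiable_def by auto
  qed
  define g where "g = (\<lambda>p z. mat_act n (F z) x p)"
  define v where "v = (\<lambda>p. mat_act n (f Z) x p - poly_act N a n Z x p)"
  define \<phi> where "\<phi> = (\<lambda>z. ip {..<n} v (\<lambda>p. g p z))"
  define c where "c = (\<lambda>k. \<Sum>w\<in>words N. if length w = k then a w * ip {..<n} v (word_act n Z w x) else 0)"
  have phi_hol: "\<phi> holomorphic_on ball 0 R"
    unfolding holomorphic_on_def
  proof
    fix z :: complex assume "z \<in> ball 0 R"
    then have z: "cmod z < R" by simp
    have "(\<lambda>z. \<Sum>p<n. cnj (v p) * (\<Sum>q<n. F z $$ (p, q) * x q)) field_differentiable (at z)"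
      by (intro field_differentiable_sum field_differentiable_mult field_differentiable_const F_deriv z) auto
    then have "\<phi> field_differentiable (at z)" by (simp add: \<phi>_def ip_def g_def act_def)
    then show "\<phi> field_differentiable (at z within ball 0 R)" by (rule field_differentiable_at_within)
  qed
  define B where "B = sqrt (nsq {..<n} v) * sqrt (nsq {..<n} x)"
  have phi_bd: "cmod (\<phi> z) \<le> B" if z: "cmod z < R" for z
  proof -
    have op: "op_norm (F z) \<le> 1" using bd zZ[OF z] by (auto simp: F_def)
    have "nsq {..<n} (\<lambda>p. g p z) \<le> (op_norm (F z))\<^sup>2 * nsq {..<n} x"
      unfolding g_def by (rule nsq_act_op_norm(1)[OF Fc[OF z]])
    also have "\<dots> \<le> 1 * nsq {..<n} x"
      using op nsq_act_op_norm(2)[OF Fc[OF z]] by (intro mult_right_mono power_le_one) auto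
    finally have "sqrt (nsq {..<n} (\<lambda>p. g p z)) \<le> sqrt (nsq {..<n} x)" by simp
    then have "sqrt (nsq {..<n} v) * sqrt (nsq {..<n} (\<lambda>p. g p z)) \<le> B"
      unfolding B_def by (intro mult_left_mono) auto
    then show ?thesis unfolding \<phi>_def using cmod_ip_le order_trans by blast
  qed
  have "\<forall>p. \<exists>C. p < n \<longrightarrow> C \<ge> 0 \<and> (\<forall>\<^sub>F z in nhds 0. cmod (g p z - (\<Sum>w\<in>words N. a w * z ^ length w * word_act n Z w x p)) \<le> C * cmod z ^ Suc N)"
  proof
    fix p
    show "\<exists>C. p < n \<longrightarrow> C \<ge> 0 \<and> (\<forall>\<^sub>F z in nhds 0. cmod (g p z - (\<Sum>w\<in>words N. a w * z ^ length w * word_act n Z w x p)) \<le> C * cmod z ^ Suc N)"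
    proof (cases "p < n")
      case True
      have "\<exists>C\<ge>0. \<forall>\<^sub>F z in nhds 0. cmod (mat_act n (f (\<lambda>i. z \<cdot>\<^sub>m Z i)) x p
        - (\<Sum>w\<in>words N. a w * z ^ length w * word_act n Z w x p)) \<le> C * cmod z ^ Suc N"
        by (rule polynomial_contact[OF hol a n Zd True])
      then show ?thesis unfolding g_def F_def by blast
    qed simp
  qed
  from choice[OF this] obtain K where K: "\<And>p. p < n \<Longrightarrow> K p \<ge> 0"
    "\<And>p. p < n \<Longrightarrow> \<forall>\<^sub>F z in nhds 0. cmod (g p z - (\<Sum>w\<in>words N. a w * z ^ length w * word_act n Z w x p)) \<le> K p * cmod z ^ Suc N"
    by blast
  have ev: "\<forall>\<^sub>F z in nhds 0. \<forall>p\<in>{..<n}. cmod (g p z - (\<Sum>w\<in>words N. a w * z ^ length w * word_act n Z w x p)) \<le> K p * cmod z ^ Suc N"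
    by (rule eventually_ball_finite) (use K(2) in auto)
  define C where "C = (\<Sum>p<n. cmod (v p) * K p)"
  have "\<forall>\<^sub>F z in nhds 0. cmod (\<phi> z - (\<Sum>k\<le>N. c k * z ^ k)) \<le> C * cmod z ^ Suc N"
    using ev
  proof eventually_elim
    fix z :: complex
    assume e: "\<forall>p\<in>{..<n}. cmod (g p z - (\<Sum>w\<in>words N. a w * z ^ length w * word_act n Z w x p)) \<le> K p * cmod z ^ Suc N"
    have "(\<Sum>k\<le>N. c k * z ^ k) = (\<Sum>k\<le>N. \<Sum>w\<in>words N. if length w = k then a w * ip {..<n} v (word_act n Z w x) * z ^ length w else 0)"
      unfolding c_def sum_distrib_right by (intro sum.cong refl) auto
    also have "\<dots> = (\<Sum>w\<in>words N. \<Sum>k\<le>N. if length w = k then a w * ip {..<n} v (word_act n Z w x) * z ^ length w else 0)"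
      by (rule sum.swap)
    also have "\<dots> = (\<Sum>w\<in>words N. a w * ip {..<n} v (word_act n Z w x) * z ^ length w)"
      by (rule sum.cong) (auto simp: words_def)
    also have "\<dots> = (\<Sum>w\<in>words N. \<Sum>p<n. cnj (v p) * (a w * z ^ length w * word_act n Z w x p))"
      unfolding ip_def by (simp add: sum_distrib_left sum_distrib_right mult_ac)
    also have "\<dots> = (\<Sum>p<n. \<Sum>w\<in>words N. cnj (v p) * (a w * z ^ length w * word_act n Z w x p))"
      by (rule sum.swap)
    finally have "\<phi> z - (\<Sum>k\<le>N. c k * z ^ k) = (\<Sum>p<n. cnj (v p) * (g p z - (\<Sum>w\<in>words N. a w * z ^ length w * word_act n Z w x p)))"
      by (simp add: \<phi>_def ip_def right_diff_distrib sum_subtractf sum_distrib_left)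
    also have "cmod \<dots> \<le> (\<Sum>p<n. cmod (cnj (v p) * (g p z - (\<Sum>w\<in>words N. a w * z ^ length w * word_act n Z w x p))))"
      by (rule norm_sum)
    also have "\<dots> \<le> (\<Sum>p<n. cmod (v p) * (K p * cmod z ^ Suc N))"
      unfolding norm_mult complex_mod_cnj using e by (intro sum_mono mult_left_mono) auto
    also have "\<dots> = C * cmod z ^ Suc N"
      unfolding C_def sum_distrib_right by (simp add: mult_ac)
    finally show "cmod (\<phi> z - (\<Sum>k\<le>N. c k * z ^ k)) \<le> C * cmod z ^ Suc N" .
  qed
  then obtain \<delta> where \<delta>: "\<delta> > 0" "\<And>z. dist z 0 < \<delta> \<Longrightarrow> cmod (\<phi> z - (\<Sum>k\<le>N. c k * z ^ k)) \<le> C * cmod z ^ Suc N"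
    unfolding eventually_nhds_metric by blast
  define e where "e = t ^ Suc N / (1 - t)"
  have e0: "e \<ge> 0" using t by (simp add: e_def)
  have "cmod (\<phi> 1 - (\<Sum>k\<le>N. c k)) \<le> B * ((1 / \<rho>) ^ Suc N / (1 - 1 / \<rho>))"
    by (rule taylor_remainder_from_contact[OF phi_hol R phi_bd \<delta>(1) \<delta>(2)]) (auto simp: dist_norm)
  then have main: "cmod (\<phi> 1 - (\<Sum>k\<le>N. c k)) \<le> B * e" by (simp add: \<rho>_def e_def)
  have "(\<Sum>k\<le>N. c k) = (\<Sum>w\<in>words N. \<Sum>k\<le>N. if length w = k then a w * ip {..<n} v (word_act n Z w x) else 0)"
    unfolding c_def by (rule sum.swap)
  also have "\<dots> = (\<Sum>w\<in>words N. a w * ip {..<n} v (word_act n Z w x))"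
    by (rule sum.cong) (auto simp: words_def)
  also have "\<dots> = (\<Sum>w\<in>words N. \<Sum>p<n. cnj (v p) * (a w * word_act n Z w x p))"
    unfolding ip_def by (simp add: sum_distrib_left mult_ac)
  also have "\<dots> = (\<Sum>p<n. \<Sum>w\<in>words N. cnj (v p) * (a w * word_act n Z w x p))" by (rule sum.swap)
  also have "\<dots> = ip {..<n} v (poly_act N a n Z x)"
    unfolding ip_def poly_act_def by (simp add: sum_distrib_left)
  finally have c1: "(\<Sum>k\<le>N. c k) = ip {..<n} v (poly_act N a n Z x)" .
  have "(\<lambda>i. 1 \<cdot>\<^sub>m Z i) = Z" by (rule ext, rule eq_matI) auto
  then have "\<phi> 1 = ip {..<n} v (mat_act n (f Z) x)" by (simp add: \<phi>_def g_def F_def)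
  then have "\<phi> 1 - (\<Sum>k\<le>N. c k) = ip {..<n} v v"
    unfolding c1 by (simp add: v_def ip_diff_right)
  then have "nsq {..<n} v \<le> B * e" using main by (simp add: ip_self)
  then have "sqrt (nsq {..<n} v) * sqrt (nsq {..<n} v) \<le> sqrt (nsq {..<n} v) * (e * sqrt (nsq {..<n} x))"
    by (simp add: B_def mult_ac)
  then have "sqrt (nsq {..<n} v) \<le> e * sqrt (nsq {..<n} x)" by (rule mult_self_le_imp_le) (use e0 in auto)
  then have "(sqrt (nsq {..<n} v))\<^sup>2 \<le> (e * sqrt (nsq {..<n} x))\<^sup>2" by (intro power_mono) auto
  then have "nsq {..<n} v \<le> e\<^sup>2 * nsq {..<n} x" by (simp add: power_mult_distrib)
  then show ?thesis unfolding v_def e_def .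
qed

section \<open>The Agler decomposition\<close>

lemma injective_mat_inverse:
  fixes A :: "complex mat"
  assumes A: "A \<in> carrier_mat n n"
    and inj: "\<And>x. (\<And>i. i < n \<Longrightarrow> mat_act n A x i = 0) \<Longrightarrow> (\<And>i. i < n \<Longrightarrow> x i = 0)"
  shows "\<exists>B. mat_inverse A = Some B \<and> B \<in> carrier_mat n n \<and> A * B = 1\<^sub>m n \<and> B * A = 1\<^sub>m n"
proof -
  have "det A \<noteq> 0"
  proof
    assume "det A = 0"
    then obtain v where v: "v \<in> carrier_vec n" "v \<noteq> 0\<^sub>v n" "A *\<^sub>v v = 0\<^sub>v n"
      using det_0_iff_vec_prod_zero_field[OF A] by blast
    have "mat_act n A (vec_index v) i = 0" if "i < n" for i
      using mult_vec_entry[OF A v(1) that] v(3) that by (simp add: act_def)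
    from inj[OF this] have "v = 0\<^sub>v n" using v(1) by (intro eq_vecI) auto
    then show False using v(2) by simp
  qed
  then have "A \<in> Units (ring_mat TYPE(complex) n ())" by (rule det_non_zero_imp_unit[OF A])
  then have "mat_inverse A \<noteq> None" using mat_inverse(1)[OF A, where b = "()"] by blast
  then obtain B where "mat_inverse A = Some B" by blast
  then show ?thesis using mat_inverse(2)[OF A] by blast
qed

lemma injective_kernel_inverse:
  fixes q :: "'a \<Rightarrow> 'a \<Rightarrow> complex"
  assumes fin: "finite W"
    and inj: "\<And>x. (\<And>w. w \<in> W \<Longrightarrow> act W q x w = 0) \<Longrightarrow> (\<And>w. w \<in> W \<Longrightarrow> x w = 0)"
  shows "\<exists>p. (\<forall>x. \<forall>w\<in>W. act W q (act W p x) w = x w) \<and> (\<forall>x. \<forall>w\<in>W. act W p (act W q x) w = x w)"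
proof -
  define M where "M = card W"
  obtain e where e: "bij_betw e {..<M} W"
    using ex_bij_betw_nat_finite[OF fin] by (auto simp: M_def atLeast0LessThan)
  define g where "g = inv_into {..<M} e"
  have g: "g w < M" "e (g w) = w" if "w \<in> W" for w
    using bij_betw_inv_into_right[OF e that] bij_betw_apply[OF bij_betw_inv_into[OF e] that] by (auto simp: g_def)
  have eg: "e p \<in> W" "g (e p) = p" if "p < M" for p
    using bij_betw_apply[OF e] bij_betw_inv_into_left[OF e] that by (auto simp: g_def)
  have sumW: "(\<Sum>p<M. F (e p)) = (\<Sum>w\<in>W. F w)" for F :: "'a \<Rightarrow> complex"
    by (rule sum.reindex_bij_betw[OF e])
  have trans: "act {..<M} (\<lambda>r s. A (e r) (e s)) y r = act W A (\<lambda>w. y (g w)) (e r)" for A y r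
    unfolding act_def sumW[symmetric] by (rule sum.cong) (auto simp: eg)
  define Q where "Q = mat M M (\<lambda>(r, s). q (e r) (e s))"
  have Q: "Q \<in> carrier_mat M M" by (simp add: Q_def)
  have Qact: "mat_act M Q y r = act W q (\<lambda>w. y (g w)) (e r)" if "r < M" for y r
    unfolding trans[symmetric] by (rule act_cong) (use that in \<open>auto simp: Q_def\<close>)
  have "\<exists>B. mat_inverse Q = Some B \<and> B \<in> carrier_mat M M \<and> Q * B = 1\<^sub>m M \<and> B * Q = 1\<^sub>m M"
  proof (rule injective_mat_inverse[OF Q])
    fix x i assume x: "\<And>i. i < M \<Longrightarrow> mat_act M Q x i = 0" and i: "i < M"
    have "x (g (e i)) = 0"
    proof (rule inj)
      fix w assume "w \<in> W"
      then show "act W q (\<lambda>w. x (g w)) w = 0" using x[of "g w"] Qact[of "g w" x] g by simp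
    qed (use eg i in auto)
    then show "x i = 0" using eg i by simp
  qed
  then obtain B where B: "B \<in> carrier_mat M M" "Q * B = 1\<^sub>m M" "B * Q = 1\<^sub>m M" by blast
  define p where "p = (\<lambda>w v. B $$ (g w, g v))"
  have mult: "mat_act M A1 (mat_act M A2 x) r = x r"
    if A: "A1 \<in> carrier_mat M M" "A2 \<in> carrier_mat M M" "A1 * A2 = 1\<^sub>m M" and r: "r < M" for A1 A2 :: "complex mat" and x r
  proof -
    have "mat_act M A1 (mat_act M A2 x) r = act {..<M} (\<lambda>r s. (A1 * A2) $$ (r, s)) x r"
      unfolding act_act by (rule act_cong) (use r mult_mat_entry[OF A(1,2)] in auto)
    also have "\<dots> = act {..<M} (\<lambda>r s. of_bool (r = s)) x r"
      by (rule act_cong) (use r in \<open>auto simp: A(3)\<close>)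
    finally show ?thesis using act_delta[of "{..<M}" r x] r by simp
  qed
  have p_act: "act W p x w = mat_act M B (\<lambda>r. x (e r)) (g w)" if "w \<in> W" for x w
    unfolding act_def p_def sumW[symmetric] by (rule sum.cong) (auto simp: eg)
  have "act W q (act W p x) w = x w" if w: "w \<in> W" for x w
  proof -
    have "act W q (act W p x) w = act W q (\<lambda>w. mat_act M B (\<lambda>r. x (e r)) (g w)) (e (g w))"
      using g w by (simp, intro act_cong) (auto simp: p_act)
    also have "\<dots> = mat_act M Q (mat_act M B (\<lambda>r. x (e r))) (g w)"
      using Qact g w by simp
    also have "\<dots> = x w" using mult[OF Q B(1,2)] g w by simp
    finally show ?thesis .
  qed
  moreover have "act W p (act W q x) w = x w" if w: "w \<in> W" for x w
  proof -
    have "act W p (act W q x) w = mat_act M B (\<lambda>r. act W q x (e r)) (g w)" using p_act w by blast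
    also have "\<dots> = mat_act M B (mat_act M Q (\<lambda>r. x (e r))) (g w)"
    proof (rule act_cong)
      fix r assume "r \<in> {..<M}"
      then have r: "r < M" by simp
      have "act W q x (e r) = act W q (\<lambda>w. x (e (g w))) (e r)" by (rule act_cong) (use eg g r in auto)
      then show "act W q x (e r) = mat_act M Q (\<lambda>r. x (e r)) r" using Qact[OF r, of "\<lambda>r. x (e r)"] by simp
    qed (use g w in auto)
    also have "\<dots> = x w" using mult[OF B(1) Q B(3)] g w by simp
    finally show ?thesis .
  qed
  ultimately show ?thesis by (intro exI[of _ p]) blast
qed

primrec append_word :: "'d list \<Rightarrow> ('d list \<Rightarrow> complex) \<Rightarrow> 'd list \<Rightarrow> complex" where
  "append_word [] x = x"
| "append_word (i # w) x = append_word w (append_op i x)"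

lemma append_word_short:
  assumes "\<And>u. length u < k \<Longrightarrow> x u = 0" "length v < k + length w"
  shows "append_word w x v = 0"
  using assms
proof (induction w arbitrary: k x)
  case (Cons i w)
  have "append_word w (append_op i x) v = 0"
  proof (rule Cons.IH[where k = "Suc k"])
    show "append_op i x u = 0" if "length u < Suc k" for u
      using Cons.prems(1)[of "butlast u"] that by (cases u rule: rev_cases) (auto simp: append_op_def)
  qed (use Cons.prems(2) in simp)
  then show ?case by simp
qed simp

lemma append_word_delta: "append_word w (\<lambda>v. of_bool (v = u)) = (\<lambda>v. of_bool (v = u @ w))"
proof (induction w arbitrary: u)
  case (Cons i w)
  have "append_op i (\<lambda>v. of_bool (v = u)) = (\<lambda>v. of_bool (v = u @ [i]))"
    by (rule ext) (auto simp: append_op_def)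
  then show ?case using Cons[of "u @ [i]"] by simp
qed simp

text \<open>
  The kernel \<open>q\<close> transports the inner product \<open>\<langle>q x, q y\<rangle>\<close> on functions of words to the standard one, and
  \<open>T i\<close> is the operator that appends \<open>i\<close>, written in the new coordinates.  The adjoints \<open>\<zeta> i\<close> form a nilpotent
  tuple of strict contractions.  The adjoint of \<open>f\<close> at this tuple sends the vector of the empty word to that of
  \<open>\<lambda>w. cnj (a w)\<close>, because appending the letters of \<open>w\<close> one after the other to the empty word gives \<open>w\<close>.  So the
  claim is that \<open>f\<close> is a contraction there.
\<close>

lemma contractive_model_bound:
  fixes f :: "('d::finite) mtuple \<Rightarrow> complex mat" and q :: "'d list \<Rightarrow> 'd list \<Rightarrow> complex"
  assumes nc: "nc_function f" and bd: "\<forall>Z\<in>nc_disc. op_norm (f Z) \<le> 1"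
    and a: "\<And>n X x i. n \<ge> 1 \<Longrightarrow> X \<in> nc_disc \<inter> nc_level n \<Longrightarrow>
      (\<And>w x i. length w = Suc N \<Longrightarrow> i < n \<Longrightarrow> word_act n X w x i = 0) \<Longrightarrow> i < n \<Longrightarrow>
      mat_act n (f X) x i = poly_act N a n X x i"
    and inj: "\<And>x. nsq (words N) (act (words N) q x) = 0 \<Longrightarrow> \<forall>w\<in>words N. x w = 0"
    and t: "0 \<le> t" "t < 1"
    and shift: "\<And>i x. nsq (words N) (act (words N) q (append_op i x)) \<le> t\<^sup>2 * nsq (words N) (act (words N) q x)"
  shows "nsq (words N) (act (words N) q (\<lambda>w. cnj (a w))) \<le> nsq (words N) (act (words N) q (\<lambda>w. of_bool (w = [])))"
proof -
  define W where "W = (words N :: 'd list set)"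
  have finW: "finite W" by (simp add: W_def)
  have "\<exists>p. (\<forall>x. \<forall>w\<in>W. act W q (act W p x) w = x w) \<and> (\<forall>x. \<forall>w\<in>W. act W p (act W q x) w = x w)"
  proof (rule injective_kernel_inverse[OF finW])
    fix x :: "'d list \<Rightarrow> complex" and w assume "\<And>w. w \<in> W \<Longrightarrow> act W q x w = 0" and w: "w \<in> W"
    then have "nsq W (act W q x) = 0" by (simp add: nsq_def)
    then show "x w = 0" using inj[of x] w by (simp add: W_def)
  qed
  then obtain p where qp: "\<And>x w. w \<in> W \<Longrightarrow> act W q (act W p x) w = x w"
    and pq: "\<And>x w. w \<in> W \<Longrightarrow> act W p (act W q x) w = x w" by blast
  define T where "T = (\<lambda>i a b. \<Sum>v\<in>W. q a v * append_op i (\<lambda>u. p u b) v)"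
  have T: "act W (T i) y a = act W q (append_op i (act W p y)) a" for i y a
  proof -
    have "act W (T i) y a = (\<Sum>b\<in>W. \<Sum>v\<in>W. q a v * (append_op i (\<lambda>u. p u b) v * y b))"
      unfolding act_def T_def by (simp add: sum_distrib_right mult.assoc)
    also have "\<dots> = (\<Sum>v\<in>W. \<Sum>b\<in>W. q a v * (append_op i (\<lambda>u. p u b) v * y b))" by (rule sum.swap)
    also have "\<dots> = act W q (append_op i (act W p y)) a"
      unfolding act_def by (rule sum.cong) (auto simp: append_op_def sum_distrib_left)
    finally show ?thesis .
  qed
  have append_cong: "append_op i x w = append_op i y w" if "\<And>u. u \<in> W \<Longrightarrow> x u = y u" "w \<in> W" for i x y w
    using that(1)[of "butlast w"] that(2) by (auto simp: append_op_def W_def words_def)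
  have Tq: "act W (T i) (act W q x) w = act W q (append_op i x) w" if "w \<in> W" for i x w
    unfolding T using that by (intro act_cong append_cong) (auto simp: pq)
  have T_norm: "nsq W (act W (T i) y) \<le> t\<^sup>2 * nsq W y" for i y
  proof -
    have "nsq W (act W (T i) y) = nsq W (act W q (append_op i (act W p y)))" by (rule nsq_cong) (rule T)
    also have "\<dots> \<le> t\<^sup>2 * nsq W (act W q (act W p y))" using shift by (simp add: W_def)
    also have "nsq W (act W q (act W p y)) = nsq W y" by (rule nsq_cong) (rule qp)
    finally show ?thesis .
  qed
  define \<zeta> where "\<zeta> = (\<lambda>i a b. cnj (T i b a))"
  have adj: "ip W (act W (\<zeta> i) x) y = ip W x (act W (T i) y)" for i x y
  proof -
    have "ip W (act W (\<zeta> i) x) y = (\<Sum>a\<in>W. \<Sum>b\<in>W. T i b a * cnj (x b) * y a)"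
      unfolding ip_def act_def \<zeta>_def by (simp add: sum_distrib_right)
    also have "\<dots> = (\<Sum>b\<in>W. \<Sum>a\<in>W. T i b a * cnj (x b) * y a)" by (rule sum.swap)
    also have "\<dots> = ip W x (act W (T i) y)"
      unfolding ip_def act_def by (simp add: sum_distrib_left mult_ac)
    finally show ?thesis .
  qed
  have \<zeta>_norm: "nsq W (act W (\<zeta> i) x) \<le> t\<^sup>2 * nsq W x" for i x
  proof -
    define y where "y = act W (\<zeta> i) x"
    have "complex_of_real (nsq W y) = ip W x (act W (T i) y)" unfolding y_def by (simp add: ip_self[symmetric] adj)
    then have "nsq W y = cmod (ip W x (act W (T i) y))" by (metis nsq_nonneg norm_of_real abs_of_nonneg)
    also have "\<dots> \<le> sqrt (nsq W x) * sqrt (nsq W (act W (T i) y))" by (rule cmod_ip_le)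
    also have "\<dots> \<le> sqrt (nsq W x) * sqrt (t\<^sup>2 * nsq W y)" by (intro mult_left_mono real_sqrt_le_mono T_norm) simp
    also have "\<dots> = (t * sqrt (nsq W x)) * sqrt (nsq W y)" using t by (simp add: real_sqrt_mult)
    finally have "sqrt (nsq W y) * sqrt (nsq W y) \<le> sqrt (nsq W y) * (t * sqrt (nsq W x))" by (simp add: mult_ac)
    then have "sqrt (nsq W y) \<le> t * sqrt (nsq W x)" by (rule mult_self_le_imp_le) (use t in auto)
    then have "(sqrt (nsq W y))\<^sup>2 \<le> (t * sqrt (nsq W x))\<^sup>2" by (rule power_mono) simp
    then show ?thesis by (simp add: y_def power_mult_distrib)
  qed
  define zact where "zact = (\<lambda>w x. foldr (\<lambda>i. act W (\<zeta> i)) w x)"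
  have zact_simps: "zact [] x = x" "zact (i # w) x = act W (\<zeta> i) (zact w x)" for i w x
    by (simp_all add: zact_def)
  have zact_adj: "ip W (zact w x) (act W q y) = ip W x (act W q (append_word w y))" for w x y
  proof (induction w arbitrary: y)
    case (Cons i w)
    have "ip W (zact (i # w) x) (act W q y) = ip W (zact w x) (act W (T i) (act W q y))"
      by (simp add: zact_simps adj)
    also have "\<dots> = ip W (zact w x) (act W q (append_op i y))" by (rule ip_cong) (auto simp: Tq)
    finally show ?case using Cons by simp
  qed (simp add: zact_simps)
  \<comment> \<open>Enumerating the words turns \<open>\<zeta>\<close> into a tuple of matrices.\<close>
  define M where "M = card W"
  obtain e where e: "bij_betw e {..<M} W"
    using ex_bij_betw_nat_finite[OF finW] by (auto simp: M_def atLeast0LessThan)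
  define g where "g = inv_into {..<M} e"
  have g: "g w < M" "e (g w) = w" if "w \<in> W" for w
    using bij_betw_inv_into_right[OF e that] bij_betw_apply[OF bij_betw_inv_into[OF e] that] by (auto simp: g_def)
  have eg: "e r \<in> W" "g (e r) = r" if "r < M" for r
    using bij_betw_apply[OF e] bij_betw_inv_into_left[OF e] that by (auto simp: g_def)
  have M1: "M \<ge> 1" using g(1)[of "[]"] by (simp add: W_def)
  define Z where "Z = (\<lambda>i. mat M M (\<lambda>(r, s). \<zeta> i (e r) (e s)))"
  have Zl: "Z \<in> nc_level M" by (simp add: Z_def nc_level_def)
  have nsq_e: "nsq {..<M} (\<lambda>r. x (e r)) = nsq W x" for x
    unfolding nsq_def by (rule sum.reindex_bij_betw[OF e])
  have Zact: "mat_act M (Z i) (\<lambda>r. x (e r)) r = act W (\<zeta> i) x (e r)" if "r < M" for i x r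
  proof -
    have "mat_act M (Z i) (\<lambda>r. x (e r)) r = (\<Sum>s<M. \<zeta> i (e r) (e s) * x (e s))"
      unfolding act_def by (rule sum.cong) (use that in \<open>auto simp: Z_def\<close>)
    also have "\<dots> = act W (\<zeta> i) x (e r)" unfolding act_def by (rule sum.reindex_bij_betw[OF e])
    finally show ?thesis .
  qed
  have via_e: "y r = y (g (e r))" if "r < M" for y :: "nat \<Rightarrow> complex" and r using eg that by simp
  have "op_norm (Z i) \<le> t" for i
  proof (rule op_norm_le)
    fix y
    have "nsq {..<M} (mat_act M (Z i) y) = nsq {..<M} (\<lambda>r. act W (\<zeta> i) (\<lambda>w. y (g w)) (e r))"
    proof (rule nsq_cong)
      fix r assume "r \<in> {..<M}"
      then have r: "r < M" by simp
      have "mat_act M (Z i) y r = mat_act M (Z i) (\<lambda>r. y (g (e r))) r"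
        by (rule act_cong) (use eg r in auto)
      then show "mat_act M (Z i) y r = act W (\<zeta> i) (\<lambda>w. y (g w)) (e r)"
        using Zact[OF r, of i "\<lambda>w. y (g w)"] by simp
    qed
    also have "\<dots> \<le> t\<^sup>2 * nsq W (\<lambda>w. y (g w))" unfolding nsq_e by (rule \<zeta>_norm)
    also have "nsq W (\<lambda>w. y (g w)) = nsq {..<M} y" unfolding nsq_e[symmetric] by (rule nsq_cong) (auto simp: eg)
    finally show "nsq {..<M} (mat_act M (Z i) y) \<le> t\<^sup>2 * nsq {..<M} y" .
  qed (use t in \<open>auto simp: Z_def\<close>)
  then have "tuple_norm Z \<le> t" unfolding tuple_norm_le_iff by blast
  then have "tuple_norm Z < 1" using t by linarith
  then have Zd: "Z \<in> nc_disc \<inter> nc_level M" using Zl nc_disc_level_iff[OF M1] by blast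
  have word_act_Z: "word_act M Z w (\<lambda>r. x (e r)) r = zact w x (e r)" if "r < M" for w x r
    using that
  proof (induction w arbitrary: r)
    case (Cons i w)
    have "word_act M Z (i # w) (\<lambda>r. x (e r)) r = mat_act M (Z i) (\<lambda>r. zact w x (e r)) r"
      unfolding word_act.simps by (rule act_cong) (use Cons in auto)
    then show ?case using Zact[OF Cons.prems] by (simp add: zact_simps)
  qed (simp add: zact_simps)
  have nil: "word_act M Z w x r = 0" if w: "length w = Suc N" and r: "r < M" for w x r
  proof -
    have "word_act M Z w x r = word_act M Z w (\<lambda>r. x (g (e r))) r" by (rule word_act_cong[OF _ r]) (use eg in auto)
    then have 1: "word_act M Z w x r = zact w (\<lambda>w. x (g w)) (e r)" using word_act_Z[OF r, of w "\<lambda>w. x (g w)"] by simp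
    define \<xi> where "\<xi> = zact w (\<lambda>w. x (g w))"
    have "ip W \<xi> \<xi> = ip W \<xi> (act W q (act W p \<xi>))" by (rule ip_cong) (auto simp: qp)
    also have "\<dots> = ip W (\<lambda>w. x (g w)) (act W q (append_word w (act W p \<xi>)))" unfolding \<xi>_def by (rule zact_adj)
    also have "\<dots> = ip W (\<lambda>w. x (g w)) (\<lambda>_. 0)"
    proof (rule ip_cong)
      fix u assume "u \<in> W"
      have "append_word w (act W p \<xi>) v = 0" if "v \<in> W" for v
        by (rule append_word_short[where k = 0]) (use that w in \<open>auto simp: W_def words_def\<close>)
      then show "act W q (append_word w (act W p \<xi>)) u = 0" by (simp add: act_def)
    qed simp
    finally have "nsq W \<xi> = 0" by (simp add: ip_self ip_def)
    then have "\<xi> (e r) = 0" using eg(1)[OF r] finW by (simp add: nsq_def sum_nonneg_eq_0_iff)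
    then show ?thesis using 1 by (simp add: \<xi>_def)
  qed
  have fZ: "f Z \<in> carrier_mat M M" using nc M1 Zd unfolding nc_function_def by blast
  have f1: "op_norm (f Z) \<le> 1" using bd Zd by blast
  define \<alpha> where "\<alpha> = (\<lambda>w. cnj (a w))"
  define x where "x = act W q \<alpha>"
  define u where "u = act W q (\<lambda>w. of_bool (w = []))"
  define y where "y = (\<lambda>w'. \<Sum>w\<in>W. a w * zact w x w')"
  have "nsq W y = nsq {..<M} (mat_act M (f Z) (\<lambda>r. x (e r)))"
    unfolding nsq_e[symmetric]
  proof (rule nsq_cong)
    fix r assume "r \<in> {..<M}"
    then have r: "r < M" by simp
    show "y (e r) = mat_act M (f Z) (\<lambda>r. x (e r)) r"
      using a[OF M1 Zd nil r, of "\<lambda>r. x (e r)"] by (simp add: poly_act_def y_def word_act_Z[OF r] W_def)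
  qed
  also have "\<dots> \<le> (op_norm (f Z))\<^sup>2 * nsq {..<M} (\<lambda>r. x (e r))" by (rule nsq_act_op_norm(1)[OF fZ])
  also have "\<dots> \<le> 1 * nsq W x"
    unfolding nsq_e using f1 nsq_act_op_norm(2)[OF fZ] by (intro mult_right_mono power_le_one) auto
  finally have yx: "nsq W y \<le> nsq W x" by simp
  have ywsum: "ip W y u = (\<Sum>w\<in>W. cnj (a w) * ip W (zact w x) u)"
  proof -
    have "ip W y u = (\<Sum>b\<in>W. \<Sum>w\<in>W. cnj (a w) * (cnj (zact w x b) * u b))"
      unfolding ip_def y_def by (simp add: sum_distrib_right mult.assoc)
    also have "\<dots> = (\<Sum>w\<in>W. \<Sum>b\<in>W. cnj (a w) * (cnj (zact w x b) * u b))" by (rule sum.swap)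
    finally show ?thesis by (simp add: ip_def sum_distrib_left)
  qed
  have "ip W y u = (\<Sum>w\<in>W. \<alpha> w * ip W x (act W q (\<lambda>v. of_bool (v = w))))"
  proof -
    have "ip W (zact w x) u = ip W x (act W q (\<lambda>v. of_bool (v = w)))" for w
      unfolding u_def zact_adj append_word_delta by simp
    then show ?thesis by (simp add: ywsum \<alpha>_def)
  qed
  also have "\<dots> = (\<Sum>w\<in>W. \<alpha> w * ip W x (\<lambda>v. q v w))"
  proof (rule sum.cong[OF refl])
    fix w assume w: "w \<in> W"
    have "act W q (\<lambda>v. of_bool (v = w)) b = q b w" for b
    proof -
      have "act W q (\<lambda>v. of_bool (v = w)) b = (\<Sum>v\<in>W. if v = w then q b v else 0)"
        unfolding act_def by (rule sum.cong) auto
      then show ?thesis using w finW by simp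
    qed
    then show "\<alpha> w * ip W x (act W q (\<lambda>v. of_bool (v = w))) = \<alpha> w * ip W x (\<lambda>v. q v w)" by (simp add: ip_def)
  qed
  also have "\<dots> = (\<Sum>w\<in>W. \<Sum>b\<in>W. cnj (x b) * (q b w * \<alpha> w))"
    by (simp add: ip_def sum_distrib_left mult_ac)
  also have "\<dots> = (\<Sum>b\<in>W. \<Sum>w\<in>W. cnj (x b) * (q b w * \<alpha> w))" by (rule sum.swap)
  also have "\<dots> = ip W x x"
    unfolding ip_def by (simp add: x_def act_def sum_distrib_left)
  finally have "complex_of_real (nsq W x) = ip W y u" by (simp add: ip_self)
  then have "nsq W x = cmod (ip W y u)" by (metis nsq_nonneg norm_of_real abs_of_nonneg)
  also have "\<dots> \<le> sqrt (nsq W y) * sqrt (nsq W u)" by (rule cmod_ip_le)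
  also have "\<dots> \<le> sqrt (nsq W x) * sqrt (nsq W u)" using yx by (intro mult_right_mono) auto
  finally have sq: "sqrt (nsq W x) * sqrt (nsq W x) \<le> sqrt (nsq W x) * sqrt (nsq W u)" by simp
  then have "sqrt (nsq W x) \<le> sqrt (nsq W u)" by (rule mult_self_le_imp_le) auto
  then have "nsq W x \<le> nsq W u" by simp
  then show ?thesis by (simp add: x_def u_def W_def \<alpha>_def)
qed

text \<open>
  Appending \<open>N + 1\<close> letters decreases the form and leaves nothing on \<open>words N\<close>.
\<close>

lemma append_contraction_nonneg:
  fixes L :: "('d::finite) list \<Rightarrow> 'd list \<Rightarrow> complex"
  assumes mono: "\<And>i x. Re (ip (words N) (append_op i x) (act (words N) L (append_op i x))) \<le> Re (ip (words N) x (act (words N) L x))"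
  shows "0 \<le> Re (ip (words N) x (act (words N) L x))"
proof -
  have "Re (ip (words N) (append_word w x) (act (words N) L (append_word w x))) \<le> Re (ip (words N) x (act (words N) L x))" for w
  proof (induction w arbitrary: x)
    case (Cons i w)
    show ?case using Cons[of "append_op i x"] mono[of i x] by simp
  qed simp
  moreover have "ip (words N) (append_word (replicate (Suc N) i) x) (act (words N) L (append_word (replicate (Suc N) i) x)) = 0" for i
  proof -
    have "append_word (replicate (Suc N) i) x v = 0" if "v \<in> words N" for v
      by (rule append_word_short[where k = 0]) (use that in \<open>auto simp: words_def\<close>)
    then show ?thesis by (simp add: ip_def del: replicate_Suc)
  qed
  ultimately show ?thesis by (metis zero_complex.sel(1))
qed

text \<open>
  If there were no decomposition, the separating form \<open>L\<close> would be larger on the conjugated coefficients \<open>\<alpha>\<close> than on the empty word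
  \<open>\<delta>\<close>.  Two small changes turn it into a form to which \<open>contractive_model_bound\<close> applies: weighting words of
  length \<open>k\<close> by \<open>t ^ k\<close> with \<open>t < 1\<close> makes the contractions strict, and a small multiple of a diagonal form
  makes it definite.
\<close>

theorem schur_agler_defect:
  fixes f :: "('d::finite) mtuple \<Rightarrow> complex mat"
  assumes nc: "nc_function f" and bd: "\<forall>Z\<in>nc_disc. op_norm (f Z) \<le> 1"
    and a: "\<And>n X x i. n \<ge> 1 \<Longrightarrow> X \<in> nc_disc \<inter> nc_level n \<Longrightarrow>
      (\<And>w x i. length w = Suc N \<Longrightarrow> i < n \<Longrightarrow> word_act n X w x i = 0) \<Longrightarrow> i < n \<Longrightarrow>
      mat_act n (f X) x i = poly_act N a n X x i"
  shows "\<exists>H. (\<forall>i. psd_on (words N) (H i)) \<and>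
    (\<forall>w\<in>words N. \<forall>v\<in>words N. of_bool (w = []) * of_bool (v = []) - cnj (a w) * a v = defect N H w v)"
proof -
  define W where "W = (words N :: 'd list set)"
  have finW: "finite W" by (simp add: W_def)
  define K where "K = (\<lambda>w v. of_bool (w = []) * of_bool (v = []) - cnj (a w) * a v)"
  show ?thesis
  proof (rule ccontr)
    assume no: "\<not> ?thesis"
    have "K v w = cnj (K w v)" for v w by (simp add: K_def)
    from defect_alternative[of N K, OF this] no obtain L
      where herm: "\<forall>w\<in>W. \<forall>v\<in>W. L v w = cnj (L w v)"
        and mono: "\<And>i x. Re (ip W (append_op i x) (act W L (append_op i x))) \<le> Re (ip W x (act W L x))"
        and neg: "Re (ip (W \<times> W) (\<lambda>p. L (fst p) (snd p)) (\<lambda>p. K (fst p) (snd p))) < 0"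
      unfolding K_def W_def by blast
    define form where "form = (\<lambda>x. Re (ip W x (act W L x)))"
    have form_nonneg: "0 \<le> form x" for x
      unfolding form_def W_def by (rule append_contraction_nonneg) (use mono in \<open>simp add: W_def\<close>)
    define \<delta> where "\<delta> = (\<lambda>w::'d list. of_bool (w = []) :: complex)"
    define \<alpha> where "\<alpha> = (\<lambda>w. cnj (a w))"
    have "(\<lambda>p. K (fst p) (snd p)) = (\<lambda>p. \<delta> (fst p) * cnj (\<delta> (snd p)) - \<alpha> (fst p) * cnj (\<alpha> (snd p)))"
      by (auto simp: K_def \<delta>_def \<alpha>_def fun_eq_iff)
    then have "ip (W \<times> W) (\<lambda>p. L (fst p) (snd p)) (\<lambda>p. K (fst p) (snd p))
      = cnj (ip W \<delta> (act W L \<delta>)) - cnj (ip W \<alpha> (act W L \<alpha>))"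
      by (simp add: ip_diff_right ip_act_rank_one)
    then have gap: "form \<delta> < form \<alpha>" using neg by (simp add: form_def)
    define D where "D = (\<lambda>(t::real) (x :: 'd list \<Rightarrow> complex) w. of_real t ^ length w * x w)"
    have D\<delta>: "D t \<delta> = \<delta>" for t by (rule ext) (simp add: D_def \<delta>_def)
    have "((\<lambda>t. form (D t \<alpha>)) \<longlongrightarrow> form (D 1 \<alpha>)) (at_left 1)"
      unfolding form_def ip_def act_def D_def by (intro tendsto_intros)
    moreover have "D 1 \<alpha> = \<alpha>" by (rule ext) (simp add: D_def)
    ultimately have "\<forall>\<^sub>F t in at_left 1. form \<delta> < form (D t \<alpha>)"
      using gap by (auto dest: order_tendstoD(1))
    \<comment> \<open>The diagonal form with weights \<open>2 ^ (- length w)\<close> is contracted by the factor \<open>1/2\<close>, which is at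
      most \<open>t\<^sup>2\<close> if \<open>t > 3/4\<close>.\<close>
    moreover have "\<forall>\<^sub>F t::real in at_left 1. 3/4 < t \<and> t < 1"
      using eventually_at_left_field[of "\<lambda>t. 3/4 < t \<and> t < 1" "1::real"] by (auto intro!: exI[of _ "3/4"])
    ultimately have "\<forall>\<^sub>F t in at_left 1. form \<delta> < form (D t \<alpha>) \<and> 3/4 < t \<and> t < 1" by eventually_elim auto
    then obtain t :: real where t: "form \<delta> < form (D t \<alpha>)" "3/4 < t" "t < 1"
      using eventually_happens'[of "at_left (1::real)"] by (auto simp: trivial_limit_at_left_real)
    define \<epsilon> where "\<epsilon> = (form (D t \<alpha>) - form \<delta>) / 2"
    have \<epsilon>: "\<epsilon> > 0" using t by (simp add: \<epsilon>_def)
    define \<rho> where "\<rho> = (\<lambda>w::'d list. (1/2::real) ^ length w)"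
    define Q where "Q = (\<lambda>x. \<Sum>w\<in>W. \<rho> w * (cmod (x w))\<^sup>2)"
    define L' where "L' = (\<lambda>w v. of_real t ^ length w * L w v * of_real t ^ length v + (if w = v then of_real (\<epsilon> * \<rho> w) else 0))"
    have L'form: "Re (ip W x (act W L' x)) = form (D t x) + \<epsilon> * Q x" for x
    proof -
      have act: "act W L' x w = of_real t ^ length w * act W L (D t x) w + of_real (\<epsilon> * \<rho> w) * x w" if "w \<in> W" for w
      proof -
        have "act W L' x w = (\<Sum>v\<in>W. of_real t ^ length w * (L w v * D t x v) + (if w = v then of_real (\<epsilon> * \<rho> w) * x v else 0))"
          unfolding act_def L'_def D_def by (rule sum.cong) (auto simp: algebra_simps)
        then show ?thesis using that finW by (simp add: sum.distrib act_def sum_distrib_left)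
      qed
      have "ip W x (act W L' x) = ip W (D t x) (act W L (D t x)) + of_real (\<epsilon> * Q x)"
      proof -
        have "ip W x (act W L' x) = (\<Sum>w\<in>W. cnj (D t x w) * act W L (D t x) w + of_real (\<epsilon> * (\<rho> w * (cmod (x w))\<^sup>2)))"
          unfolding ip_def
        proof (rule sum.cong[OF refl])
          fix w assume w: "w \<in> W"
          have "cnj (x w) * x w = of_real ((cmod (x w))\<^sup>2)" using complex_norm_square[of "x w"] by (simp add: mult.commute)
          then have "cnj (x w) * (of_real (\<epsilon> * \<rho> w) * x w) = of_real (\<epsilon> * \<rho> w) * of_real ((cmod (x w))\<^sup>2)"
            by (simp add: mult_ac)
          then show "cnj (x w) * act W L' x w = cnj (D t x w) * act W L (D t x) w + of_real (\<epsilon> * (\<rho> w * (cmod (x w))\<^sup>2))"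
            by (simp add: act[OF w] D_def distrib_left mult_ac)
        qed
        then show ?thesis by (simp add: sum.distrib ip_def Q_def sum_distrib_left)
      qed
      then show ?thesis by (simp add: form_def)
    qed
    have Q0: "0 \<le> Q x" for x unfolding Q_def \<rho>_def by (intro sum_nonneg) auto
    have psd: "psd_on W L'"
      unfolding psd_on_def L'form
    proof (intro conjI ballI allI)
      fix w v assume "w \<in> W" "v \<in> W"
      then have "L v w = cnj (L w v)" using herm by blast
      then show "L' v w = cnj (L' w v)" by (simp add: L'_def mult_ac)
    next
      fix x show "0 \<le> form (D t x) + \<epsilon> * Q x" using form_nonneg[of "D t x"] Q0[of x] \<epsilon> by simp
    qed
    from psd_on_factor[OF finW psd] obtain q where q: "\<And>w v. w \<in> W \<Longrightarrow> v \<in> W \<Longrightarrow> L' w v = (\<Sum>j\<in>W. cnj (q j w) * q j v)"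
      by blast
    have q_nsq: "nsq W (act W q x) = form (D t x) + \<epsilon> * Q x" for x
    proof -
      have "ip W x (act W L' x) = (\<Sum>w\<in>W. \<Sum>v\<in>W. \<Sum>j\<in>W. cnj (q j w * x w) * (q j v * x v))"
        unfolding ip_def act_def
        by (intro sum.cong refl) (simp add: sum_distrib_left sum_distrib_right q mult_ac)
      also have "\<dots> = (\<Sum>w\<in>W. \<Sum>j\<in>W. \<Sum>v\<in>W. cnj (q j w * x w) * (q j v * x v))"
        by (intro sum.cong refl sum.swap)
      also have "\<dots> = (\<Sum>j\<in>W. \<Sum>w\<in>W. \<Sum>v\<in>W. cnj (q j w * x w) * (q j v * x v))"
        by (rule sum.swap)
      also have "\<dots> = ip W (act W q x) (act W q x)"
        unfolding ip_def act_def cnj_sum sum_product ..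
      finally have "complex_of_real (nsq W (act W q x)) = ip W x (act W L' x)" by (simp add: ip_self)
      then have "nsq W (act W q x) = Re (ip W x (act W L' x))" by (metis Re_complex_of_real)
      then show ?thesis by (simp add: L'form)
    qed
    have "nsq W (act W q (\<lambda>w. cnj (a w))) \<le> nsq W (act W q (\<lambda>w. of_bool (w = [])))"
      unfolding W_def
    proof (rule contractive_model_bound[OF nc bd a])
      show "0 \<le> t" "t < 1" using t by auto
    next
      fix x assume "nsq (words N) (act (words N) q x) = 0"
      then have "form (D t x) + \<epsilon> * Q x = 0" using q_nsq by (simp add: W_def)
      moreover have "0 \<le> \<epsilon> * Q x" using \<epsilon> Q0[of x] by simp
      ultimately have "\<epsilon> * Q x = 0" using form_nonneg[of "D t x"] by linarith
      then have "Q x = 0" using \<epsilon> by simp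
      then have "\<forall>w\<in>W. \<rho> w * (cmod (x w))\<^sup>2 = 0"
        unfolding Q_def by (subst (asm) sum_nonneg_eq_0_iff[OF finW]) (auto simp: \<rho>_def)
      then show "\<forall>w\<in>words N. x w = 0" by (simp add: \<rho>_def W_def)
    next
      fix i x
      have DS: "D t (append_op i x) = (\<lambda>w. of_real t * append_op i (D t x) w)"
      proof (rule ext)
        fix w show "D t (append_op i x) w = of_real t * append_op i (D t x) w"
          by (cases w rule: rev_cases) (auto simp: D_def append_op_def)
      qed
      have "form (D t (append_op i x)) = t\<^sup>2 * form (append_op i (D t x))"
      proof -
        have "act W L (\<lambda>w. of_real t * append_op i (D t x) w) = (\<lambda>w. of_real t * act W L (append_op i (D t x)) w)"
          by (rule ext) (rule act_scale)
        then show ?thesis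
          unfolding form_def DS by (simp add: ip_scale_left ip_scale_right power2_eq_square)
      qed
      also have "\<dots> \<le> t\<^sup>2 * form (D t x)" using mono by (intro mult_left_mono) (auto simp: form_def)
      finally have 1: "form (D t (append_op i x)) \<le> t\<^sup>2 * form (D t x)" .
      have "Q (append_op i x) = (\<Sum>w\<in>W. if w \<noteq> [] \<and> last w = i then (\<lambda>u. \<rho> u / 2 * (cmod (x u))\<^sup>2) (butlast w) else 0)"
        unfolding Q_def
      proof (rule sum.cong[OF refl])
        fix w show "\<rho> w * (cmod (append_op i x w))\<^sup>2 = (if w \<noteq> [] \<and> last w = i then (\<lambda>u. \<rho> u / 2 * (cmod (x u))\<^sup>2) (butlast w) else 0)"
          by (cases w rule: rev_cases) (auto simp: append_op_def \<rho>_def)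
      qed
      also have "\<dots> = (\<Sum>u\<in>W. if length u < N then \<rho> u / 2 * (cmod (x u))\<^sup>2 else 0)"
        unfolding W_def by (rule sum_append)
      also have "\<dots> \<le> (\<Sum>u\<in>W. (1/2) * (\<rho> u * (cmod (x u))\<^sup>2))"
        by (rule sum_mono) (auto simp: \<rho>_def)
      also have "\<dots> = (1/2) * Q x" by (simp add: Q_def sum_distrib_left)
      also have "\<dots> \<le> t\<^sup>2 * Q x"
      proof (rule mult_right_mono[OF _ Q0])
        have "(3/4)\<^sup>2 \<le> t\<^sup>2" using t by (intro power_mono) auto
        then show "1/2 \<le> t\<^sup>2" by (simp add: power2_eq_square)
      qed
      finally have "\<epsilon> * Q (append_op i x) \<le> \<epsilon> * (t\<^sup>2 * Q x)" using \<epsilon> by simp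
      then show "nsq (words N) (act (words N) q (append_op i x)) \<le> t\<^sup>2 * nsq (words N) (act (words N) q x)"
        using 1 q_nsq[of x] q_nsq[of "append_op i x"] by (simp add: W_def algebra_simps)
    qed
    then have "form (D t \<alpha>) + \<epsilon> * Q \<alpha> \<le> form \<delta> + \<epsilon> * Q \<delta>"
      using q_nsq[of \<alpha>] q_nsq[of \<delta>] D\<delta> by (simp add: \<alpha>_def \<delta>_def)
    moreover have "Q \<delta> = 1"
    proof -
      have "Q \<delta> = (\<Sum>w\<in>W. if w = [] then 1 else 0)"
        unfolding Q_def by (rule sum.cong) (auto simp: \<delta>_def \<rho>_def)
      then show ?thesis using finW by (simp add: W_def)
    qed
    moreover have "0 \<le> \<epsilon> * Q \<alpha>" using \<epsilon> Q0[of \<alpha>] by simp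
    ultimately have "form (D t \<alpha>) \<le> form \<delta> + \<epsilon>" by simp
    moreover have "form (D t \<alpha>) = form \<delta> + 2 * \<epsilon>" by (simp add: \<epsilon>_def field_simps)
    ultimately show False using \<epsilon> by linarith
  qed
qed

section \<open>Unitary realizations\<close>

text \<open>
  Factor \<open>H i\<close> with vectors \<open>q (i, j)\<close> and bring the terms of the decomposition with a minus sign to the other
  side.  Both sides are then Gram matrices of families indexed by words, and the unitary that carries one to the other is \<open>T\<close>,
  with the external channel \<open>None\<close> and one internal channel for each pair of a letter and a word.  For the empty word the
  relation determines the first row of \<open>T\<close>; for a word that ends in \<open>i\<close> it says how \<open>T\<close> extends \<open>q\<close> and \<open>a\<close> by one letter.
\<close>

lemma unitary_realization:
  fixes a :: "('d::finite) list \<Rightarrow> complex"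
  assumes psd: "\<And>i. psd_on (words N) (H i)"
    and K: "\<And>w v. w \<in> words N \<Longrightarrow> v \<in> words N \<Longrightarrow> of_bool (w = []) * of_bool (v = []) - cnj (a w) * a v = defect N H w v"
  shows "\<exists>T (q :: 'd \<times> 'd list \<Rightarrow> 'd list \<Rightarrow> complex). isometric_on (insert None (Some ` (UNIV \<times> words N))) T \<and>
    T None None = a [] \<and> (\<forall>s\<in>UNIV \<times> words N. T None (Some s) = q s []) \<and>
    (\<forall>u i. length u < N \<longrightarrow> (\<Sum>j\<in>words N. q (i, j) u * T (Some (i, j)) None) = a (u @ [i]) \<and>
      (\<forall>s\<in>UNIV \<times> words N. (\<Sum>j\<in>words N. q (i, j) u * T (Some (i, j)) (Some s)) = q s (u @ [i])))"
proof -
  define W where "W = (words N :: 'd list set)"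
  define S where "S = (UNIV :: 'd set) \<times> W"
  define I where "I = insert None (Some ` S)"
  have fin: "finite W" "finite S" "finite I" by (simp_all add: W_def S_def I_def)
  have "\<forall>i. \<exists>p. \<forall>w\<in>W. \<forall>v\<in>W. H i w v = (\<Sum>j\<in>W. cnj (p j w) * p j v)"
    using psd_on_factor[OF fin(1)] psd by (simp add: W_def)
  from choice[OF this] obtain p where p: "\<And>i w v. w \<in> W \<Longrightarrow> v \<in> W \<Longrightarrow> H i w v = (\<Sum>j\<in>W. cnj (p i j w) * p i j v)"
    by blast
  define q where "q = (\<lambda>s. p (fst s) (snd s))"
  have sumI: "(\<Sum>c\<in>I. F c) = F None + (\<Sum>i\<in>UNIV. \<Sum>j\<in>W. F (Some (i, j)))" for F :: "('d \<times> 'd list) option \<Rightarrow> complex"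
  proof -
    have "(\<Sum>c\<in>I. F c) = F None + (\<Sum>s\<in>S. F (Some s))"
      unfolding I_def using fin by (subst sum.insert) (auto simp: sum.reindex)
    also have "(\<Sum>s\<in>S. F (Some s)) = (\<Sum>i\<in>UNIV. \<Sum>j\<in>W. F (Some (i, j)))"
      unfolding S_def by (simp add: sum.cartesian_product')
    finally show ?thesis .
  qed
  define l where "l = (\<lambda>(w :: 'd list) c. case c of None \<Rightarrow> of_bool (w = []) | Some (i, j) \<Rightarrow>
    (if w \<noteq> [] \<and> last w = i then p i j (butlast w) else 0 :: complex))"
  define r where "r = (\<lambda>w c. case c of None \<Rightarrow> a w | Some (i, j) \<Rightarrow> p i j w)"
  have gram: "ip I (l w) (l v) = ip I (r w) (r v)" if wv: "w \<in> W" "v \<in> W" for w v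
  proof -
    have bl: "butlast w \<in> W" "butlast v \<in> W" using wv by (auto simp: W_def words_def)
    have "(\<Sum>j\<in>W. cnj (l w (Some (i, j))) * l v (Some (i, j))) = append_ker i (H i) w v" for i
      using p[OF bl] by (auto simp: l_def append_ker_def)
    moreover have "cnj (of_bool (w = [])) = (of_bool (w = []) :: complex)" by simp
    ultimately have "ip I (l w) (l v) = of_bool (w = []) * of_bool (v = []) + (\<Sum>i\<in>UNIV. append_ker i (H i) w v)"
      unfolding ip_def sumI by (simp add: l_def)
    moreover have "ip I (r w) (r v) = cnj (a w) * a v + (\<Sum>i\<in>UNIV. H i w v)"
      unfolding ip_def sumI by (simp add: r_def p[OF wv])
    moreover have "of_bool (w = []) * of_bool (v = []) - cnj (a w) * a v = (\<Sum>i\<in>UNIV. H i w v) - (\<Sum>i\<in>UNIV. append_ker i (H i) w v)"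
      using K[of w v] wv by (simp add: W_def defect_def sum_subtractf)
    ultimately show ?thesis by (simp add: algebra_simps)
  qed
  from lurking_unitary[OF fin(1,3), of l r, OF gram] obtain U where U: "isometric_on I (\<lambda>a b. U b a)"
    and Ul: "\<And>w b. w \<in> W \<Longrightarrow> b \<in> I \<Longrightarrow> act I U (l w) b = r w b" by blast
  define T where "T = (\<lambda>a b. U b a)"
  have Nil: "T None b = r [] b" if "b \<in> I" for b
    using Ul[of "[]" b] that by (simp add: act_def sumI l_def T_def W_def)
  have snoc: "(\<Sum>j\<in>W. q (i, j) u * T (Some (i, j)) b) = r (u @ [i]) b" if "b \<in> I" "length u < N" for u i b
  proof -
    have "act I U (l (u @ [i])) b = (\<Sum>k\<in>UNIV. \<Sum>j\<in>W. if k = i then p i j u * T (Some (i, j)) b else 0)"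
      unfolding act_def sumI by (simp add: l_def T_def) (intro sum.cong refl, auto simp: mult.commute T_def)
    also have "\<dots> = (\<Sum>k\<in>UNIV. if k = i then (\<Sum>j\<in>W. p i j u * T (Some (i, j)) b) else 0)"
      by (intro sum.cong refl) auto
    also have "\<dots> = (\<Sum>j\<in>W. p i j u * T (Some (i, j)) b)" by simp
    finally show ?thesis using Ul[of "u @ [i]" b] that by (simp add: W_def words_def q_def)
  qed
  show ?thesis
  proof (intro exI[of _ T] exI[of _ q] conjI allI impI ballI)
    show "isometric_on (insert None (Some ` (UNIV \<times> words N))) T"
      using U by (simp add: T_def I_def S_def W_def)
    show "T None None = a []" using Nil[of None] by (simp add: I_def r_def)
    show "T None (Some s) = q s []" if "s \<in> UNIV \<times> words N" for s
      using Nil[of "Some s"] that by (cases s) (auto simp: I_def S_def W_def r_def q_def)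
    show "(\<Sum>j\<in>words N. q (i, j) u * T (Some (i, j)) None) = a (u @ [i])" if "length u < N" for u i
      using snoc[of None u i] that by (simp add: I_def W_def r_def)
    show "(\<Sum>j\<in>words N. q (i, j) u * T (Some (i, j)) (Some s)) = q s (u @ [i])"
      if "length u < N" "s \<in> UNIV \<times> words N" for u i s
      using snoc[of "Some s" u i] that by (cases s) (auto simp: I_def S_def W_def r_def q_def)
  qed
qed

text \<open>
  The output on channel \<open>c\<close> of the network \<open>T\<close> with input \<open>z\<close>, a vector in each channel of \<open>F\<close>.
\<close>

abbreviation response :: "'c set \<Rightarrow> ('c \<Rightarrow> 'c \<Rightarrow> complex) \<Rightarrow> ('c \<Rightarrow> 'p \<Rightarrow> complex) \<Rightarrow> 'c \<Rightarrow> 'p \<Rightarrow> complex" where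
  "response F T z \<equiv> \<lambda>c p. \<Sum>b\<in>F. T c b * z b p"

lemma isometric_energy:
  assumes "isometric_on F T"
  shows "(\<Sum>c\<in>F. ip I (response F T z c) (response F T z' c)) = (\<Sum>c\<in>F. ip I (z c) (z' c))"
proof -
  have "(\<Sum>c\<in>F. ip I (response F T z c) (response F T z' c))
    = (\<Sum>p\<in>I. ip F (act F T (\<lambda>b. z b p)) (act F T (\<lambda>b. z' b p)))"
    unfolding ip_def act_def by (rule sum.swap)
  also have "\<dots> = (\<Sum>p\<in>I. ip F (\<lambda>b. z b p) (\<lambda>b. z' b p))" using assms by (simp add: isometric_on_def)
  also have "\<dots> = (\<Sum>c\<in>F. ip I (z c) (z' c))" unfolding ip_def by (rule sum.swap)
  finally show ?thesis .
qed

lemma isometric_energy_nsq: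
  assumes "isometric_on F T"
  shows "(\<Sum>c\<in>F. nsq I (response F T z c)) = (\<Sum>c\<in>F. nsq I (z c))"
proof -
  have "complex_of_real (\<Sum>c\<in>F. nsq I (response F T z c)) = complex_of_real (\<Sum>c\<in>F. nsq I (z c))"
    unfolding of_real_sum ip_self[symmetric] by (rule isometric_energy[OF assms])
  then show ?thesis by (simp only: of_real_eq_iff)
qed

lemma nsq_act_tuple_norm:
  assumes Z: "Z \<in> nc_level n" and r: "tuple_norm Z \<le> r"
  shows "nsq {..<n} (mat_act n (Z i) x) \<le> r\<^sup>2 * nsq {..<n} x"
proof -
  have c: "Z i \<in> carrier_mat n n" by (rule nc_level_carrier[OF Z])
  have "op_norm (Z i) \<le> r" using op_norm_le_tuple_norm[of Z i] r by linarith
  then have "(op_norm (Z i))\<^sup>2 \<le> r\<^sup>2" using nsq_act_op_norm(2)[OF c] by (rule power_mono)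
  then show ?thesis
    using nsq_act_op_norm(1)[OF c, of x] mult_right_mono[of "(op_norm (Z i))\<^sup>2" "r\<^sup>2" "nsq {..<n} x"] nsq_nonneg[of "{..<n}" x] by linarith
qed

lemma sum_words_of_length_Suc:
  fixes F :: "('d::finite) list \<Rightarrow> 'b::comm_monoid_add"
  shows "(\<Sum>w | length w = Suc l. F w) = (\<Sum>w | length w = l. \<Sum>i\<in>UNIV. F (w @ [i]))"
proof -
  have "(\<Sum>w | length w = l. \<Sum>i\<in>UNIV. F (w @ [i])) = (\<Sum>(w, i)\<in>{w. length w = l} \<times> UNIV. F (w @ [i]))"
    by (rule sum.cartesian_product)
  also have "\<dots> = (\<Sum>w | length w = Suc l. F w)"
    by (rule sum.reindex_bij_witness[of _ "\<lambda>w. (butlast w, last w)" "\<lambda>(w, i). w @ [i]"]) (auto simp flip: length_greater_0_conv)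
  finally show ?thesis ..
qed

lemma words_Suc_sum:
  fixes F :: "('d::finite) list \<Rightarrow> 'b::comm_monoid_add"
  shows "(\<Sum>w\<in>words (Suc l). F w) = (\<Sum>w\<in>words l. F w) + (\<Sum>w | length w = Suc l. F w)"
proof -
  have "words (Suc l) = words l \<union> {w::'d list. length w = Suc l}" by (auto simp: words_def)
  moreover have "finite {w::'d list. length w = Suc l}"
    by (rule finite_subset[OF _ finite_words[of "Suc l"]]) (auto simp: words_def)
  moreover have "words l \<inter> {w::'d list. length w = Suc l} = {}" by (auto simp: words_def)
  ultimately show ?thesis by (simp add: sum.union_disjoint)
qed

text \<open>
  Here \<open>X \<xi> c\<close> is the output on channel \<open>c\<close> if \<open>Z\<close> is applied to the states \<open>\<xi>\<close> and nothing else enters, and \<open>R l \<xi>\<close> is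
  what remains after the feedback loop has been unrolled \<open>l\<close> times.  Each unrolling splits off the terms of degree \<open>l + 1\<close>, which
  are those of the polynomial with coefficients \<open>a\<close>.  As \<open>T\<close> preserves energy, each passage costs a factor \<open>r\<close>, and the states have energy
  at most \<open>1 / (1 - r\<^sup>2)\<close> times that of the input.
\<close>

theorem realization_approximates:
  fixes Z :: "('d::finite) mtuple" and T :: "('d \<times> 'd list) option \<Rightarrow> ('d \<times> 'd list) option \<Rightarrow> complex"
  assumes iso: "isometric_on (insert None (Some ` (UNIV \<times> words N))) T"
    and T00: "T None None = a []" and T0: "\<And>s. s \<in> UNIV \<times> words N \<Longrightarrow> T None (Some s) = q s []"
    and Ta: "\<And>u i. length u < N \<Longrightarrow> (\<Sum>j\<in>words N. q (i, j) u * T (Some (i, j)) None) = a (u @ [i])"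
    and Tq: "\<And>u i s. length u < N \<Longrightarrow> s \<in> UNIV \<times> words N \<Longrightarrow> (\<Sum>j\<in>words N. q (i, j) u * T (Some (i, j)) (Some s)) = q s (u @ [i])"
    and Z: "Z \<in> nc_level n" and r: "tuple_norm Z \<le> r" "0 \<le> r" "r < 1"
    and z0: "\<And>p. z None p = u p"
    and zs: "\<And>s p. s \<in> UNIV \<times> words N \<Longrightarrow> p < n \<Longrightarrow>
      z (Some s) p = mat_act n (Z (fst s)) (\<lambda>p. \<Sum>b\<in>insert None (Some ` (UNIV \<times> words N)). T (Some s) b * z b p) p"
  shows "nsq {..<n} (\<lambda>p. (\<Sum>b\<in>insert None (Some ` (UNIV \<times> words N)). T None b * z b p) - poly_act N a n Z u p)
    \<le> (r ^ Suc N)\<^sup>2 / (1 - r\<^sup>2) * nsq {..<n} u"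
proof -
  define W where "W = (words N :: 'd list set)"
  define S where "S = (UNIV :: 'd set) \<times> W"
  define F where "F = insert None (Some ` S)"
  have fin: "finite W" "finite S" "finite F" by (simp_all add: W_def S_def F_def)
  have sumF: "(\<Sum>c\<in>F. G c) = G None + (\<Sum>s\<in>S. G (Some s))" for G :: "('d \<times> 'd list) option \<Rightarrow> 'x::comm_monoid_add"
    unfolding F_def using fin by (subst sum.insert) (auto simp: sum.reindex)
  have isoF: "isometric_on F T" using iso by (simp add: F_def S_def W_def)
  define A where "A = (\<lambda>i. mat_act n (Z i))"
  define E where "E = (\<lambda>\<xi> :: ('d \<times> 'd list) \<Rightarrow> nat \<Rightarrow> complex. \<Sum>s\<in>S. nsq {..<n} (\<xi> s))"
  have E0: "0 \<le> E \<xi>" for \<xi> unfolding E_def by (intro sum_nonneg) simp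
  have A_norm: "(\<Sum>s\<in>S. nsq {..<n} (A (fst s) (\<xi> s))) \<le> r\<^sup>2 * E \<xi>" for \<xi>
    unfolding E_def A_def sum_distrib_left by (intro sum_mono nsq_act_tuple_norm[OF Z r(1)])
  define X where "X = (\<lambda>\<xi> c p. \<Sum>s\<in>S. T c (Some s) * A (fst s) (\<xi> s) p)"
  have X_energy: "nsq {..<n} (X \<xi> None) + E (\<lambda>s. X \<xi> (Some s)) \<le> r\<^sup>2 * E \<xi>" for \<xi>
  proof -
    define z' where "z' = (\<lambda>c p. case c of None \<Rightarrow> 0 | Some s \<Rightarrow> A (fst s) (\<xi> s) p)"
    have "X \<xi> c = (response F T z' c)" for c by (simp add: X_def sumF z'_def)
    then have "nsq {..<n} (X \<xi> None) + E (\<lambda>s. X \<xi> (Some s)) = (\<Sum>c\<in>F. nsq {..<n} (z' c))"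
      unfolding E_def using isometric_energy_nsq[OF isoF, of "{..<n}" z'] by (simp add: sumF)
    also have "\<dots> = (\<Sum>s\<in>S. nsq {..<n} (A (fst s) (\<xi> s)))" by (simp add: sumF z'_def nsq_def)
    finally show ?thesis using A_norm[of \<xi>] by simp
  qed
  define x where "x = (\<lambda>s p. response F T z (Some s) p)"
  define y where "y = (response F T z None)"
  have zx: "z (Some s) p = A (fst s) (x s) p" if "s \<in> S" "p < n" for s p
    using zs[of s p] that by (simp add: A_def x_def F_def S_def W_def)
  have x_eq: "x s p = T (Some s) None * u p + X x (Some s) p" if "p < n" for s p
    using that by (simp add: x_def[of] sumF X_def z0 zx)
  have y_eq: "y p = T None None * u p + X x None p" if "p < n" for p
    using that by (simp add: y_def sumF X_def z0 zx)
  have Ex: "E x \<le> nsq {..<n} u / (1 - r\<^sup>2)"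
  proof -
    have "nsq {..<n} y + E x = (\<Sum>c\<in>F. nsq {..<n} (z c))"
      unfolding E_def x_def y_def using isometric_energy_nsq[OF isoF, of "{..<n}" z] by (simp add: sumF)
    also have "\<dots> = nsq {..<n} u + (\<Sum>s\<in>S. nsq {..<n} (A (fst s) (x s)))"
      unfolding sumF by (intro arg_cong2[where f = "(+)"] nsq_cong sum.cong refl) (auto simp: z0 zx)
    also have "\<dots> \<le> nsq {..<n} u + r\<^sup>2 * E x" using A_norm[of x] by simp
    finally have "nsq {..<n} y + E x \<le> nsq {..<n} u + r\<^sup>2 * E x" .
    then have "E x \<le> nsq {..<n} u + r\<^sup>2 * E x" using nsq_nonneg[of "{..<n}" y] by linarith
    then have "E x * (1 - r\<^sup>2) \<le> nsq {..<n} u" by (simp add: algebra_simps)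
    moreover have "r\<^sup>2 < 1" using r by (simp add: power_less_one_iff abs_square_less_1)
    ultimately show ?thesis by (simp add: pos_le_divide_eq)
  qed
  define R where "R = (\<lambda>l (\<xi> :: ('d \<times> 'd list) \<Rightarrow> nat \<Rightarrow> complex) p. \<Sum>w | length w = l. \<Sum>i\<in>UNIV. \<Sum>j\<in>W. q (i, j) w * word_act n Z (w @ [i]) (\<xi> (i, j)) p)"
  have sumS: "(\<Sum>s\<in>S. G s) = (\<Sum>i\<in>UNIV. \<Sum>j\<in>W. G (i, j))" for G :: "('d \<times> 'd list) \<Rightarrow> complex"
    unfolding S_def by (simp add: sum.cartesian_product')
  have R0: "R 0 \<xi> p = X \<xi> None p" for \<xi> p
    unfolding R_def X_def sumS A_def using T0 by (simp add: W_def)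
  have R_cong: "R l \<xi> p = R l \<xi>' p" if "\<And>s p. s \<in> S \<Longrightarrow> p < n \<Longrightarrow> \<xi> s p = \<xi>' s p" "p < n" for l \<xi> \<xi>' p
    unfolding R_def using that by (intro sum.cong refl arg_cong2[where f = "(*)"] word_act_cong) (auto simp: S_def)
  have R_add: "R l (\<lambda>s p. \<xi> s p + \<xi>' s p) p = R l \<xi> p + R l \<xi>' p" for l \<xi> \<xi>' p
    unfolding R_def word_act_add distrib_left sum.distrib ..
  have R_Suc: "R l (\<lambda>s. X \<xi> (Some s)) p = R (Suc l) \<xi> p" if "l < N" for l \<xi> p
  proof -
    have "R l (\<lambda>s. X \<xi> (Some s)) p = (\<Sum>w | length w = l. \<Sum>i\<in>UNIV. \<Sum>s\<in>S. q s (w @ [i]) * word_act n Z (w @ [i]) (A (fst s) (\<xi> s)) p)"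
      unfolding R_def
    proof (intro sum.cong refl)
      fix w :: "'d list" and i assume "w \<in> {w. length w = l}"
      then have w: "length w < N" using that by simp
      have "(\<Sum>j\<in>W. q (i, j) w * word_act n Z (w @ [i]) (X \<xi> (Some (i, j))) p)
        = (\<Sum>j\<in>W. \<Sum>s\<in>S. q (i, j) w * T (Some (i, j)) (Some s) * word_act n Z (w @ [i]) (A (fst s) (\<xi> s)) p)"
        unfolding X_def word_act_sum word_act_scale by (simp add: sum_distrib_left mult.assoc)
      also have "\<dots> = (\<Sum>s\<in>S. \<Sum>j\<in>W. q (i, j) w * T (Some (i, j)) (Some s) * word_act n Z (w @ [i]) (A (fst s) (\<xi> s)) p)"
        by (rule sum.swap)
      also have "\<dots> = (\<Sum>s\<in>S. q s (w @ [i]) * word_act n Z (w @ [i]) (A (fst s) (\<xi> s)) p)"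
        using Tq[OF w] by (intro sum.cong refl) (simp add: W_def S_def flip: sum_distrib_right)
      finally show "(\<Sum>j\<in>W. q (i, j) w * word_act n Z (w @ [i]) (X \<xi> (Some (i, j))) p)
        = (\<Sum>s\<in>S. q s (w @ [i]) * word_act n Z (w @ [i]) (A (fst s) (\<xi> s)) p)" .
    qed
    also have "\<dots> = (\<Sum>w | length w = Suc l. \<Sum>s\<in>S. q s w * word_act n Z w (A (fst s) (\<xi> s)) p)"
      by (rule sum_words_of_length_Suc[symmetric])
    also have "\<dots> = R (Suc l) \<xi> p"
      unfolding R_def sumS by (simp add: A_def word_act_append)
    finally show ?thesis .
  qed
  have R_norm: "nsq {..<n} (R l \<xi>) \<le> (r ^ Suc l)\<^sup>2 * E \<xi>" if "l \<le> N" for l \<xi>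
    using that
  proof (induction l arbitrary: \<xi>)
    case 0
    have "nsq {..<n} (R 0 \<xi>) = nsq {..<n} (X \<xi> None)" by (rule nsq_cong) (rule R0)
    then show ?case using X_energy[of \<xi>] E0[of "\<lambda>s. X \<xi> (Some s)"] by simp
  next
    case (Suc l)
    have "nsq {..<n} (R (Suc l) \<xi>) = nsq {..<n} (R l (\<lambda>s. X \<xi> (Some s)))"
      by (rule nsq_cong) (use R_Suc Suc.prems in simp)
    also have "\<dots> \<le> (r ^ Suc l)\<^sup>2 * E (\<lambda>s. X \<xi> (Some s))" using Suc by simp
    also have "\<dots> \<le> (r ^ Suc l)\<^sup>2 * (r\<^sup>2 * E \<xi>)"
    proof (rule mult_left_mono)
      show "E (\<lambda>s. X \<xi> (Some s)) \<le> r\<^sup>2 * E \<xi>"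
        using X_energy[of \<xi>] nsq_nonneg[of "{..<n}" "X \<xi> None"] by linarith
    qed simp
    finally show ?case by (simp add: power_mult_distrib mult_ac)
  qed
  have expand: "y p = poly_act l a n Z u p + R l x p" if "l \<le> N" "p < n" for l p
    using that(1)
  proof (induction l)
    case 0
    have "words 0 = {[] :: 'd list}" by (auto simp: words_def)
    then show ?case using y_eq[OF that(2)] by (simp add: poly_act_def R0 T00)
  next
    case (Suc l)
    have "R l x p = R l (\<lambda>s p. T (Some s) None * u p + X x (Some s) p) p"
      by (rule R_cong) (use x_eq that in auto)
    also have "\<dots> = R l (\<lambda>s p. T (Some s) None * u p) p + R (Suc l) x p"
      using R_add[of l "\<lambda>s p. T (Some s) None * u p" "\<lambda>s. X x (Some s)" p] R_Suc[of l x p] Suc.prems by simp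
    also have "R l (\<lambda>s p. T (Some s) None * u p) p = (\<Sum>w | length w = l. \<Sum>i\<in>UNIV. a (w @ [i]) * word_act n Z (w @ [i]) u p)"
      unfolding R_def word_act_scale
    proof (intro sum.cong refl)
      fix w :: "'d list" and i assume "w \<in> {w. length w = l}"
      then have w: "length w < N" using Suc.prems by simp
      have "(\<Sum>j\<in>W. q (i, j) w * (T (Some (i, j)) None * word_act n Z (w @ [i]) u p))
        = (\<Sum>j\<in>W. q (i, j) w * T (Some (i, j)) None) * word_act n Z (w @ [i]) u p"
        by (simp add: sum_distrib_right mult.assoc)
      then show "(\<Sum>j\<in>W. q (i, j) w * (T (Some (i, j)) None * word_act n Z (w @ [i]) u p)) = a (w @ [i]) * word_act n Z (w @ [i]) u p"
        using Ta[OF w] by (simp add: W_def)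
    qed
    also have "\<dots> = (\<Sum>w | length w = Suc l. a w * word_act n Z w u p)" by (rule sum_words_of_length_Suc[symmetric])
    finally show ?case using Suc by (simp add: poly_act_def words_Suc_sum)
  qed
  have "nsq {..<n} (\<lambda>p. y p - poly_act N a n Z u p) = nsq {..<n} (R N x)"
    by (rule nsq_cong) (use expand[of N] in simp)
  also have "\<dots> \<le> (r ^ Suc N)\<^sup>2 * E x" by (rule R_norm) simp
  also have "\<dots> \<le> (r ^ Suc N)\<^sup>2 * (nsq {..<n} u / (1 - r\<^sup>2))" using Ex by (intro mult_left_mono) auto
  finally show ?thesis by (simp add: y_def F_def S_def W_def)
qed

section \<open>The transfer function is a rational expression\<close>

lemma act_mult_mat:
  assumes "A \<in> carrier_mat n n" "B \<in> carrier_mat n n" "p < n"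
  shows "mat_act n (A * B) x p = mat_act n A (mat_act n B x) p"
  unfolding act_act by (rule act_cong) (use assms mult_mat_entry[OF assms(1,2)] in auto)

lemma act_add_mat:
  assumes "B \<in> carrier_mat n n" "p < n"
  shows "mat_act n (A + B) x p = mat_act n A x p + mat_act n B x p"
  unfolding act_def sum.distrib[symmetric] using assms by (intro sum.cong) (auto simp: algebra_simps)

lemma act_smult_mat:
  assumes "A \<in> carrier_mat n n" "p < n"
  shows "mat_act n (c \<cdot>\<^sub>m A) x p = c * mat_act n A x p"
  unfolding act_def sum_distrib_left using assms by (intro sum.cong) auto

lemma act_one_mat:
  assumes "p < n"
  shows "mat_act n (1\<^sub>m n) x p = x p"
proof -
  have "mat_act n (1\<^sub>m n) x p = act {..<n} (\<lambda>i j. of_bool (i = j)) x p"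
    by (rule act_cong) (use assms in auto)
  then show ?thesis using act_delta[of "{..<n}" p x] assms by simp
qed

text \<open>
  The channels in \<open>S\<close> are closed: their input is their output, multiplied by the entry of \<open>Z\<close> that the label prescribes.
\<close>

definition closed_loop :: "'c set \<Rightarrow> ('c \<Rightarrow> 'c \<Rightarrow> complex) \<Rightarrow> 'c set \<Rightarrow> ('c \<Rightarrow> 'd) \<Rightarrow> nat \<Rightarrow> ('d::finite) mtuple \<Rightarrow> ('c \<Rightarrow> nat \<Rightarrow> complex) \<Rightarrow> bool" where
  "closed_loop F T S lab n Z z \<longleftrightarrow> (\<forall>s\<in>S. \<forall>p<n. z s p = mat_act n (Z (lab s)) (response F T z s) p)"

text \<open>
  The block matrix \<open>M\<close> describes the network that is left after closing the channels in \<open>S\<close>.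
\<close>

definition eliminates :: "'c set \<Rightarrow> ('c \<Rightarrow> 'c \<Rightarrow> complex) \<Rightarrow> 'c set \<Rightarrow> ('c \<Rightarrow> 'd) \<Rightarrow> nat \<Rightarrow> ('d::finite) mtuple \<Rightarrow> ('c \<Rightarrow> 'c \<Rightarrow> complex mat) \<Rightarrow> bool" where
  "eliminates F T S lab n Z M \<longleftrightarrow>
    (\<forall>a\<in>F - S. \<forall>b\<in>F - S. M a b \<in> carrier_mat n n) \<and>
    (\<forall>w. \<exists>z. (\<forall>a\<in>F - S. z a = w a) \<and> closed_loop F T S lab n Z z \<and>
      (\<forall>a\<in>F - S. \<forall>p<n. (response F T z a p) = (\<Sum>b\<in>F - S. mat_act n (M a b) (w b) p)))"

text \<open>
  Closing one more channel \<open>s\<close> replaces \<open>M a b\<close> by \<open>M a b + M a s (1 - Z M s s)\<^sup>-\<^sup>1 Z M s b\<close>.  The inverse exists on the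
  polydisc: conservation of energy in \<open>T\<close> shows that \<open>M s s\<close> is a contraction, and \<open>Z\<close> is a strict one.
\<close>

theorem state_elimination:
  fixes T :: "'c \<Rightarrow> 'c \<Rightarrow> complex" and lab :: "'c \<Rightarrow> 'd::finite"
  assumes F: "finite F" and iso: "isometric_on F T" and "finite S" "S \<subseteq> F"
  shows "\<exists>E. \<forall>n\<ge>1. \<forall>Z\<in>nc_disc \<inter> nc_level n. \<exists>M.
    (\<forall>a\<in>F - S. \<forall>b\<in>F - S. expr_eval (E a b) Z = Some (M a b)) \<and> eliminates F T S lab n Z M"
  using assms(3,4)
proof (induction S rule: finite_induct)
  case empty
  show ?case
  proof (intro exI[of _ "\<lambda>a b. NConst (T a b)"] allI impI ballI)
    fix n :: nat and Z :: "'d mtuple" assume "1 \<le> n" and Z: "Z \<in> nc_disc \<inter> nc_level n"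
    then have size: "nc_size Z = n" using nc_size_level by blast
    have "eliminates F T {} lab n Z (\<lambda>a b. T a b \<cdot>\<^sub>m 1\<^sub>m n)"
      unfolding eliminates_def
    proof (intro conjI allI)
      fix w
      show "\<exists>z. (\<forall>a\<in>F - {}. z a = w a) \<and> closed_loop F T {} lab n Z z \<and>
      (\<forall>a\<in>F - {}. \<forall>p<n. (response F T z a p) = (\<Sum>b\<in>F - {}. mat_act n (T a b \<cdot>\<^sub>m 1\<^sub>m n) (w b) p))"
        by (intro exI[of _ w]) (auto simp: closed_loop_def act_smult_mat[OF one_carrier_mat] act_one_mat)
    qed simp
    then show "\<exists>M. (\<forall>a\<in>F - {}. \<forall>b\<in>F - {}. expr_eval (NConst (T a b)) Z = Some (M a b)) \<and> eliminates F T {} lab n Z M"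
      by (intro exI[of _ "\<lambda>a b. T a b \<cdot>\<^sub>m 1\<^sub>m n"]) (simp add: size)
  qed
next
  case (insert s S)
  define A where "A = F - insert s S"
  have A: "F - S = insert s A" "s \<notin> A" "finite A" using insert.hyps insert.prems F by (auto simp: A_def)
  have SF: "S \<subseteq> F" using insert.prems by blast
  from insert.IH[OF SF] obtain E where E: "\<forall>n\<ge>1. \<forall>Z\<in>nc_disc \<inter> nc_level n. \<exists>M.
    (\<forall>a\<in>insert s A. \<forall>b\<in>insert s A. expr_eval (E a b) Z = Some (M a b)) \<and> eliminates F T S lab n Z M"
    unfolding A(1) by blast
  define E' where "E' = (\<lambda>a b. NAdd (E a b) (NMult (E a s)
    (NMult (NInv (NAdd (NConst 1) (NScale (-1) (NMult (NVar (lab s)) (E s s))))) (NMult (NVar (lab s)) (E s b)))))"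
  show ?case unfolding A_def[symmetric]
  proof (intro exI[of _ E'] allI impI ballI)
    fix n :: nat and Z :: "'d mtuple" assume n: "1 \<le> n" and Z: "Z \<in> nc_disc \<inter> nc_level n"
    have size: "nc_size Z = n" using Z nc_size_level by blast
    have Zl: "Z \<in> nc_level n" and Z1: "tuple_norm Z < 1" using Z nc_disc_level_iff[OF n] by blast+
    define \<kappa> where "\<kappa> = tuple_norm Z"
    have \<kappa>: "0 \<le> \<kappa>" "\<kappa> < 1" using Z1 tuple_norm_nonneg[OF Zl] by (simp_all add: \<kappa>_def)
    have Znorm: "nsq {..<n} (mat_act n (Z i) x) \<le> \<kappa>\<^sup>2 * nsq {..<n} x" for i x
      by (rule nsq_act_tuple_norm[OF Zl]) (simp add: \<kappa>_def)
    obtain M where eval: "\<forall>a\<in>insert s A. \<forall>b\<in>insert s A. expr_eval (E a b) Z = Some (M a b)"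
      and elim: "eliminates F T S lab n Z M"
      using E n Z by blast
    have Mc: "M a b \<in> carrier_mat n n" if "a \<in> insert s A" "b \<in> insert s A" for a b
      using elim that unfolding eliminates_def A(1) by blast
    have loop: "\<exists>z. (\<forall>a\<in>insert s A. z a = w a) \<and> closed_loop F T S lab n Z z \<and>
      (\<forall>a\<in>insert s A. \<forall>p<n. (response F T z a p) = (\<Sum>b\<in>insert s A. mat_act n (M a b) (w b) p))" for w
      using conjunct2[OF elim[unfolded eliminates_def A(1)]] by (rule spec)
    have Zs: "Z (lab s) \<in> carrier_mat n n" by (rule nc_level_carrier[OF Zl])
    have Mss: "M s s \<in> carrier_mat n n" by (rule Mc) auto
    define P where "P = Z (lab s) * M s s"
    have P: "P \<in> carrier_mat n n" unfolding P_def using Zs Mss by simp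
    define G where "G = 1 \<cdot>\<^sub>m 1\<^sub>m n + (-1) \<cdot>\<^sub>m P"
    have G: "G \<in> carrier_mat n n" using P by (simp add: G_def)
    have actG: "mat_act n G x p = x p - mat_act n (Z (lab s)) (mat_act n (M s s) x) p" if "p < n" for x p
    proof -
      have "mat_act n G x p = mat_act n (1 \<cdot>\<^sub>m 1\<^sub>m n) x p + mat_act n ((-1) \<cdot>\<^sub>m P) x p"
        unfolding G_def by (rule act_add_mat) (use P that in auto)
      also have "\<dots> = 1 * x p + (-1) * mat_act n P x p"
        using act_smult_mat[OF one_carrier_mat that, of 1 x] act_smult_mat[OF P that, of "-1" x] act_one_mat[OF that, of x] by simp
      also have "mat_act n P x p = mat_act n (Z (lab s)) (mat_act n (M s s) x) p"
        unfolding P_def by (rule act_mult_mat[OF Zs Mss that])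
      finally show ?thesis by simp
    qed
    have "\<exists>B. mat_inverse G = Some B \<and> B \<in> carrier_mat n n \<and> G * B = 1\<^sub>m n \<and> B * G = 1\<^sub>m n"
    proof (rule injective_mat_inverse[OF G])
      fix x i assume x: "\<And>i. i < n \<Longrightarrow> mat_act n G x i = 0" and i: "i < n"
      define y where "y = mat_act n (M s s) x"
      have xy: "x p = mat_act n (Z (lab s)) y p" if "p < n" for p
        using x[OF that] actG[OF that, of x] by (simp add: y_def)
      define w where "w = (\<lambda>c p. if c = s then x p else 0)"
      from loop[of w] obtain z where z: "\<And>a. a \<in> insert s A \<Longrightarrow> z a = w a" "closed_loop F T S lab n Z z"
        "\<And>a p. a \<in> insert s A \<Longrightarrow> p < n \<Longrightarrow> (response F T z a p) = (\<Sum>b\<in>insert s A. mat_act n (M a b) (w b) p)"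
        by blast
      have outs: "(response F T z s p) = y p" if "p < n" for p
      proof -
        have "(\<Sum>b\<in>insert s A. mat_act n (M s b) (w b) p) = y p + (\<Sum>b\<in>A. mat_act n (M s b) (w b) p)"
          using A by (simp add: w_def y_def)
        also have "(\<Sum>b\<in>A. mat_act n (M s b) (w b) p) = 0"
        proof (rule sum.neutral, intro ballI)
          fix b assume "b \<in> A"
          then have "w b = (\<lambda>_. 0)" using A(2) by (auto simp: w_def)
          then show "mat_act n (M s b) (w b) p = 0" by (simp add: act_def)
        qed
        finally show ?thesis using z(3)[of s p] that by simp
      qed
      have FSA: "F = S \<union> insert s A" "S \<inter> insert s A = {}" using A SF insert.hyps(2) by auto
      have split: "(\<Sum>c\<in>F. h c) = (\<Sum>c\<in>S. h c) + (h s + (\<Sum>c\<in>A. h c))" for h :: "'c \<Rightarrow> real"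
        using FSA A insert.hyps(1) by (metis finite_insert sum.insert sum.union_disjoint)
      define out where "out = (\<lambda>c p. response F T z c p)"
      have "(\<Sum>c\<in>F. nsq {..<n} (out c)) = (\<Sum>c\<in>F. nsq {..<n} (z c))"
        unfolding out_def by (rule isometric_energy_nsq[OF iso])
      moreover have "nsq {..<n} (out s) = nsq {..<n} y" by (rule nsq_cong) (simp add: out_def outs)
      moreover have "nsq {..<n} (z s) = nsq {..<n} x" using z(1)[of s] by (simp add: w_def)
      moreover have "(\<Sum>c\<in>A. nsq {..<n} (z c)) = 0"
      proof (rule sum.neutral, intro ballI)
        fix c assume "c \<in> A"
        then have "z c = (\<lambda>_. 0)" using A(2) z(1)[of c] by (auto simp: w_def)
        then show "nsq {..<n} (z c) = 0" by (simp add: nsq_def)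
      qed
      moreover have "(\<Sum>c\<in>A. nsq {..<n} (out c)) \<ge> 0" by (intro sum_nonneg) simp
      moreover have "(\<Sum>c\<in>S. nsq {..<n} (z c)) \<le> (\<Sum>c\<in>S. nsq {..<n} (out c))"
      proof (rule sum_mono)
        fix c assume c: "c \<in> S"
        have "nsq {..<n} (z c) = nsq {..<n} (mat_act n (Z (lab c)) (out c))"
          by (rule nsq_cong) (use z(2) c in \<open>auto simp: closed_loop_def out_def\<close>)
        also have "\<dots> \<le> \<kappa>\<^sup>2 * nsq {..<n} (out c)" by (rule Znorm)
        also have "\<dots> \<le> 1 * nsq {..<n} (out c)" using \<kappa> by (intro mult_right_mono) (auto simp: power_le_one)
        finally show "nsq {..<n} (z c) \<le> nsq {..<n} (out c)" by simp
      qed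
      ultimately have yx: "nsq {..<n} y \<le> nsq {..<n} x" unfolding split by linarith
      have "nsq {..<n} x = nsq {..<n} (mat_act n (Z (lab s)) y)" by (rule nsq_cong) (simp add: xy)
      also have "\<dots> \<le> \<kappa>\<^sup>2 * nsq {..<n} y" by (rule Znorm)
      also have "\<dots> \<le> \<kappa>\<^sup>2 * nsq {..<n} x" using yx by (intro mult_left_mono) auto
      finally have "(1 - \<kappa>\<^sup>2) * nsq {..<n} x \<le> 0" by (simp add: algebra_simps)
      moreover have "1 - \<kappa>\<^sup>2 > 0" using \<kappa> by (simp add: abs_square_less_1)
      ultimately have "nsq {..<n} x \<le> 0" by (simp add: mult_le_0_iff)
      moreover have "(cmod (x i))\<^sup>2 \<le> nsq {..<n} x" by (rule entry_le_nsq) (use i in auto)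
      ultimately have "(cmod (x i))\<^sup>2 \<le> 0" by linarith
      then show "x i = 0" by simp
    qed
    then obtain B where B: "mat_inverse G = Some B" "B \<in> carrier_mat n n" "G * B = 1\<^sub>m n" by blast
    define M' where "M' = (\<lambda>a b. M a b + M a s * (B * (Z (lab s) * M s b)))"
    have eval': "expr_eval (E' a b) Z = Some (M' a b) \<and> M' a b \<in> carrier_mat n n" if ab: "a \<in> A" "b \<in> A" for a b
    proof -
      have c: "M a b \<in> carrier_mat n n" "M a s \<in> carrier_mat n n" "M s b \<in> carrier_mat n n"
        using Mc ab by auto
      have "expr_eval (E' a b) Z = Some (M' a b)"
        using eval ab B(1) by (simp add: E'_def M'_def size G_def P_def)
      then show ?thesis using c B(2) Zs by (simp add: M'_def)
    qed
    have actM': "mat_act n (M' a b) x p = mat_act n (M a b) x p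
        + mat_act n (M a s) (mat_act n B (mat_act n (Z (lab s)) (mat_act n (M s b) x))) p"
      if ab: "a \<in> A" "b \<in> A" and p: "p < n" for a b x p
    proof -
      have c: "M a b \<in> carrier_mat n n" "M a s \<in> carrier_mat n n" "M s b \<in> carrier_mat n n"
        using Mc ab by auto
      have ZM: "Z (lab s) * M s b \<in> carrier_mat n n" using Zs c by simp
      have BZM: "B * (Z (lab s) * M s b) \<in> carrier_mat n n" using B(2) ZM by simp
      have "mat_act n (M' a b) x p = mat_act n (M a b) x p + mat_act n (M a s * (B * (Z (lab s) * M s b))) x p"
        unfolding M'_def by (rule act_add_mat) (use c BZM p in auto)
      also have "mat_act n (M a s * (B * (Z (lab s) * M s b))) x p = mat_act n (M a s) (mat_act n (B * (Z (lab s) * M s b)) x) p"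
        by (rule act_mult_mat[OF c(2) BZM p])
      also have "\<dots> = mat_act n (M a s) (mat_act n B (mat_act n (Z (lab s)) (mat_act n (M s b) x))) p"
      proof (rule act_cong)
        fix i assume "i \<in> {..<n}"
        then have i: "i < n" by simp
        have "mat_act n (B * (Z (lab s) * M s b)) x i = mat_act n B (mat_act n (Z (lab s) * M s b) x) i"
          by (rule act_mult_mat[OF B(2) ZM i])
        also have "\<dots> = mat_act n B (mat_act n (Z (lab s)) (mat_act n (M s b) x)) i"
          by (rule act_cong) (use act_mult_mat[OF Zs c(3)] i in auto)
        finally show "mat_act n (B * (Z (lab s) * M s b)) x i = mat_act n B (mat_act n (Z (lab s)) (mat_act n (M s b) x)) i" .
      qed (use p in auto)
      finally show ?thesis .
    qed
    have "eliminates F T (insert s S) lab n Z M'"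
      unfolding eliminates_def A_def[symmetric]
    proof (intro conjI allI)
      show "\<forall>a\<in>A. \<forall>b\<in>A. M' a b \<in> carrier_mat n n" using eval' by blast
      fix w :: "'c \<Rightarrow> nat \<Rightarrow> complex"
      define v where "v = (\<lambda>p. \<Sum>b\<in>A. mat_act n (M s b) (w b) p)"
      define \<omega> where "\<omega> = mat_act n B (mat_act n (Z (lab s)) v)"
      define w' where "w' = (\<lambda>c. if c = s then \<omega> else w c)"
      from loop[of w'] obtain z where z: "\<And>a. a \<in> insert s A \<Longrightarrow> z a = w' a" "closed_loop F T S lab n Z z"
        "\<And>a p. a \<in> insert s A \<Longrightarrow> p < n \<Longrightarrow> (response F T z a p) = (\<Sum>b\<in>insert s A. mat_act n (M a b) (w' b) p)"
        by blast
      have sumw': "(\<Sum>b\<in>insert s A. mat_act n (M a b) (w' b) p) = mat_act n (M a s) \<omega> p + (\<Sum>b\<in>A. mat_act n (M a b) (w b) p)" for a p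
      proof -
        have "(\<Sum>b\<in>A. mat_act n (M a b) (w' b) p) = (\<Sum>b\<in>A. mat_act n (M a b) (w b) p)"
          by (rule sum.cong) (use A(2) in \<open>auto simp: w'_def\<close>)
        then show ?thesis using A by (simp add: w'_def)
      qed
      have \<omega>: "\<omega> p = mat_act n (Z (lab s)) (response F T z s) p" if p: "p < n" for p
      proof -
        have "mat_act n G \<omega> p = mat_act n (G * B) (mat_act n (Z (lab s)) v) p"
          unfolding \<omega>_def by (rule act_mult_mat[OF G B(2) p, symmetric])
        also have "\<dots> = mat_act n (Z (lab s)) v p" unfolding B(3) by (rule act_one_mat[OF p])
        finally have "\<omega> p = mat_act n (Z (lab s)) (\<lambda>i. mat_act n (M s s) \<omega> i + v i) p"
          unfolding act_add using actG[OF p, of \<omega>] by (simp add: diff_eq_eq add.commute)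
        also have "\<dots> = mat_act n (Z (lab s)) (response F T z s) p"
        proof (rule act_cong)
          fix i assume "i \<in> {..<n}"
          then show "mat_act n (M s s) \<omega> i + v i = (response F T z s i)"
            using z(3)[of s i] sumw'[of s i] by (simp add: v_def)
        qed (use p in auto)
        finally show ?thesis .
      qed
      show "\<exists>z. (\<forall>a\<in>A. z a = w a) \<and> closed_loop F T (insert s S) lab n Z z \<and>
        (\<forall>a\<in>A. \<forall>p<n. (response F T z a p) = (\<Sum>b\<in>A. mat_act n (M' a b) (w b) p))"
      proof (intro exI[of _ z] conjI ballI allI impI)
        fix a assume "a \<in> A"
        then show "z a = w a" using z(1)[of a] A(2) by (auto simp: w'_def)
      next
        have "z s p = mat_act n (Z (lab s)) (response F T z s) p" if "p < n" for p
          using \<omega>[OF that] z(1)[of s] by (simp add: w'_def)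
        then show "closed_loop F T (insert s S) lab n Z z" using z(2) by (simp add: closed_loop_def)
      next
        fix a p assume a: "a \<in> A" and p: "p < n"
        have "(\<Sum>b\<in>A. mat_act n (M' a b) (w b) p) = (\<Sum>b\<in>A. mat_act n (M a b) (w b) p)
          + (\<Sum>b\<in>A. mat_act n (M a s) (mat_act n B (mat_act n (Z (lab s)) (mat_act n (M s b) (w b)))) p)"
          unfolding sum.distrib[symmetric] by (rule sum.cong) (use actM' a p in auto)
        also have "(\<Sum>b\<in>A. mat_act n (M a s) (mat_act n B (mat_act n (Z (lab s)) (mat_act n (M s b) (w b)))) p)
          = mat_act n (M a s) \<omega> p"
        proof -
          have "\<omega> = (\<lambda>i. \<Sum>b\<in>A. mat_act n B (mat_act n (Z (lab s)) (mat_act n (M s b) (w b))) i)"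
          proof
            fix i
            have "mat_act n (Z (lab s)) v = (\<lambda>j. \<Sum>b\<in>A. mat_act n (Z (lab s)) (mat_act n (M s b) (w b)) j)"
              unfolding v_def by (rule ext) (rule act_sum)
            then show "\<omega> i = (\<Sum>b\<in>A. mat_act n B (mat_act n (Z (lab s)) (mat_act n (M s b) (w b))) i)"
              unfolding \<omega>_def by (simp only: act_sum)
          qed
          then show ?thesis by (simp only: act_sum)
        qed
        finally show "(response F T z a p) = (\<Sum>b\<in>A. mat_act n (M' a b) (w b) p)"
          using z(3)[of a p] a p sumw'[of a p] by simp
      qed
    qed
    then show "\<exists>M. (\<forall>a\<in>A. \<forall>b\<in>A. expr_eval (E' a b) Z = Some (M a b)) \<and> eliminates F T (insert s S) lab n Z M"
      using eval' by blast
  qed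
qed

section \<open>Boundary values\<close>

lemma ip_act_adjoint: "ip I (act I A x) y = ip I x (act I (\<lambda>a b. cnj (A b a)) y)"
proof -
  have "ip I (act I A x) y = (\<Sum>a\<in>I. \<Sum>b\<in>I. cnj (x b) * (cnj (A a b) * y a))"
    unfolding ip_def act_def by (simp add: sum_distrib_left mult_ac)
  also have "\<dots> = (\<Sum>b\<in>I. \<Sum>a\<in>I. cnj (x b) * (cnj (A a b) * y a))" by (rule sum.swap)
  finally show ?thesis unfolding ip_def act_def by (simp add: sum_distrib_left)
qed

lemma mat_adjoint_entry:
  fixes A :: "complex mat"
  assumes "A \<in> carrier_mat n n" "i < n" "j < n"
  shows "mat_adjoint A $$ (i, j) = cnj (A $$ (j, i))"
  using assms by (auto simp: mat_adjoint_def mat_of_rows_def)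

lemma mat_adjoint_carrier:
  fixes A :: "complex mat"
  assumes "A \<in> carrier_mat n n"
  shows "mat_adjoint A \<in> carrier_mat n n"
  using assms by (auto simp: mat_adjoint_def)

lemma unitary_mats_isometric:
  assumes "U \<in> unitary_mats n"
  shows "isometric_on {..<n} (ent U)"
  unfolding isometric_on_def
proof (intro allI)
  fix x y
  have U: "U \<in> carrier_mat n n" and UU: "mat_adjoint U * U = 1\<^sub>m n" using assms by (auto simp: unitary_mats_def)
  have "ip {..<n} (mat_act n U x) (mat_act n U y)
    = ip {..<n} x (act {..<n} (\<lambda>a b. cnj (U $$ (b, a))) (mat_act n U y))"
    by (rule ip_act_adjoint)
  also have "\<dots> = ip {..<n} x y"
  proof (rule ip_cong)
    fix p assume "p \<in> {..<n}"
    then have p: "p < n" by simp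
    have "act {..<n} (\<lambda>a b. cnj (U $$ (b, a))) (mat_act n U y) p = mat_act n (mat_adjoint U) (mat_act n U y) p"
      by (rule act_cong) (use p mat_adjoint_entry[OF U] in auto)
    also have "\<dots> = mat_act n (1\<^sub>m n) y p"
      unfolding UU[symmetric] by (rule act_mult_mat[OF mat_adjoint_carrier[OF U] U p, symmetric])
    finally show "act {..<n} (\<lambda>a b. cnj (U $$ (b, a))) (mat_act n U y) p = y p" by (simp add: act_one_mat[OF p])
  qed simp
  finally show "ip {..<n} (mat_act n U x) (mat_act n U y) = ip {..<n} x y" .
qed

text \<open>
  The network preceded by the unitaries \<open>U\<close> is a unitary network with scalar channels, one for each pair of a channel and a
  coordinate, to which \<open>unitary_feedback\<close> applies.
\<close>

lemma boundary_closed_loop: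
  assumes F: "finite F" "p0 \<in> F" and iso: "isometric_on F T" and U: "\<And>i. U i \<in> unitary_mats n"
  shows "\<exists>z. z p0 = u \<and> closed_loop F T (F - {p0}) lab n U z"
proof -
  define S where "S = F - {p0}"
  have S: "finite S" "p0 \<notin> S" "F = insert p0 S" using F by (auto simp: S_def)
  define V where "V = (\<lambda>b i j. if b = p0 then of_bool (i = j) else U (lab b) $$ (i, j))"
  have V_iso: "isometric_on {..<n} (V b)" for b
  proof (cases "b = p0")
    case True
    then show ?thesis by (auto simp: isometric_on_def V_def act_delta intro!: ip_cong)
  next
    case False
    then have "V b = ent (U (lab b))" by (simp add: V_def)
    then show ?thesis using unitary_mats_isometric[OF U] by simp
  qed
  define M where "M = (\<lambda>(a, i) (b, j). T a b * V b i j)"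
  have actM: "act (F \<times> {..<n}) M x (a, i) = (\<Sum>b\<in>F. T a b * act {..<n} (V b) (\<lambda>j. x (b, j)) i)" for x a i
    by (simp add: act_def M_def sum.cartesian_product' sum_distrib_left mult.assoc)
  have ipF: "ip (F \<times> {..<n}) x y = (\<Sum>b\<in>F. ip {..<n} (\<lambda>j. x (b, j)) (\<lambda>j. y (b, j)))" for x y
    by (simp add: ip_def sum.cartesian_product')
  have "isometric_on (F \<times> {..<n}) M"
    unfolding isometric_on_def
  proof (intro allI)
    fix x y
    have "ip (F \<times> {..<n}) (act (F \<times> {..<n}) M x) (act (F \<times> {..<n}) M y)
      = (\<Sum>b\<in>F. ip {..<n} (act {..<n} (V b) (\<lambda>j. x (b, j))) (act {..<n} (V b) (\<lambda>j. y (b, j))))"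
      unfolding ipF actM by (rule isometric_energy[OF iso])
    also have "\<dots> = ip (F \<times> {..<n}) x y" unfolding ipF using V_iso by (simp add: isometric_on_def)
    finally show "ip (F \<times> {..<n}) (act (F \<times> {..<n}) M x) (act (F \<times> {..<n}) M y) = ip (F \<times> {..<n}) x y" .
  qed
  moreover have eq: "{p0} \<times> {..<n} \<union> S \<times> {..<n} = F \<times> {..<n}" using S(3) by auto
  ultimately have isoM: "isometric_on ({p0} \<times> {..<n} \<union> S \<times> {..<n}) M" by simp
  have "finite (S \<times> {..<n})" "finite ({p0} \<times> {..<n})" "({p0} \<times> {..<n}) \<inter> (S \<times> {..<n}) = {}"
    using S by auto
  from unitary_feedback[OF this isoM, of "\<lambda>(a, i). u i"] obtain x
    where x0: "\<And>i. i < n \<Longrightarrow> x (p0, i) = u i"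
      and xs: "\<And>s i. s \<in> S \<Longrightarrow> i < n \<Longrightarrow> act (F \<times> {..<n}) M x (s, i) = x (s, i)"
    unfolding eq by auto
  define z where "z = (\<lambda>b. if b = p0 then u else mat_act n (U (lab b)) (\<lambda>j. x (b, j)))"
  have zV: "z b i = act {..<n} (V b) (\<lambda>j. x (b, j)) i" if "i < n" for b i
  proof (cases "b = p0")
    case True
    then show ?thesis using that x0[OF that] by (simp add: z_def V_def act_delta)
  qed (simp add: z_def V_def)
  have "closed_loop F T S lab n U z"
    unfolding closed_loop_def
  proof (intro ballI allI impI)
    fix s p assume s: "s \<in> S" and p: "p < n"
    have "z s p = mat_act n (U (lab s)) (\<lambda>j. x (s, j)) p" using s S(2) by (auto simp: z_def)
    also have "\<dots> = mat_act n (U (lab s)) (response F T z s) p"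
      by (rule act_cong) (use xs[OF s] p in \<open>auto simp: actM zV\<close>)
    finally show "z s p = mat_act n (U (lab s)) (response F T z s) p" .
  qed
  then show ?thesis by (intro exI[of _ z]) (simp add: z_def S_def)
qed

text \<open>
  Let \<open>x\<close> be the states for \<open>U\<close> and \<open>x + d\<close> those for \<open>r U\<close>.  Energy balance for the difference of the two solutions gives
  \<open>\<parallel>\<Delta>\<parallel>\<^sup>2 + \<parallel>d\<parallel>\<^sup>2 = \<parallel>r d - (1 - r) x\<parallel>\<^sup>2\<close>, where \<open>\<Delta>\<close> is the difference of the outputs.  This first yields
  \<open>\<parallel>d\<parallel> \<le> \<parallel>x\<parallel>\<close> and then that \<open>\<Delta>\<close> tends to \<open>0\<close>.
\<close>

lemma radial_estimate:
  assumes F: "finite F" "p0 \<in> F" and iso: "isometric_on F T" and U: "\<And>i. U i \<in> unitary_mats n"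
    and r: "0 \<le> r" "r < 1"
    and z: "closed_loop F T (F - {p0}) lab n U z"
    and z': "closed_loop F T (F - {p0}) lab n (\<lambda>i. complex_of_real r \<cdot>\<^sub>m U i) z'"
    and eq: "z' p0 = z p0"
  shows "nsq {..<n} (\<lambda>p. (response F T z' p0 p) - (response F T z p0 p))
    \<le> 2 * (1 - r) * (\<Sum>s\<in>F - {p0}. nsq {..<n} (response F T z s))"
proof -
  define S where "S = F - {p0}"
  have S: "finite S" "p0 \<notin> S" "F = insert p0 S" using F by (auto simp: S_def)
  have sumF: "(\<Sum>c\<in>F. h c) = h p0 + (\<Sum>s\<in>S. h s)" for h :: "'a \<Rightarrow> real"
    unfolding S(3) using S(1,2) by simp
  define out where "out = (\<lambda>c p. response F T z c p)"
  define out' where "out' = (\<lambda>c p. response F T z' c p)"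
  have Uc: "U i \<in> carrier_mat n n" for i using U[of i] by (simp add: unitary_mats_def)
  define d where "d = (\<lambda>(s, p). out' s p - out s p)"
  define x where "x = (\<lambda>(s, p). out s p)"
  have energy: "nsq {..<n} (\<lambda>p. out' p0 p - out p0 p) + nsq (S \<times> {..<n}) d
    = nsq (S \<times> {..<n}) (\<lambda>k. of_real r * d k + of_real (r - 1) * x k)"
  proof -
    have "(\<Sum>c\<in>F. nsq {..<n} (\<lambda>p. out' c p - out c p)) = (\<Sum>c\<in>F. nsq {..<n} (\<lambda>p. z' c p - z c p))"
      using isometric_energy_nsq[OF iso, of "{..<n}" "\<lambda>c p. z' c p - z c p"]
      by (simp add: out_def out'_def right_diff_distrib sum_subtractf)
    moreover have "nsq {..<n} (\<lambda>p. z' p0 p - z p0 p) = 0" by (simp add: eq nsq_def)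
    moreover have "nsq {..<n} (\<lambda>p. z' s p - z s p) = nsq {..<n} (\<lambda>p. of_real r * d (s, p) + of_real (r - 1) * x (s, p))" if s: "s \<in> S" for s
    proof -
      have "nsq {..<n} (\<lambda>p. z' s p - z s p) = nsq {..<n} (mat_act n (U (lab s)) (\<lambda>p. of_real r * out' s p - out s p))"
      proof (rule nsq_cong)
        fix p assume "p \<in> {..<n}"
        then have p: "p < n" by simp
        have "z' s p = mat_act n (of_real r \<cdot>\<^sub>m U (lab s)) (out' s) p"
          using z' s p by (simp add: closed_loop_def S_def out'_def)
        moreover have "z s p = mat_act n (U (lab s)) (out s) p"
          using z s p by (simp add: closed_loop_def S_def out_def)
        ultimately show "z' s p - z s p = mat_act n (U (lab s)) (\<lambda>p. of_real r * out' s p - out s p) p"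
          by (simp add: act_smult_mat[OF Uc p] act_diff act_scale)
      qed
      also have "\<dots> = nsq {..<n} (\<lambda>p. of_real r * out' s p - out s p)"
        by (rule isometric_on_nsq[OF unitary_mats_isometric[OF U]])
      also have "\<dots> = nsq {..<n} (\<lambda>p. of_real r * d (s, p) + of_real (r - 1) * x (s, p))"
        by (simp add: d_def x_def algebra_simps)
      finally show ?thesis .
    qed
    ultimately have "nsq {..<n} (\<lambda>p. out' p0 p - out p0 p) + (\<Sum>s\<in>S. nsq {..<n} (\<lambda>p. out' s p - out s p))
      = (\<Sum>s\<in>S. nsq {..<n} (\<lambda>p. of_real r * d (s, p) + of_real (r - 1) * x (s, p)))"
      unfolding sumF by simp
    then show ?thesis by (simp add: nsq_def sum.cartesian_product' d_def)
  qed
  define b where "b = sqrt (nsq (S \<times> {..<n}) d)"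
  define c where "c = sqrt (nsq (S \<times> {..<n}) x)"
  have b0: "b \<ge> 0" "b\<^sup>2 = nsq (S \<times> {..<n}) d" by (simp_all add: b_def)
  have c0: "c \<ge> 0" "c\<^sup>2 = nsq (S \<times> {..<n}) x" by (simp_all add: c_def)
  define m where "m = r * b + (1 - r) * c"
  have "sqrt (nsq (S \<times> {..<n}) (\<lambda>k. of_real r * d k + of_real (r - 1) * x k))
    \<le> sqrt (nsq (S \<times> {..<n}) (\<lambda>k. of_real r * d k)) + sqrt (nsq (S \<times> {..<n}) (\<lambda>k. of_real (r - 1) * x k))"
    by (rule sqrt_nsq_add)
  also have "\<dots> = m"
    unfolding nsq_scale norm_of_real power2_abs using r by (simp add: m_def b_def c_def real_sqrt_mult)
  finally have "(sqrt (nsq (S \<times> {..<n}) (\<lambda>k. of_real r * d k + of_real (r - 1) * x k)))\<^sup>2 \<le> m\<^sup>2"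
    by (rule power_mono) simp
  then have le: "nsq {..<n} (\<lambda>p. out' p0 p - out p0 p) + b\<^sup>2 \<le> m\<^sup>2"
    using energy b0 by simp
  then have "b\<^sup>2 \<le> m\<^sup>2" using nsq_nonneg[of "{..<n}" "\<lambda>p. out' p0 p - out p0 p"] by linarith
  moreover have "m \<ge> 0" using r b0 c0 by (simp add: m_def)
  ultimately have "b \<le> m" by (rule power2_le_imp_le)
  then have "(1 - r) * b \<le> (1 - r) * c" by (simp add: m_def algebra_simps)
  then have bc: "b \<le> c" using r by simp
  have "m\<^sup>2 - b\<^sup>2 = ((1 - r) * (c - b)) * (m + b)"
    by (simp add: m_def power2_eq_square algebra_simps)
  also have "\<dots> \<le> ((1 - r) * c) * (2 * c)"
  proof (rule mult_mono)
    show "(1 - r) * (c - b) \<le> (1 - r) * c" using r b0 by (intro mult_left_mono) auto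
    have "r * b \<le> r * c" using bc r by (intro mult_left_mono) auto
    then have "m \<le> c" by (simp add: m_def algebra_simps)
    then show "m + b \<le> 2 * c" using bc by simp
    show "0 \<le> (1 - r) * c" using r c0 by simp
    show "0 \<le> m + b" using \<open>m \<ge> 0\<close> b0 by simp
  qed
  also have "\<dots> = 2 * (1 - r) * c\<^sup>2" by (simp add: power2_eq_square)
  finally have "nsq {..<n} (\<lambda>p. out' p0 p - out p0 p) \<le> 2 * (1 - r) * c\<^sup>2" using le by linarith
  moreover have "c\<^sup>2 = (\<Sum>s\<in>S. nsq {..<n} (out s))"
    unfolding c0(2) by (simp add: nsq_def sum.cartesian_product' x_def)
  ultimately show ?thesis by (simp add: out_def out'_def S_def)
qed

text \<open>
  The columns of the limit are the outputs for the standard basis vectors as inputs.  They are orthonormal because the network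
  and \<open>U\<close> preserve inner products, so that the contributions of the internal channels cancel.
\<close>

theorem radial_limit_unitary:
  fixes U :: "('d::finite) mtuple" and lab :: "'c \<Rightarrow> 'd"
  assumes F: "finite F" "p0 \<in> F" and iso: "isometric_on F T" and U: "\<And>i. U i \<in> unitary_mats n"
    and M: "\<And>r u. 0 < r \<Longrightarrow> r < 1 \<Longrightarrow> \<exists>z. z p0 = u \<and> closed_loop F T (F - {p0}) lab n (\<lambda>i. complex_of_real r \<cdot>\<^sub>m U i) z \<and>
      (\<forall>p<n. (response F T z p0 p) = mat_act n (M r) u p)"
  shows "\<exists>W\<in>unitary_mats n. \<forall>i<n. \<forall>j<n. ((\<lambda>r. M r $$ (i, j)) \<longlongrightarrow> W $$ (i, j)) (at_left 1)"
proof -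
  define e where "e = (\<lambda>j i::nat. of_bool (i = j) :: complex)"
  have "\<forall>j. \<exists>z. z p0 = e j \<and> closed_loop F T (F - {p0}) lab n U z"
    by (intro allI boundary_closed_loop F iso U)
  from choice[OF this] obtain z where z0: "\<And>j. z j p0 = e j" and zl: "\<And>j. closed_loop F T (F - {p0}) lab n U (z j)" by blast
  define Y where "Y = (\<lambda>j p. response F T (z j) p0 p)"
  define W where "W = mat n n (\<lambda>(i, j). Y j i)"
  have Wc: "W \<in> carrier_mat n n" by (simp add: W_def)
  have S: "finite (F - {p0})" "F = insert p0 (F - {p0})" using F by auto
  have sumF: "(\<Sum>c\<in>F. h c) = h p0 + (\<Sum>s\<in>F - {p0}. h s)" for h :: "'c \<Rightarrow> complex"
    by (rule sum.remove[OF F])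
  have orth: "ip {..<n} (Y j) (Y k) = ip {..<n} (e j) (e k)" for j k
  proof -
    have "ip {..<n} (z j s) (z k s) = ip {..<n} (response F T (z j) s) (response F T (z k) s)"
      if s: "s \<in> F - {p0}" for s
    proof -
      have "ip {..<n} (z j s) (z k s) = ip {..<n} (mat_act n (U (lab s)) (response F T (z j) s))
        (mat_act n (U (lab s)) (response F T (z k) s))"
        by (rule ip_cong) (use zl s in \<open>auto simp: closed_loop_def\<close>)
      then show ?thesis using unitary_mats_isometric[OF U] by (simp add: isometric_on_def)
    qed
    then show ?thesis
      using isometric_energy[OF iso, of "{..<n}" "z j" "z k"]
      unfolding sumF[of "\<lambda>c. ip {..<n} (z j c) (z k c)"]
        sumF[of "\<lambda>c. ip {..<n} (response F T (z j) c) (response F T (z k) c)"]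
      by (simp add: Y_def z0)
  qed
  have "mat_adjoint W * W = 1\<^sub>m n"
  proof (rule eq_matI)
    fix j k assume "j < dim_row (1\<^sub>m n :: complex mat)" "k < dim_col (1\<^sub>m n :: complex mat)"
    then have j: "j < n" and k: "k < n" by auto
    have "(mat_adjoint W * W) $$ (j, k) = (\<Sum>i<n. mat_adjoint W $$ (j, i) * W $$ (i, k))"
      by (rule mult_mat_entry[OF mat_adjoint_carrier[OF Wc] Wc j k])
    also have "\<dots> = ip {..<n} (Y j) (Y k)"
      unfolding ip_def by (rule sum.cong) (use j k mat_adjoint_entry[OF Wc] in \<open>auto simp: W_def\<close>)
    also have "\<dots> = (\<Sum>i<n. if i = j then of_bool (j = k) else 0)"
      unfolding orth unfolding ip_def e_def by (rule sum.cong) auto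
    finally show "(mat_adjoint W * W) $$ (j, k) = 1\<^sub>m n $$ (j, k)" using j k by simp
  qed (use Wc mat_adjoint_carrier[OF Wc] in auto)
  moreover have "W * mat_adjoint W = 1\<^sub>m n"
    by (rule mat_mult_left_right_inverse[OF mat_adjoint_carrier[OF Wc] Wc calculation])
  ultimately have "W \<in> unitary_mats n" using Wc by (simp add: unitary_mats_def)
  moreover have "((\<lambda>r. M r $$ (i, j)) \<longlongrightarrow> W $$ (i, j)) (at_left 1)" if i: "i < n" and j: "j < n" for i j
  proof -
    define C where "C = (\<Sum>s\<in>F - {p0}. nsq {..<n} (response F T (z j) s))"
    have est: "cmod (M r $$ (i, j) - W $$ (i, j)) \<le> sqrt (2 * (1 - r) * C)" if r: "0 < r" "r < 1" for r
    proof -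
      from M[OF r, of "e j"] obtain z' where z': "z' p0 = e j" "closed_loop F T (F - {p0}) lab n (\<lambda>i. complex_of_real r \<cdot>\<^sub>m U i) z'"
        "\<And>p. p < n \<Longrightarrow> (response F T z' p0 p) = mat_act n (M r) (e j) p" by blast
      have "mat_act n (M r) (e j) i = (\<Sum>k<n. if k = j then M r $$ (i, k) else 0)"
        unfolding act_def e_def by (rule sum.cong) auto
      then have Mij: "M r $$ (i, j) = (response F T z' p0 i)" using z'(3)[OF i] j by simp
      have "(cmod (M r $$ (i, j) - W $$ (i, j)))\<^sup>2 \<le> nsq {..<n} (\<lambda>p. (response F T z' p0 p) - (response F T (z j) p0 p))"
        using entry_le_nsq[of "{..<n}" i "\<lambda>p. (response F T z' p0 p) - (response F T (z j) p0 p)"] i j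
        by (simp add: Mij W_def Y_def)
      also have "\<dots> \<le> 2 * (1 - r) * C"
        unfolding C_def using r by (intro radial_estimate[OF F iso U _ _ zl z'(2)]) (simp_all add: z'(1) z0)
      finally show ?thesis by (rule real_le_rsqrt)
    qed
    have "((\<lambda>r. M r $$ (i, j) - W $$ (i, j)) \<longlongrightarrow> 0) (at_left 1)"
    proof (rule Lim_null_comparison)
      have "\<forall>\<^sub>F r::real in at_left 1. 0 < r \<and> r < 1"
        using eventually_at_left_field[of "\<lambda>r. 0 < r \<and> r < 1" "1::real"] by (auto intro!: exI[of _ 0])
      then show "\<forall>\<^sub>F r in at_left 1. cmod (M r $$ (i, j) - W $$ (i, j)) \<le> sqrt (2 * (1 - r) * C)"
        by eventually_elim (use est in auto)
      have "((\<lambda>r. sqrt (2 * (1 - r) * C)) \<longlongrightarrow> sqrt (2 * (1 - 1) * C)) (at_left 1)"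
        by (intro tendsto_intros)
      then show "((\<lambda>r. sqrt (2 * (1 - r) * C)) \<longlongrightarrow> 0) (at_left 1)" by simp
    qed
    then show ?thesis by (simp add: LIM_zero_iff)
  qed
  ultimately show ?thesis by blast
qed

section \<open>Interpolating inner functions\<close>

theorem transfer_expression:
  fixes T :: "'c \<Rightarrow> 'c \<Rightarrow> complex" and lab :: "'c \<Rightarrow> 'd::finite"
  assumes F: "finite F" "p0 \<in> F" and iso: "isometric_on F T"
  shows "\<exists>e. \<forall>n\<ge>1. \<forall>Z\<in>nc_disc \<inter> nc_level n. \<exists>M\<in>carrier_mat n n. expr_eval e Z = Some M \<and>
    (\<forall>u. \<exists>z. z p0 = u \<and> closed_loop F T (F - {p0}) lab n Z z \<and>
      (\<forall>p<n. (response F T z p0 p) = mat_act n M u p))"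
proof -
  have p: "F - (F - {p0}) = {p0}" using F by auto
  from state_elimination[OF F(1) iso, of "F - {p0}" lab] F(1)
  obtain E where E: "\<forall>n\<ge>1. \<forall>Z\<in>nc_disc \<inter> nc_level n. \<exists>M.
      expr_eval (E p0 p0) Z = Some (M p0 p0) \<and> eliminates F T (F - {p0}) lab n Z M"
    unfolding p by auto
  show ?thesis
  proof (intro exI[of _ "E p0 p0"] allI impI ballI)
    fix n :: nat and Z :: "'d mtuple" assume "1 \<le> n" "Z \<in> nc_disc \<inter> nc_level n"
    then obtain M where M: "expr_eval (E p0 p0) Z = Some (M p0 p0)" "eliminates F T (F - {p0}) lab n Z M"
      using E by blast
    have Mc: "M p0 p0 \<in> carrier_mat n n" using M(2) unfolding eliminates_def p by blast
    have loop: "\<exists>z. (\<forall>a\<in>{p0}. z a = w a) \<and> closed_loop F T (F - {p0}) lab n Z z \<and>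
        (\<forall>a\<in>{p0}. \<forall>p<n. (response F T z a p) = (\<Sum>b\<in>{p0}. mat_act n (M a b) (w b) p))" for w
      using conjunct2[OF M(2)[unfolded eliminates_def p]] by (rule spec)
    have "\<exists>z. z p0 = u \<and> closed_loop F T (F - {p0}) lab n Z z \<and>
      (\<forall>p<n. (response F T z p0 p) = mat_act n (M p0 p0) u p)" for u
      using loop[of "\<lambda>_. u"] by simp
    then show "\<exists>M\<in>carrier_mat n n. expr_eval (E p0 p0) Z = Some M \<and>
      (\<forall>u. \<exists>z. z p0 = u \<and> closed_loop F T (F - {p0}) lab n Z z \<and>
      (\<forall>p<n. (response F T z p0 p) = mat_act n M u p))"
      using M(1) Mc by blast
  qed
qed

lemma scaled_unitary_in_disc:
  assumes n: "n \<ge> 1" and U: "U \<in> unitary_tuples n" and r: "0 \<le> r" "r < 1"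
  shows "(\<lambda>i. complex_of_real r \<cdot>\<^sub>m U i) \<in> nc_disc \<inter> nc_level n"
proof -
  have Ui: "U i \<in> unitary_mats n" for i using U by (simp add: unitary_tuples_def)
  have Uc: "U i \<in> carrier_mat n n" for i using Ui[of i] by (simp add: unitary_mats_def)
  then have Ul: "U \<in> nc_level n" by (simp add: nc_level_def)
  have "op_norm (U i) \<le> 1" for i
    by (rule op_norm_le[OF Uc]) (use isometric_on_nsq[OF unitary_mats_isometric[OF Ui]] in auto)
  then have "tuple_norm U \<le> 1" unfolding tuple_norm_le_iff by blast
  then have "cmod (of_real r) * tuple_norm U \<le> r * 1" using r by (simp add: mult_left_le)
  then have "tuple_norm (\<lambda>i. complex_of_real r \<cdot>\<^sub>m U i) < 1"
    using tuple_norm_scale_le[OF Ul, of "of_real r"] r by linarith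
  then show ?thesis using scaled_tuple_level[OF Ul] nc_disc_level_iff[OF n] by blast
qed

theorem inner_expression_approximation:
  fixes f :: "('d::finite) mtuple \<Rightarrow> complex mat"
  assumes hol: "nc_holomorphic f" and bd: "\<forall>Z\<in>nc_disc. op_norm (f Z) \<le> 1"
  shows "\<exists>e. (\<forall>n\<ge>1. \<forall>Z\<in>nc_disc \<inter> nc_level n. \<exists>M\<in>carrier_mat n n. expr_eval e Z = Some M) \<and>
    (\<forall>n\<ge>1. \<forall>U\<in>unitary_tuples n. \<exists>W\<in>unitary_mats n. \<forall>i<n. \<forall>j<n.
      ((\<lambda>r. the (expr_eval e (\<lambda>i. complex_of_real r \<cdot>\<^sub>m U i)) $$ (i, j)) \<longlongrightarrow> W $$ (i, j)) (at_left 1)) \<and>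
    (\<forall>t n Z. 0 < t \<longrightarrow> t < 1 \<longrightarrow> n \<ge> 1 \<longrightarrow> Z \<in> nc_level n \<longrightarrow> tuple_norm Z \<le> t\<^sup>2 \<longrightarrow>
      op_norm (the (expr_eval e Z) - f Z) \<le> t ^ Suc N / sqrt (1 - t\<^sup>2) + t ^ Suc N / (1 - t))"
proof -
  have nc: "nc_function f" using hol by (simp add: nc_holomorphic_def)
  obtain a where a0: "\<forall>n\<ge>1. \<forall>X\<in>nc_disc \<inter> nc_level n.
    (\<forall>w x i. length w = Suc N \<longrightarrow> i < n \<longrightarrow> word_act n X w x i = 0) \<longrightarrow>
    (\<forall>x. \<forall>i<n. mat_act n (f X) x i = (\<Sum>w\<in>words N. a w * word_act n X w x i))"
    using nilpotent_calculus[OF nc] by blast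
  have a: "mat_act n (f X) x i = poly_act N a n X x i"
    if "n \<ge> 1" "X \<in> nc_disc \<inter> nc_level n" "\<And>w x i. length w = Suc N \<Longrightarrow> i < n \<Longrightarrow> word_act n X w x i = 0" "i < n" for n X x i
    unfolding poly_act_def using a0 that by blast
  obtain H where psd: "\<And>i. psd_on (words N) (H i)"
    and K: "\<And>w v. w \<in> words N \<Longrightarrow> v \<in> words N \<Longrightarrow> of_bool (w = []) * of_bool (v = []) - cnj (a w) * a v = defect N H w v"
    using schur_agler_defect[OF nc bd a] by blast
  define F where "F = insert None (Some ` ((UNIV :: 'd set) \<times> (words N :: 'd list set)))"
  have "\<exists>T (q :: 'd \<times> 'd list \<Rightarrow> 'd list \<Rightarrow> complex). isometric_on F T \<and>
    T None None = a [] \<and> (\<forall>s\<in>UNIV \<times> words N. T None (Some s) = q s []) \<and>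
    (\<forall>u i. length u < N \<longrightarrow> (\<Sum>j\<in>words N. q (i, j) u * T (Some (i, j)) None) = a (u @ [i]) \<and>
      (\<forall>s\<in>UNIV \<times> words N. (\<Sum>j\<in>words N. q (i, j) u * T (Some (i, j)) (Some s)) = q s (u @ [i])))"
    unfolding F_def by (rule unitary_realization[of N H a, OF psd K])
  then obtain T and q :: "'d \<times> 'd list \<Rightarrow> 'd list \<Rightarrow> complex" where iso: "isometric_on F T" and T00: "T None None = a []"
    and T0': "\<forall>s\<in>UNIV \<times> words N. T None (Some s) = q s []"
    and Tu: "\<forall>u i. length u < N \<longrightarrow> (\<Sum>j\<in>words N. q (i, j) u * T (Some (i, j)) None) = a (u @ [i]) \<and>
      (\<forall>s\<in>UNIV \<times> words N. (\<Sum>j\<in>words N. q (i, j) u * T (Some (i, j)) (Some s)) = q s (u @ [i]))"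
    by (elim exE conjE)
  have T0: "T None (Some s) = q s []" if "s \<in> UNIV \<times> words N" for s
    by (rule bspec[OF T0' that])
  have Ta: "(\<Sum>j\<in>words N. q (i, j) u * T (Some (i, j)) None) = a (u @ [i])" if "length u < N" for u i
    by (rule conjunct1[OF Tu[THEN spec, THEN spec, THEN mp, OF that]])
  have Tq: "(\<Sum>j\<in>words N. q (i, j) u * T (Some (i, j)) (Some s)) = q s (u @ [i])"
    if "length u < N" "s \<in> UNIV \<times> words N" for u i s
    by (rule bspec[OF conjunct2[OF Tu[THEN spec, THEN spec, THEN mp, OF that(1)]] that(2)])
  have F: "finite F" "None \<in> F" by (simp_all add: F_def)
  define lab where "lab = (\<lambda>c :: ('d \<times> 'd list) option. fst (the c))"
  obtain e where e: "\<forall>n\<ge>1. \<forall>Z\<in>nc_disc \<inter> nc_level n. \<exists>M\<in>carrier_mat n n. expr_eval e Z = Some M \<and>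
    (\<forall>u. \<exists>z. z None = u \<and> closed_loop F T (F - {None}) lab n Z z \<and>
      (\<forall>p<n. (response F T z None p) = mat_act n M u p))"
    using transfer_expression[OF F iso] by blast
  show ?thesis
  proof (intro exI[of _ e] conjI allI impI ballI)
    fix n :: nat and Z :: "'d mtuple" assume "1 \<le> n" "Z \<in> nc_disc \<inter> nc_level n"
    then show "\<exists>M\<in>carrier_mat n n. expr_eval e Z = Some M" using e by blast
  next
    fix n :: nat and U :: "'d mtuple" assume n: "1 \<le> n" and U: "U \<in> unitary_tuples n"
    define M where "M = (\<lambda>r. the (expr_eval e (\<lambda>i. complex_of_real r \<cdot>\<^sub>m U i)))"
    have Ui: "U i \<in> unitary_mats n" for i using U by (simp add: unitary_tuples_def)
    have "\<exists>W\<in>unitary_mats n. \<forall>i<n. \<forall>j<n. ((\<lambda>r. M r $$ (i, j)) \<longlongrightarrow> W $$ (i, j)) (at_left 1)"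
    proof (rule radial_limit_unitary[OF F iso Ui, where lab = lab and M = M])
      fix r :: real and u assume r: "0 < r" "r < 1"
      have "(\<lambda>i. complex_of_real r \<cdot>\<^sub>m U i) \<in> nc_disc \<inter> nc_level n"
        by (rule scaled_unitary_in_disc[OF n U]) (use r in auto)
      then obtain M' where M': "expr_eval e (\<lambda>i. complex_of_real r \<cdot>\<^sub>m U i) = Some M'"
        "\<exists>z. z None = u \<and> closed_loop F T (F - {None}) lab n (\<lambda>i. complex_of_real r \<cdot>\<^sub>m U i) z \<and>
          (\<forall>p<n. (response F T z None p) = mat_act n M' u p)"
        using e n by blast
      then show "\<exists>z. z None = u \<and> closed_loop F T (F - {None}) lab n (\<lambda>i. complex_of_real r \<cdot>\<^sub>m U i) z \<and>
          (\<forall>p<n. (response F T z None p) = mat_act n (M r) u p)"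
        by (simp add: M_def)
    qed
    then show "\<exists>W\<in>unitary_mats n. \<forall>i<n. \<forall>j<n.
      ((\<lambda>r. the (expr_eval e (\<lambda>i. complex_of_real r \<cdot>\<^sub>m U i)) $$ (i, j)) \<longlongrightarrow> W $$ (i, j)) (at_left 1)"
      by (simp only: M_def)
  next
    fix t :: real and n :: nat and Z :: "'d mtuple"
    assume t: "0 < t" "t < 1" and n: "1 \<le> n" and Z: "Z \<in> nc_level n" and Zt: "tuple_norm Z \<le> t\<^sup>2"
    have t2: "t\<^sup>2 < t" using t by (simp add: power2_eq_square)
    then have t21: "t\<^sup>2 < 1" using t by linarith
    have "tuple_norm Z < 1" using Zt t21 by linarith
    then have Zd: "Z \<in> nc_disc \<inter> nc_level n" using Z nc_disc_level_iff[OF n] by blast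
    obtain M where Mc: "M \<in> carrier_mat n n" and M: "expr_eval e Z = Some M"
      and loop: "\<And>u. \<exists>z. z None = u \<and> closed_loop F T (F - {None}) lab n Z z \<and>
        (\<forall>p<n. (response F T z None p) = mat_act n M u p)"
      using e n Zd by blast
    have fZ: "f Z \<in> carrier_mat n n" using nc n Zd unfolding nc_function_def by blast
    define A where "A = t ^ Suc N / sqrt (1 - t\<^sup>2)"
    define B where "B = t ^ Suc N / (1 - t)"
    have AB: "0 \<le> A" "0 \<le> B" using t t21 by (simp_all add: A_def B_def)
    have "op_norm (M - f Z) \<le> A + B"
    proof (rule op_norm_le)
      show "M - f Z \<in> carrier_mat n n" using fZ by (rule minus_carrier_mat)
      show "0 \<le> A + B" using AB by simp
      fix u
      define v where "v = (\<lambda>p. mat_act n M u p - poly_act N a n Z u p)"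
      define w where "w = (\<lambda>p. mat_act n (f Z) u p - poly_act N a n Z u p)"
      from loop[of u] obtain z where z: "z None = u" "closed_loop F T (F - {None}) lab n Z z"
        "\<And>p. p < n \<Longrightarrow> (response F T z None p) = mat_act n M u p" by blast
      have "nsq {..<n} v = nsq {..<n} (\<lambda>p. (response F T z None p) - poly_act N a n Z u p)"
        by (rule nsq_cong) (simp add: v_def z(3))
      also have "\<dots> \<le> (t ^ Suc N)\<^sup>2 / (1 - t\<^sup>2) * nsq {..<n} u"
        unfolding F_def
      proof (rule realization_approximates[OF iso[unfolded F_def] T00 T0 Ta Tq Z])
        show "tuple_norm Z \<le> t" "0 \<le> t" "t < 1" using Zt t t2 by linarith+
        show "z None p = u p" for p by (simp add: z(1))
        fix s :: "'d \<times> 'd list" and p assume "s \<in> UNIV \<times> words N" "p < n"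
        then show "z (Some s) p = mat_act n (Z (fst s)) (\<lambda>p. \<Sum>b\<in>insert None (Some ` (UNIV \<times> words N)). T (Some s) b * z b p) p"
          using z(2) unfolding closed_loop_def F_def lab_def by force
      qed
      also have "(t ^ Suc N)\<^sup>2 / (1 - t\<^sup>2) = A\<^sup>2" using t21 by (simp add: A_def power_divide)
      finally have v: "sqrt (nsq {..<n} v) \<le> A * sqrt (nsq {..<n} u)"
        using AB by (metis real_sqrt_le_mono real_sqrt_mult real_sqrt_abs abs_of_nonneg)
      have "nsq {..<n} w \<le> B\<^sup>2 * nsq {..<n} u"
        unfolding w_def B_def by (rule polynomial_approximation[OF hol bd a n Z Zt t])
      then have w: "sqrt (nsq {..<n} w) \<le> B * sqrt (nsq {..<n} u)"
        using AB by (metis real_sqrt_le_mono real_sqrt_mult real_sqrt_abs abs_of_nonneg)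
      have "nsq {..<n} (mat_act n (M - f Z) u) = nsq {..<n} (\<lambda>p. v p + (-1) * w p)"
      proof (rule nsq_cong)
        fix p assume "p \<in> {..<n}"
        then have "mat_act n (M - f Z) u p = mat_act n M u p - mat_act n (f Z) u p"
          unfolding act_def sum_subtractf[symmetric] using Mc fZ by (intro sum.cong) (auto simp: algebra_simps)
        then show "mat_act n (M - f Z) u p = v p + (-1) * w p" by (simp add: v_def w_def)
      qed
      then have "sqrt (nsq {..<n} (mat_act n (M - f Z) u)) \<le> sqrt (nsq {..<n} v) + sqrt (nsq {..<n} (\<lambda>p. (-1) * w p))"
        using sqrt_nsq_add[of "{..<n}" v "\<lambda>p. (-1) * w p"] by simp
      also have "\<dots> \<le> (A + B) * sqrt (nsq {..<n} u)"
        unfolding nsq_scale using v w by (simp add: algebra_simps)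
      finally have "(sqrt (nsq {..<n} (mat_act n (M - f Z) u)))\<^sup>2 \<le> ((A + B) * sqrt (nsq {..<n} u))\<^sup>2"
        by (rule power_mono) simp
      then show "nsq {..<n} (mat_act n (M - f Z) u) \<le> (A + B)\<^sup>2 * nsq {..<n} u"
        by (simp add: power_mult_distrib)
    qed
    then show "op_norm (the (expr_eval e Z) - f Z) \<le> t ^ Suc N / sqrt (1 - t\<^sup>2) + t ^ Suc N / (1 - t)"
      by (simp add: M A_def B_def)
  qed
qed

section \<open>Topology of the levels\<close>

lemma op_norm_le_add_entries:
  assumes A: "A \<in> carrier_mat n n" and B: "B \<in> carrier_mat n n"
  shows "op_norm A \<le> op_norm B + (\<Sum>p<n. \<Sum>q<n. cmod (A $$ (p, q) - B $$ (p, q)))"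
proof (rule op_norm_le[OF A])
  define D where "D = (\<Sum>p<n. \<Sum>q<n. cmod (A $$ (p, q) - B $$ (p, q)))"
  have D: "D \<ge> 0" by (simp add: D_def sum_nonneg)
  have B0: "op_norm B \<ge> 0" by (rule nsq_act_op_norm(2)[OF B])
  show "0 \<le> op_norm B + (\<Sum>p<n. \<Sum>q<n. cmod (A $$ (p, q) - B $$ (p, q)))"
    using B0 D by (simp add: D_def)
  fix x
  define s where "s = sqrt (nsq {..<n} x)"
  have s: "s \<ge> 0" by (simp add: s_def)
  have xq: "cmod (x q) \<le> s" if "q < n" for q
    using entry_le_nsq[of "{..<n}" q x] that by (simp add: s_def real_le_rsqrt)
  define d where "d = (\<lambda>p. \<Sum>q<n. (A $$ (p, q) - B $$ (p, q)) * x q)"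
  have "sqrt (nsq {..<n} d) \<le> (\<Sum>p<n. cmod (d p))"
    unfolding L2_set_nsq[symmetric] by (rule L2_set_le_sum) simp
  also have "\<dots> \<le> (\<Sum>p<n. \<Sum>q<n. cmod (A $$ (p, q) - B $$ (p, q)) * s)"
    unfolding d_def
  proof (rule sum_mono)
    fix p
    show "cmod (\<Sum>q<n. (A $$ (p, q) - B $$ (p, q)) * x q) \<le> (\<Sum>q<n. cmod (A $$ (p, q) - B $$ (p, q)) * s)"
      by (rule order_trans[OF norm_sum], rule sum_mono) (auto simp: norm_mult intro!: mult_left_mono xq)
  qed
  also have "\<dots> = D * s" by (simp add: D_def sum_distrib_right)
  finally have d: "sqrt (nsq {..<n} d) \<le> D * s" .
  have "nsq {..<n} (mat_act n B x) \<le> (op_norm B * s)\<^sup>2"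
    using nsq_act_op_norm(1)[OF B, of x] by (simp add: s_def power_mult_distrib)
  then have b: "sqrt (nsq {..<n} (mat_act n B x)) \<le> op_norm B * s"
    using B0 s by (simp add: real_le_lsqrt)
  have "mat_act n A x = (\<lambda>p. mat_act n B x p + d p)"
    by (simp add: act_def d_def algebra_simps sum_subtractf fun_eq_iff)
  then have "sqrt (nsq {..<n} (mat_act n A x)) \<le> sqrt (nsq {..<n} (mat_act n B x)) + sqrt (nsq {..<n} d)"
    using sqrt_nsq_add by metis
  also have "\<dots> \<le> (op_norm B + D) * s" using b d by (simp add: algebra_simps)
  finally have "(sqrt (nsq {..<n} (mat_act n A x)))\<^sup>2 \<le> ((op_norm B + D) * s)\<^sup>2"
    by (rule power_mono) simp
  then show "nsq {..<n} (mat_act n A x) \<le> (op_norm B + (\<Sum>p<n. \<Sum>q<n. cmod (A $$ (p, q) - B $$ (p, q))))\<^sup>2 * nsq {..<n} x"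
    by (simp add: D_def[symmetric] s_def power_mult_distrib)
qed

lemma topspace_mat_topology: "topspace (mat_topology n) = carrier_mat n n"
  by (simp add: mat_topology_def topspace_pullback_topology)

lemma topspace_tuple_topology: "topspace (tuple_topology n) = nc_level n"
  by (auto simp: tuple_topology_def topspace_mat_topology nc_level_def PiE_def)

lemma continuous_map_mat_entry:
  assumes "p < n" "q < n"
  shows "continuous_map (mat_topology n) euclidean (\<lambda>A. A $$ (p, q))"
proof -
  have "continuous_map euclidean euclidean (\<lambda>h :: nat \<times> nat \<Rightarrow> complex. h (p, q))"
    by (simp add: continuous_on_coordinate)
  then have "continuous_map (mat_topology n) euclidean
      ((\<lambda>h. h (p, q)) \<circ> (\<lambda>A (i, j). if i < n \<and> j < n then A $$ (i, j) else 0))"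
    unfolding mat_topology_def by (rule continuous_map_pullback)
  then show ?thesis using assms by (simp add: o_def)
qed

lemma openin_tuple_norm_less: "openin (tuple_topology n) {Z \<in> nc_level n. tuple_norm Z < c}"
proof (subst openin_subopen, intro ballI)
  fix B :: "'a mtuple" assume B: "B \<in> {Z \<in> nc_level n. tuple_norm Z < c}"
  define g where "g = (\<lambda>Z :: 'a mtuple. \<Sum>i\<in>UNIV. \<Sum>p<n. \<Sum>q<n. cmod (Z i $$ (p, q) - B i $$ (p, q)))"
  have entry: "continuous_map (tuple_topology n) euclidean (\<lambda>Z. Z i $$ (p, q))" if "p < n" "q < n" for i :: 'a and p q
  proof -
    have "continuous_map (tuple_topology n) (mat_topology n) (\<lambda>Z. Z i)"
      unfolding tuple_topology_def by (rule continuous_map_product_projection) simp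
    from continuous_map_compose[OF this continuous_map_mat_entry[OF that]] show ?thesis by (simp add: o_def)
  qed
  have "continuous_map (tuple_topology n) euclidean g"
    unfolding g_def
    by (intro continuous_map_sum continuous_map_norm continuous_map_diff entry) auto
  from openin_continuous_map_preimage[OF this, of "{..<c - tuple_norm B}"]
  have op: "openin (tuple_topology n) {Z \<in> nc_level n. g Z < c - tuple_norm B}"
    by (simp add: topspace_tuple_topology)
  moreover have "B \<in> {Z \<in> nc_level n. g Z < c - tuple_norm B}" using B by (simp add: g_def)
  moreover have "{Z \<in> nc_level n. g Z < c - tuple_norm B} \<subseteq> {Z \<in> nc_level n. tuple_norm Z < c}"
  proof
    fix Z assume "Z \<in> {Z \<in> nc_level n. g Z < c - tuple_norm B}"
    then have Z: "Z \<in> nc_level n" and gZ: "g Z < c - tuple_norm B" by auto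
    have "op_norm (Z i) < c" for i
    proof -
      have "op_norm (Z i) \<le> op_norm (B i) + (\<Sum>p<n. \<Sum>q<n. cmod (Z i $$ (p, q) - B i $$ (p, q)))"
        by (rule op_norm_le_add_entries) (use Z B in \<open>auto simp: nc_level_def\<close>)
      also have "\<dots> \<le> tuple_norm B + g Z"
        unfolding g_def
        by (intro add_mono op_norm_le_tuple_norm member_le_sum[where f = "\<lambda>i. \<Sum>p<n. \<Sum>q<n. cmod (Z i $$ (p, q) - B i $$ (p, q))"])
          (auto intro!: sum_nonneg)
      finally show ?thesis using gZ by linarith
    qed
    then show "Z \<in> {Z \<in> nc_level n. tuple_norm Z < c}" using Z by (simp add: tuple_norm_less_iff)
  qed
  ultimately show "\<exists>T. openin (tuple_topology n) T \<and> B \<in> T \<and> T \<subseteq> {Z \<in> nc_level n. tuple_norm Z < c}"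
    by blast
qed

text \<open>
  The sets on which the norm is less than \<open>c\<close>, for \<open>c < 1\<close>, form an open cover.
\<close>

lemma compact_level_norm_bound:
  assumes K: "compactin (tuple_topology n) K" and disc: "K \<subseteq> nc_disc"
  shows "\<exists>r<1. \<forall>Z\<in>K. tuple_norm Z \<le> r"
proof -
  define O' where "O' = (\<lambda>c. {Z :: 'a mtuple. Z \<in> nc_level n \<and> tuple_norm Z < c})"
  have sub: "K \<subseteq> nc_level n" using compactin_subset_topspace[OF K] by (simp add: topspace_tuple_topology)
  have "\<exists>\<F>. finite \<F> \<and> \<F> \<subseteq> O' ` {..<1} \<and> K \<subseteq> \<Union>\<F>"
  proof (rule compactinD[OF K])
    fix U assume "U \<in> O' ` {..<1}"
    then show "openin (tuple_topology n) U" using openin_tuple_norm_less by (auto simp: O'_def)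
  next
    show "K \<subseteq> \<Union> (O' ` {..<1})"
    proof
      fix Z assume Z: "Z \<in> K"
      then have "tuple_norm Z < 1" using disc by (auto simp: nc_disc_def)
      then obtain c where "tuple_norm Z < c" "c < 1" using dense by blast
      then show "Z \<in> \<Union> (O' ` {..<1})" using Z sub by (auto simp: O'_def)
    qed
  qed
  then obtain \<F> where \<F>: "finite \<F>" "\<F> \<subseteq> O' ` {..<1}" "K \<subseteq> \<Union>\<F>" by blast
  from finite_subset_image[OF \<F>(1,2)] obtain C where C: "C \<subseteq> {..<1}" "finite C" "\<F> = O' ` C" by blast
  have "\<forall>Z\<in>K. tuple_norm Z \<le> Max (insert 0 C)"
  proof
    fix Z assume "Z \<in> K"
    then obtain c where c: "c \<in> C" "tuple_norm Z < c" using \<F>(3) C(3) by (auto simp: O'_def)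
    then have "c \<le> Max (insert 0 C)" using C(2) by simp
    then show "tuple_norm Z \<le> Max (insert 0 C)" using c by simp
  qed
  moreover have "Max (insert 0 C) < 1" using C by auto
  ultimately show ?thesis by blast
qed

lemma limitin_mat_topology:
  assumes W: "W \<in> carrier_mat n n" and ev: "\<forall>\<^sub>F r in F. M r \<in> carrier_mat n n"
    and lim: "\<And>i j. i < n \<Longrightarrow> j < n \<Longrightarrow> ((\<lambda>r. M r $$ (i, j)) \<longlongrightarrow> W $$ (i, j)) F"
  shows "limitin (mat_topology n) M W F"
proof -
  define h where "h = (\<lambda>(A :: complex mat) (i, j). if i < n \<and> j < n then A $$ (i, j) else 0)"
  have "limitin (product_topology (\<lambda>_. euclidean) UNIV) (\<lambda>r. h (M r)) (h W) F"
    unfolding limitin_componentwise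
  proof (intro conjI ballI)
    fix k :: "nat \<times> nat"
    obtain i j where k: "k = (i, j)" by (cases k)
    show "limitin euclidean (\<lambda>r. h (M r) k) (h W k) F"
      using lim[of i j] by (cases "i < n \<and> j < n") (auto simp: k h_def)
  qed auto
  then have tend: "((\<lambda>r. h (M r)) \<longlongrightarrow> h W) F" by (simp add: euclidean_product_topology)
  show ?thesis
    unfolding limitin_def topspace_mat_topology
  proof (intro conjI allI impI W)
    fix V assume V: "openin (mat_topology n) V \<and> W \<in> V"
    then obtain O' where O': "open O'" "V = h -` O' \<inter> carrier_mat n n"
      unfolding mat_topology_def openin_pullback_topology h_def by auto
    have "\<forall>\<^sub>F r in F. h (M r) \<in> O'" using tend O' V by (intro topological_tendstoD) auto
    with ev show "\<forall>\<^sub>F r in F. M r \<in> V" by eventually_elim (simp add: O'(2))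
  qed
qed

section \<open>Approximation by rational inner functions\<close>

text \<open>
  Any two members of the class of \<open>e\<close> that are defined at a point of the domain of \<open>e\<close> agree there with \<open>e\<close>, so the value
  does not depend on the representative.
\<close>

lemma rat_eval_class:
  assumes "Z \<in> expr_domain e"
  shows "rat_eval (expr_rel `` {e}) Z = the (expr_eval e Z)" and "e \<in> expr_rel `` {e}"
proof -
  show mem: "e \<in> expr_rel `` {e}" using assms by (auto simp: expr_rel_def)
  show "rat_eval (expr_rel `` {e}) Z = the (expr_eval e Z)"
    unfolding rat_eval_def
  proof (rule the_equality)
    show "\<exists>r\<in>expr_rel `` {e}. Z \<in> expr_domain r \<and> expr_eval r Z = Some (the (expr_eval e Z))"
      using mem assms by (intro bexI[of _ e]) (auto simp: expr_domain_def)
    fix W assume "\<exists>r\<in>expr_rel `` {e}. Z \<in> expr_domain r \<and> expr_eval r Z = Some W"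
    then obtain r where r: "(e, r) \<in> expr_rel" "Z \<in> expr_domain r" "expr_eval r Z = Some W" by blast
    then have "expr_eval e Z = expr_eval r Z" using assms by (auto simp: expr_rel_def)
    then show "W = the (expr_eval e Z)" using r by simp
  qed
qed

lemma nc_inner_class:
  fixes e :: "('d::finite) nc_expr"
  assumes ev: "\<And>n Z. n \<ge> 1 \<Longrightarrow> Z \<in> nc_disc \<inter> nc_level n \<Longrightarrow> \<exists>M\<in>carrier_mat n n. expr_eval e Z = Some M"
    and bdry: "\<And>n U. n \<ge> 1 \<Longrightarrow> U \<in> unitary_tuples n \<Longrightarrow> \<exists>W\<in>unitary_mats n. \<forall>i<n. \<forall>j<n.
      ((\<lambda>r. the (expr_eval e (\<lambda>i. complex_of_real r \<cdot>\<^sub>m U i)) $$ (i, j)) \<longlongrightarrow> W $$ (i, j)) (at_left 1)"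
  shows "nc_inner (expr_rel `` {e})" and "nc_disc \<subseteq> expr_domain e"
proof -
  show dom: "nc_disc \<subseteq> expr_domain e"
  proof
    fix Z :: "'d mtuple" assume Z: "Z \<in> nc_disc"
    then obtain n where n: "n \<ge> 1" "Z \<in> nc_level n" by (auto simp: nc_disc_def nc_space_def)
    then show "Z \<in> expr_domain e" using ev[OF n(1)] Z by (auto simp: expr_domain_def nc_disc_def)
  qed
  have one: "(\<lambda>_. 1\<^sub>m 1) \<in> unitary_tuples 1"
  proof -
    have "mat_adjoint (1\<^sub>m 1) = (1\<^sub>m 1 :: complex mat)"
    proof (rule eq_matI)
      fix i j assume "i < dim_row (1\<^sub>m 1 :: complex mat)" "j < dim_col (1\<^sub>m 1 :: complex mat)"
      then show "mat_adjoint (1\<^sub>m 1) $$ (i, j) = (1\<^sub>m 1 :: complex mat) $$ (i, j)"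
        using mat_adjoint_entry[OF one_carrier_mat[of 1], of i j] by simp
    qed (use mat_adjoint_carrier[OF one_carrier_mat[of 1]] in auto)
    then show ?thesis by (simp add: unitary_tuples_def unitary_mats_def)
  qed
  have "(\<lambda>i. complex_of_real 0 \<cdot>\<^sub>m (\<lambda>_::'d. 1\<^sub>m 1) i) \<in> nc_disc \<inter> nc_level 1"
    by (rule scaled_unitary_in_disc[OF _ one]) auto
  then have ne: "expr_domain e \<noteq> {}" using dom by blast
  show "nc_inner (expr_rel `` {e})"
    unfolding nc_inner_def
  proof (intro conjI allI impI)
    show "expr_rel `` {e} \<in> nc_rational_functions"
      unfolding nc_rational_functions_def by (rule quotientI) (use ne in simp)
    show "nc_disc \<subseteq> rat_domain (expr_rel `` {e})"
      using dom rat_eval_class(2) unfolding rat_domain_def by blast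
    fix n :: nat and \<mu> :: "'d mtuple measure" assume n: "1 \<le> n" and \<mu>: "is_haar_measure n \<mu>"
    show "AE U in \<mu>. \<exists>W\<in>unitary_mats n. limitin (mat_topology n) (\<lambda>r. rat_eval (expr_rel `` {e}) (\<lambda>i. complex_of_real r \<cdot>\<^sub>m U i)) W (at_left 1)"
    proof (rule AE_I2)
      fix U assume "U \<in> space \<mu>"
      then have U: "U \<in> unitary_tuples n" using \<mu> by (simp add: is_haar_measure_def)
      define M where "M = (\<lambda>r. the (expr_eval e (\<lambda>i. complex_of_real r \<cdot>\<^sub>m U i)))"
      define M' where "M' = (\<lambda>r. rat_eval (expr_rel `` {e}) (\<lambda>i. complex_of_real r \<cdot>\<^sub>m U i))"
      from bdry[OF n U] obtain W where W: "W \<in> unitary_mats n"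
        and lim: "\<And>i j. i < n \<Longrightarrow> j < n \<Longrightarrow> ((\<lambda>r. M r $$ (i, j)) \<longlongrightarrow> W $$ (i, j)) (at_left 1)"
        by (auto simp: M_def)
      have eq: "M' r = M r \<and> M' r \<in> carrier_mat n n" if "0 \<le> r" "r < 1" for r
      proof -
        have d: "(\<lambda>i. complex_of_real r \<cdot>\<^sub>m U i) \<in> nc_disc \<inter> nc_level n" by (rule scaled_unitary_in_disc[OF n U that])
        then have "M' r = M r" unfolding M'_def M_def by (intro rat_eval_class(1)) (use dom in auto)
        moreover have "M r \<in> carrier_mat n n" using ev[OF n d] by (auto simp: M_def)
        ultimately show ?thesis by simp
      qed
      have near: "\<forall>\<^sub>F r::real in at_left 1. 0 \<le> r \<and> r < 1"
        using eventually_at_left_field[of "\<lambda>r. 0 \<le> r \<and> r < 1" "1::real"] by (auto intro!: exI[of _ 0])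
      have "limitin (mat_topology n) M' W (at_left 1)"
      proof (rule limitin_mat_topology)
        show "W \<in> carrier_mat n n" using W by (simp add: unitary_mats_def)
        show "\<forall>\<^sub>F r in at_left 1. M' r \<in> carrier_mat n n" using near by eventually_elim (use eq in blast)
        fix i j assume ij: "i < n" "j < n"
        have "\<forall>\<^sub>F r in at_left 1. M r $$ (i, j) = M' r $$ (i, j)" using near by eventually_elim (use eq in auto)
        with lim[OF ij] show "((\<lambda>r. M' r $$ (i, j)) \<longlongrightarrow> W $$ (i, j)) (at_left 1)"
          by (rule Lim_transform_eventually)
      qed
      then show "\<exists>W\<in>unitary_mats n. limitin (mat_topology n) (\<lambda>r. rat_eval (expr_rel `` {e}) (\<lambda>i. complex_of_real r \<cdot>\<^sub>m U i)) W (at_left 1)"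
        using W unfolding M'_def by blast
    qed
  qed
qed

theorem theorem3:
  fixes f :: "('d::finite) mtuple \<Rightarrow> complex mat"
  assumes "nc_holomorphic f"
    and "\<forall>Z\<in>nc_disc. op_norm (f Z) \<le> 1"
  shows "\<exists>\<Theta> :: nat \<Rightarrow> 'd nc_expr set.
    (\<forall>m\<ge>1. nc_inner (\<Theta> m)) \<and>
    (\<forall>K\<subseteq>nc_disc. levelwise_compact K \<longrightarrow>
       (\<forall>n\<ge>1. nc_uniform_limit_on (K \<inter> nc_level n) (\<lambda>m. rat_eval (\<Theta> m)) f) \<and>
       ((\<exists>r<1. \<forall>Z\<in>K. tuple_norm Z \<le> r) \<longrightarrow>
          nc_uniform_limit_on K (\<lambda>m. rat_eval (\<Theta> m)) f))"
proof -
  from choice[OF allI[OF inner_expression_approximation[OF assms]]] obtain e where e: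
    "\<forall>N. (\<forall>n\<ge>1. \<forall>Z\<in>nc_disc \<inter> nc_level n. \<exists>M\<in>carrier_mat n n. expr_eval (e N) Z = Some M) \<and>
    (\<forall>n\<ge>1. \<forall>U\<in>unitary_tuples n. \<exists>W\<in>unitary_mats n. \<forall>i<n. \<forall>j<n.
      ((\<lambda>r. the (expr_eval (e N) (\<lambda>i. complex_of_real r \<cdot>\<^sub>m U i)) $$ (i, j)) \<longlongrightarrow> W $$ (i, j)) (at_left 1)) \<and>
    (\<forall>t n Z. 0 < t \<longrightarrow> t < 1 \<longrightarrow> n \<ge> 1 \<longrightarrow> Z \<in> nc_level n \<longrightarrow> tuple_norm Z \<le> t\<^sup>2 \<longrightarrow>
      op_norm (the (expr_eval (e N) Z) - f Z) \<le> t ^ Suc N / sqrt (1 - t\<^sup>2) + t ^ Suc N / (1 - t))" ..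
  \<comment> \<open>The degree \<open>N\<close> of interpolation serves as the index of the sequence.\<close>
  define \<Theta> where "\<Theta> = (\<lambda>m. expr_rel `` {e m})"
  have ev: "\<exists>M\<in>carrier_mat n n. expr_eval (e m) Z = Some M" if "n \<ge> 1" "Z \<in> nc_disc \<inter> nc_level n" for m n Z
    using conjunct1[OF spec[OF e, of m]] that by blast
  have bdry: "\<exists>W\<in>unitary_mats n. \<forall>i<n. \<forall>j<n.
      ((\<lambda>r. the (expr_eval (e m) (\<lambda>i. complex_of_real r \<cdot>\<^sub>m U i)) $$ (i, j)) \<longlongrightarrow> W $$ (i, j)) (at_left 1)"
    if "n \<ge> 1" "U \<in> unitary_tuples n" for m n U
    using conjunct1[OF conjunct2[OF spec[OF e, of m]]] that by blast
  have approx: "op_norm (the (expr_eval (e m) Z) - f Z) \<le> t ^ Suc m / sqrt (1 - t\<^sup>2) + t ^ Suc m / (1 - t)"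
    if "0 < t" "t < 1" "n \<ge> 1" "Z \<in> nc_level n" "tuple_norm Z \<le> t\<^sup>2" for t n m Z
    using conjunct2[OF conjunct2[OF spec[OF e, of m]]] that by blast
  have inner: "nc_inner (\<Theta> m)" and dom: "nc_disc \<subseteq> expr_domain (e m)" for m
    unfolding \<Theta>_def using nc_inner_class[of "e m", OF ev bdry] by blast+
  have uniform: "nc_uniform_limit_on K (\<lambda>m. rat_eval (\<Theta> m)) f"
    if K: "K \<subseteq> nc_disc" and r: "r < 1" "\<forall>Z\<in>K. tuple_norm Z \<le> r" for K r
    unfolding nc_uniform_limit_on_def
  proof (intro allI impI)
    fix \<epsilon> :: real assume "\<epsilon> > 0"
    \<comment> \<open>The estimates are stated for \<open>tuple_norm Z \<le> t\<^sup>2\<close> with \<open>t > 0\<close>; the maximum covers \<open>r \<le> 0\<close>.\<close>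
    define t where "t = sqrt (max r (1/2))"
    have t: "0 < t" "t < 1" "t\<^sup>2 = max r (1/2)" using r by (auto simp: t_def)
    have "(\<lambda>m. t ^ Suc m / sqrt (1 - t\<^sup>2) + t ^ Suc m / (1 - t)) \<longlonglongrightarrow> 0 / sqrt (1 - t\<^sup>2) + 0 / (1 - t)"
      using t by (intro tendsto_intros LIMSEQ_Suc LIMSEQ_realpow_zero) (auto simp: power2_eq_1_iff)
    then have "(\<lambda>m. t ^ Suc m / sqrt (1 - t\<^sup>2) + t ^ Suc m / (1 - t)) \<longlonglongrightarrow> 0" by simp
    then have "\<forall>\<^sub>F m in sequentially. t ^ Suc m / sqrt (1 - t\<^sup>2) + t ^ Suc m / (1 - t) < \<epsilon>"
      by (rule order_tendstoD(2)) fact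
    then show "\<forall>\<^sub>F m in sequentially. \<forall>Z\<in>K. op_norm (rat_eval (\<Theta> m) Z - f Z) < \<epsilon>"
    proof eventually_elim
      fix m assume m: "t ^ Suc m / sqrt (1 - t\<^sup>2) + t ^ Suc m / (1 - t) < \<epsilon>"
      show "\<forall>Z\<in>K. op_norm (rat_eval (\<Theta> m) Z - f Z) < \<epsilon>"
      proof
        fix Z assume Z: "Z \<in> K"
        then have Zd: "Z \<in> nc_disc" using K by blast
        then obtain n where n: "n \<ge> 1" "Z \<in> nc_level n" by (auto simp: nc_disc_def nc_space_def)
        have "tuple_norm Z \<le> t\<^sup>2" using r(2) Z unfolding t(3) by fastforce
        from approx[OF t(1,2) n this, of m] m
        have "op_norm (the (expr_eval (e m) Z) - f Z) < \<epsilon>" by linarith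
        then show "op_norm (rat_eval (\<Theta> m) Z - f Z) < \<epsilon>"
          unfolding \<Theta>_def rat_eval_class(1)[OF subsetD[OF dom Zd]] .
      qed
    qed
  qed
  show ?thesis
  proof (intro exI[of _ \<Theta>] conjI allI impI)
    show "nc_inner (\<Theta> m)" for m by (rule inner)
    fix K :: "'d mtuple set" assume K: "K \<subseteq> nc_disc" and c: "levelwise_compact K"
    {
      fix n :: nat assume "1 \<le> n"
      then have "compactin (tuple_topology n) (K \<inter> nc_level n)" using c by (simp add: levelwise_compact_def)
      then obtain r where "r < 1" "\<forall>Z\<in>K \<inter> nc_level n. tuple_norm Z \<le> r"
        using compact_level_norm_bound[of n "K \<inter> nc_level n"] K by blast
      then show "nc_uniform_limit_on (K \<inter> nc_level n) (\<lambda>m. rat_eval (\<Theta> m)) f"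
        using K by (intro uniform) auto
    }
    assume "\<exists>r<1. \<forall>Z\<in>K. tuple_norm Z \<le> r"
    then show "nc_uniform_limit_on K (\<lambda>m. rat_eval (\<Theta> m)) f" using uniform[OF K] by blast
  qed
qed

end
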